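(* Let $m$ be a positive integer, let $K\in C^{[m]}(I^2)$ be independent of $\kappa$ and let $f\in\tilde H^m_{\kappa,0}(I)$. Suppose that for every $\kappa>1$ the equation $y(s)-\int_IK(s,t)e^{i\kappa|s-t|}y(t)\,dt=f(s)$, $s\in I$, has a unique solution $y=y_\kappa\in C(I)$. Then $y\in\tilde H^m_{\kappa,0}(I)$.
   Context: $I=[-1,1]$; $\kappa\in(1,\infty)$; functions are complex-valued; a $\kappa$-parameterized function is a family indexed by $\kappa>1$; "independent of $\kappa$" means a fixed function. $C^{[m]}(I^2)$: functions on $I^2$ with continuous $\partial_s^\alpha\partial_t^\beta$ derivatives, $\alpha,\beta\le m$. $H^m(I)$ is the Sobolev space with $\|u\|_{H^m}=(\sum_{j=0}^m\|u^{(j)}\|_{L^2(I)}^2)^{1/2}$. $H^m_{\kappa,0}(I)$: $\kappa$-parameterized $u$ with $u\in H^m(I)$ for every $\kappa$ and positive constants $c,\kappa_0$ with $\|u\|_{H^m}\le c$ for all $\kappa\ge\kappa_0$. $\tilde H^m_{\kappa,0}(I)=\{u_0+u_1e^{i\kappa t}+u_2e^{-i\kappa t}:u_0,u_1,u_2\in H^m_{\kappa,0}(I)\}$. *)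

theory Defs
  imports "HOL-Analysis.Analysis"
begin

abbreviation II :: "real set" where "II \<equiv> {-1..1}"

definition L2_I :: "(real \<Rightarrow> complex) \<Rightarrow> bool" where
  "L2_I g \<longleftrightarrow> g \<in> borel_measurable (lebesgue_on II) \<and>
     integrable (lebesgue_on II) (\<lambda>x. (norm (g x))^2)"

definition L2_norm_sq_I :: "(real \<Rightarrow> complex) \<Rightarrow> real" where
  "L2_norm_sq_I g = integral\<^sup>L (lebesgue_on II) (\<lambda>x. (norm (g x))^2)"

definition test_fun :: "(real \<Rightarrow> real) \<Rightarrow> bool" where
  "test_fun \<phi> \<longleftrightarrow>
     (\<forall>k x. ((deriv ^^ k) \<phi> has_real_derivative (deriv ^^ Suc k) \<phi> x) (at x)) \<and>
     (\<exists>a b. -1 < a \<and> b < 1 \<and> (\<forall>x. x \<notin> {a..b} \<longrightarrow> \<phi> x = 0))"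

definition weak_deriv_I :: "(real \<Rightarrow> complex) \<Rightarrow> (real \<Rightarrow> complex) \<Rightarrow> bool" where
  "weak_deriv_I g h \<longleftrightarrow> (\<forall>\<phi>. test_fun \<phi> \<longrightarrow>
     integral\<^sup>L (lebesgue_on II) (\<lambda>x. g x * complex_of_real (deriv \<phi> x)) =
     - integral\<^sup>L (lebesgue_on II) (\<lambda>x. h x * complex_of_real (\<phi> x)))"

definition H_bound :: "nat \<Rightarrow> (real \<Rightarrow> complex) \<Rightarrow> real \<Rightarrow> bool" where
  "H_bound m u c \<longleftrightarrow> (\<exists>g :: nat \<Rightarrow> real \<Rightarrow> complex.
     g 0 = u \<and> (\<forall>j\<le>m. L2_I (g j)) \<and> (\<forall>j<m. weak_deriv_I (g j) (g (Suc j))) \<and>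
     sqrt (\<Sum>j\<le>m. L2_norm_sq_I (g j)) \<le> c)"

definition sobolev_H :: "nat \<Rightarrow> (real \<Rightarrow> complex) \<Rightarrow> bool" where
  "sobolev_H m u \<longleftrightarrow> (\<exists>c. H_bound m u c)"

definition H_kappa0 :: "nat \<Rightarrow> (real \<Rightarrow> real \<Rightarrow> complex) \<Rightarrow> bool" where
  "H_kappa0 m u \<longleftrightarrow> (\<forall>\<kappa>>1. sobolev_H m (u \<kappa>)) \<and>
     (\<exists>c>0. \<exists>\<kappa>0>0. \<forall>\<kappa>. \<kappa> > 1 \<and> \<kappa> \<ge> \<kappa>0 \<longrightarrow> H_bound m (u \<kappa>) c)"

definition Htilde_kappa0 :: "nat \<Rightarrow> (real \<Rightarrow> real \<Rightarrow> complex) \<Rightarrow> bool" where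
  "Htilde_kappa0 m u \<longleftrightarrow> (\<exists>u0 u1 u2. H_kappa0 m u0 \<and> H_kappa0 m u1 \<and> H_kappa0 m u2 \<and>
     (\<forall>\<kappa>>1. \<forall>t\<in>II. u \<kappa> t = u0 \<kappa> t + u1 \<kappa> t * exp (\<i> * of_real (\<kappa> * t))
                                  + u2 \<kappa> t * exp (- \<i> * of_real (\<kappa> * t))))"

text \<open>K \<in> C^[m](I^2): D \<alpha> \<beta> = \<partial>_s^\<alpha> \<partial>_t^\<beta> K exists and is continuous on I^2 for \<alpha>,\<beta> \<le> m
  (one-sided derivatives at the boundary).\<close>
definition C_bracket :: "nat \<Rightarrow> (real \<Rightarrow> real \<Rightarrow> complex) \<Rightarrow> bool" where
  "C_bracket m K \<longleftrightarrow> (\<exists>D :: nat \<Rightarrow> nat \<Rightarrow> real \<Rightarrow> real \<Rightarrow> complex.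
     (\<forall>s\<in>II. \<forall>t\<in>II. D 0 0 s t = K s t) \<and>
     (\<forall>\<beta><m. \<forall>s\<in>II. \<forall>t\<in>II.
        ((\<lambda>t'. D 0 \<beta> s t') has_vector_derivative D 0 (Suc \<beta>) s t) (at t within II)) \<and>
     (\<forall>\<alpha><m. \<forall>\<beta>\<le>m. \<forall>s\<in>II. \<forall>t\<in>II.
        ((\<lambda>s'. D \<alpha> \<beta> s' t) has_vector_derivative D (Suc \<alpha>) \<beta> s t) (at s within II)) \<and>
     (\<forall>\<alpha>\<le>m. \<forall>\<beta>\<le>m. continuous_on (II \<times> II) (\<lambda>(s,t). D \<alpha> \<beta> s t)))"

definition solves_IE :: "(real \<Rightarrow> real \<Rightarrow> complex) \<Rightarrow> real \<Rightarrow> (real \<Rightarrow> complex) \<Rightarrow> (real \<Rightarrow> complex) \<Rightarrow> bool" where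
  "solves_IE K \<kappa> g z \<longleftrightarrow> (\<forall>s\<in>II.
     z s - integral\<^sup>L (lebesgue_on II) (\<lambda>t. K s t * exp (\<i> * of_real (\<kappa> * \<bar>s - t\<bar>)) * z t) = g s)"

end

theory Submission
  imports Defs "HOL-Computational_Algebra.Polynomial"
begin

text \<open>Split the integral operator into its parts \<open>A\<close> (\<open>t \<le> s\<close>) and \<open>B\<close> (\<open>t \<ge> s\<close>). Up to the phases
  \<open>e\<^bsup>i\<kappa>s\<^esup>\<close> both are Volterra operators, so \<open>A\<^sup>n\<close> and \<open>B\<^sup>n\<close> smooth and decay like \<open>1/n!\<close>, whereas \<open>AB\<close> and
  \<open>BA\<close> are \<open>O(1/\<kappa>)\<close> by integration by parts. Hence \<open>(A+B)\<^sup>n = A\<^sup>n + B\<^sup>n + O(1/\<kappa>)\<close>, and the expansion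
  \<open>y = \<Sum>\<^bsub>n<N\<^esub> (A+B)\<^sup>n f + (A+B)\<^sup>N y\<close> first bounds \<open>y\<close> uniformly for large \<open>\<kappa>\<close>. In the same expansion the
  terms with \<open>f\<close> stay in the oscillatory space, because \<open>A\<close> and \<open>B\<close> preserve it; and for \<open>N = m + m\<^sup>2\<close> the
  last term lies in it too: runs of \<open>m\<close> equal factors are smooth after removing a phase, and \<open>m\<close> changes
  between \<open>A\<close> and \<open>B\<close> produce a factor \<open>\<kappa>\<^sup>-\<^sup>m\<close>, which compensates for \<open>m\<close> derivatives of any size \<open>O(\<kappa>\<^sup>m)\<close>.\<close>

section \<open>Integration by parts for absolutely continuous functions\<close>

text \<open>Two kinds of bounds are kept apart. In
  \<open>CB l (\<lambda>j. B * \<kappa> ^ j)\<close> every derivative may cost a factor \<kappa>;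
  phases are harmless there, and remainders are estimated in this scale. In \<open>CT\<close> and
  \<open>HT\<close> the amplitudes of the frequencies \<open>0\<close>, \<open>\<kappa>\<close>,
  \<open>- \<kappa>\<close> are bounded independently of \<kappa>, and integration must be shown to
  create no other frequency. The difficulty is an integral whose phase does not cancel: the boundary
  terms of repeated integration by parts contain derivatives of the amplitude \<open>w\<close> that
  cannot be differentiated \<open>m\<close> more times, as \<open>w\<close> has only
  \<open>m\<close> derivatives. The amplitude is therefore obtained as one particular solution of a
  first order differential equation, whose derivatives are bounded from the top order downwards. A
  second difficulty is that the amplitudes of \<open>f\<close> agree with continuous functions only
  almost everywhere; since the equation makes \<open>f\<close> continuous, these functions can
  replace them. Reflection \<open>t \<mapsto> - t\<close> reduces the estimates for \<open>B\<close>
  to those for \<open>A\<close>.\<close>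

lemma integrable_iff_abs:
  fixes g :: "real \<Rightarrow> complex"
  shows "integrable (lebesgue_on {a..b}) g \<longleftrightarrow> g absolutely_integrable_on {a..b}"
  by (simp add: absolutely_integrable_on_def set_integrable_def integrable_restrict_space)

text \<open>The integrand \<open>p x * h t\<close>, cut off to the triangle
  \<open>t \<le> x\<close>, is dominated by the full product, which is integrable on the square.
  This swap does the work of differentiating the primitive of \<open>h\<close>, which is possible
  only almost everywhere.\<close>

lemma fubini_triangle:
  fixes p h :: "real \<Rightarrow> complex"
  assumes "continuous_on {a..b} p" and h: "h absolutely_integrable_on {a..b}"
  shows "integral {a..b} (\<lambda>x. p x * integral {a..x} h) = integral {a..b} (\<lambda>t. h t * integral {t..b} p)"
    and "(\<lambda>t. h t * integral {t..b} p) absolutely_integrable_on {a..b}"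
proof -
  let ?M = "lebesgue_on {a..b}"
  interpret finite_measure ?M by (rule finite_measure_lebesgue_on) auto
  interpret pair_sigma_finite ?M ?M ..
  have pi: "integrable ?M p" using assms(1)
    by (simp add: integrable_iff_abs absolutely_integrable_continuous_real)
  have hi: "integrable ?M h" using h by (simp add: integrable_iff_abs)
  have [measurable]: "p \<in> borel_measurable ?M" "h \<in> borel_measurable ?M" using pi hi by auto
  have prod: "integrable (?M \<Otimes>\<^sub>M ?M) (\<lambda>(x,t). p x * h t)"
    by (rule Fubini_integrable) (use pi hi in \<open>auto simp: norm_mult\<close>)
  \<comment> \<open>Makes the triangle measurable in the product of the two restricted measure
    spaces.\<close>
  have id[measurable]: "(\<lambda>x::real. x) \<in> ?M \<rightarrow>\<^sub>M borel"
    by (rule continuous_imp_measurable_on_sets_lebesgue) auto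
  let ?f = "\<lambda>x t. (if t \<le> x then p x * h t else 0)"
  have int: "integrable (?M \<Otimes>\<^sub>M ?M) (\<lambda>(x,t). ?f x t)"
    by (rule Bochner_Integration.integrable_bound[OF prod]) (auto simp: split_beta)
  have fub: "(\<integral>t. (\<integral>x. ?f x t \<partial>?M) \<partial>?M) = (\<integral>x. (\<integral>t. ?f x t \<partial>?M) \<partial>?M)"
    by (rule Fubini_integral[OF int])
  have i1: "integrable ?M (\<lambda>t. \<integral>x. ?f x t \<partial>?M)" by (rule integrable_snd[OF int])
  have i2: "integrable ?M (\<lambda>x. \<integral>t. ?f x t \<partial>?M)" by (rule integrable_fst[OF int])
  have e1: "(\<integral>t. ?f x t \<partial>?M) = p x * integral {a..x} h" if x: "x \<in> {a..b}" for x
  proof -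
    have hx: "h absolutely_integrable_on {a..x}"
      using absolutely_integrable_on_subinterval[OF h] x by auto
    have "(\<integral>t. ?f x t \<partial>?M) = (\<integral>t. p x * (indicator {a..x} t *\<^sub>R h t) \<partial>?M)"
      by (rule Bochner_Integration.integral_cong) (use x in \<open>auto simp: indicator_def\<close>)
    also have "\<dots> = p x * (\<integral>t. indicator {a..x} t *\<^sub>R h t \<partial>?M)" by (rule integral_mult_right_zero)
    also have "(\<integral>t. indicator {a..x} t *\<^sub>R h t \<partial>?M) = (\<integral>t. h t \<partial>lebesgue_on {a..x})"
      by (simp add: integral_restrict_space) (rule Bochner_Integration.integral_cong, use x in \<open>auto simp: indicator_def\<close>)
    also have "\<dots> = integral {a..x} h"
      by (rule lebesgue_integral_eq_integral) (use hx in \<open>auto simp: integrable_iff_abs\<close>)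
    finally show ?thesis .
  qed
  have e2: "(\<integral>x. ?f x t \<partial>?M) = h t * integral {t..b} p" if x: "t \<in> {a..b}" for t
  proof -
    have hx: "p absolutely_integrable_on {t..b}"
      by (rule absolutely_integrable_continuous_real) (use x assms(1) in \<open>auto intro: continuous_on_subset\<close>)
    have "(\<integral>x. ?f x t \<partial>?M) = (\<integral>x. h t * (indicator {t..b} x *\<^sub>R p x) \<partial>?M)"
      by (rule Bochner_Integration.integral_cong) (use x in \<open>auto simp: indicator_def\<close>)
    also have "\<dots> = h t * (\<integral>x. indicator {t..b} x *\<^sub>R p x \<partial>?M)" by (rule integral_mult_right_zero)
    also have "(\<integral>x. indicator {t..b} x *\<^sub>R p x \<partial>?M) = (\<integral>x. p x \<partial>lebesgue_on {t..b})"
      by (simp add: integral_restrict_space) (rule Bochner_Integration.integral_cong, use x in \<open>auto simp: indicator_def\<close>)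
    also have "\<dots> = integral {t..b} p"
      by (rule lebesgue_integral_eq_integral) (use hx in \<open>auto simp: integrable_iff_abs\<close>)
    finally show ?thesis .
  qed
  have i1': "integrable ?M (\<lambda>t. h t * integral {t..b} p)"
    using i1 by (rule Bochner_Integration.integrable_cong[OF refl, THEN iffD1, rotated]) (simp add: e2)
  then show "(\<lambda>t. h t * integral {t..b} p) absolutely_integrable_on {a..b}"
    by (simp add: integrable_iff_abs)
  have i2': "integrable ?M (\<lambda>x. p x * integral {a..x} h)"
    using i2 by (rule Bochner_Integration.integrable_cong[OF refl, THEN iffD1, rotated]) (simp add: e1)
  have "(\<integral>x. (\<integral>t. ?f x t \<partial>?M) \<partial>?M) = (\<integral>x. p x * integral {a..x} h \<partial>?M)"
    by (rule Bochner_Integration.integral_cong) (auto simp: e1)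
  moreover have "(\<integral>t. (\<integral>x. ?f x t \<partial>?M) \<partial>?M) = (\<integral>t. h t * integral {t..b} p \<partial>?M)"
    by (rule Bochner_Integration.integral_cong) (auto simp: e2)
  ultimately show "integral {a..b} (\<lambda>x. p x * integral {a..x} h) = integral {a..b} (\<lambda>t. h t * integral {t..b} p)"
    using fub lebesgue_integral_eq_integral[OF i1'] lebesgue_integral_eq_integral[OF i2'] by simp
qed

text \<open>Up to the constant \<open>w a\<close>, \<open>w\<close> is the primitive of
  \<open>h\<close>, so \<open>fubini_triangle\<close> turns the integral of \<open>q' * w\<close>
  into one in which only \<open>q'\<close> is integrated, where the fundamental theorem applies.
  \<open>w\<close> itself is never differentiated.\<close>

lemma ac_by_parts:
  fixes q q' w h :: "real \<Rightarrow> complex"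
  assumes "a \<le> b"
    and q: "\<And>x. x \<in> {a..b} \<Longrightarrow> (q has_vector_derivative q' x) (at x within {a..b})"
    and q': "continuous_on {a..b} q'"
    and h: "h absolutely_integrable_on {a..b}"
    and w: "\<And>t. t \<in> {a..b} \<Longrightarrow> w t = w a + integral {a..t} h"
  shows "((\<lambda>x. q' x * w x + q x * h x) has_integral (q b * w b - q a * w a)) {a..b}"
proof -
  have qint: "integral {t..b} q' = q b - q t" if "t \<in> {a..b}" for t
    by (rule integral_unique, rule fundamental_theorem_of_calculus)
      (use that in \<open>auto intro!: has_vector_derivative_within_subset[OF q]\<close>)
  have hI: "h integrable_on {a..b}" using h set_lebesgue_integral_eq_integral(1) by blast
  have wI: "continuous_on {a..b} (\<lambda>x. integral {a..x} h)"
    by (rule indefinite_integral_continuous_1[OF hI])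
  have i0: "(\<lambda>t. h t * (q b - q t)) integrable_on {a..b}"
    by (rule integrable_eq[OF set_lebesgue_integral_eq_integral(1)[OF fubini_triangle(2)[OF q' h]]]) (simp add: qint)
  have "integral {a..b} (\<lambda>x. q' x * integral {a..x} h) = integral {a..b} (\<lambda>t. h t * integral {t..b} q')"
    by (rule fubini_triangle(1)[OF q' h])
  also have "\<dots> = integral {a..b} (\<lambda>t. h t * (q b - q t))"
    by (rule integral_cong) (simp add: qint)
  finally have *: "integral {a..b} (\<lambda>x. q' x * integral {a..x} h) = integral {a..b} (\<lambda>t. h t * (q b - q t))" .
  have A: "((\<lambda>t. h t * (q b - q t)) has_integral integral {a..b} (\<lambda>x. q' x * integral {a..x} h)) {a..b}"
    unfolding * by (rule integrable_integral[OF i0])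
  have B: "((\<lambda>x. q' x * integral {a..x} h) has_integral integral {a..b} (\<lambda>x. q' x * integral {a..x} h)) {a..b}"
    by (intro integrable_integral integrable_continuous_interval continuous_intros q' wI)
  have C: "((\<lambda>t. h t * q b) has_integral ((w b - w a) * q b)) {a..b}"
    using has_integral_mult_left[OF integrable_integral[OF hI]] w[of b] assms(1) by simp
  have D: "((\<lambda>t. q' t * w a) has_integral ((q b - q a) * w a)) {a..b}"
    by (rule has_integral_mult_left, rule fundamental_theorem_of_calculus[OF assms(1)]) (rule q)
  \<comment> \<open>The unknown integral of \<open>q' x * integral {a..x} h\<close> enters once with
    each sign, through \<open>A\<close> and \<open>B\<close>, and cancels; \<open>C\<close> and
    \<open>D\<close> supply the boundary terms.\<close>
  have "((\<lambda>x. (h x * q b - h x * (q b - q x)) + (q' x * integral {a..x} h + q' x * w a))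
     has_integral (((w b - w a) * q b - integral {a..b} (\<lambda>x. q' x * integral {a..x} h)) + (integral {a..b} (\<lambda>x. q' x * integral {a..x} h) + (q b - q a) * w a))) {a..b}"
    by (intro has_integral_add has_integral_diff A B C D)
  moreover have "((w b - w a) * q b - integral {a..b} (\<lambda>x. q' x * integral {a..x} h)) + (integral {a..b} (\<lambda>x. q' x * integral {a..x} h) + (q b - q a) * w a) = q b * w b - q a * w a"
    by (simp add: algebra_simps)
  ultimately have *: "((\<lambda>x. (h x * q b - h x * (q b - q x)) + (q' x * integral {a..x} h + q' x * w a))
     has_integral (q b * w b - q a * w a)) {a..b}" by simp
  show ?thesis
  proof (rule has_integral_eq[OF _ *])
    fix x assume "x \<in> {a..b}"
    then have "integral {a..x} h = w x - w a" using w[of x] by (metis add_diff_cancel_left')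
    then show "h x * q b - h x * (q b - q x) + (q' x * integral {a..x} h + q' x * w a) = q' x * w x + q x * h x"
      by (simp only:) (simp add: algebra_simps)
  qed
qed

section \<open>Test functions and weak derivatives\<close>

text \<open>Since \<^term>\<open>test_fun\<close> speaks about iterated derivatives, we use a family of
  functions that is closed under differentiation.\<close>
definition pexp :: "real poly \<Rightarrow> real \<Rightarrow> real" where
  "pexp p x = (if x > 0 then poly p (1/x) * exp (- (1/x)) else 0)"

lemma poly_exp_tendsto_0: "((\<lambda>x. poly p x * exp (- x)) \<longlongrightarrow> 0) at_top" for p :: "real poly"
proof -
  have "((\<lambda>x. \<Sum>i\<le>degree p. coeff p i * (x ^ i / exp x)) \<longlongrightarrow> 0) at_top"
    by (intro tendsto_null_sum tendsto_mult_right_zero tendsto_power_div_exp_0)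
  then show ?thesis
    by (simp add: poly_altdef sum_distrib_right exp_minus divide_inverse mult.assoc)
qed

text \<open>For \<open>z = 1/x\<close> the chain rule brings \<open>- z^2\<close>, hence the factor
  \<open>[:0,0,1:]\<close>, and the family is closed under differentiation. At \<open>0\<close> the
  difference quotient from the right is \<open>z * p(z) * exp(-z)\<close>, which tends to
  \<open>0\<close> as \<open>z\<close> grows.\<close>

lemma pexp_has_derivative:
  "(pexp p has_real_derivative pexp ([:0,0,1:] * (p - pderiv p)) x) (at x)"
proof -
  consider "x > 0" | "x < 0" | "x = 0" by linarith
  then show ?thesis
  proof cases
    case 1
    have "((\<lambda>x. poly p (1/x) * exp (- (1/x))) has_real_derivative pexp ([:0,0,1:] * (p - pderiv p)) x) (at x)"
    proof -
      have i: "((\<lambda>x. 1/x) has_real_derivative - (1/x * (1/x))) (at x)"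
        using 1 by (auto intro!: derivative_eq_intros)
      have "((\<lambda>x. poly p (1/x) * exp (- (1/x))) has_real_derivative
        (poly (pderiv p) (1/x) * - (1/x * (1/x)) * exp (- (1/x)) + exp (- (1/x)) * - (- (1/x * (1/x))) * poly p (1/x))) (at x)"
        by (intro DERIV_mult DERIV_chain2[OF poly_DERIV i] DERIV_chain2[OF DERIV_exp] DERIV_minus i)
      moreover have "poly (pderiv p) (1/x) * - (1/x * (1/x)) * exp (- (1/x)) + exp (- (1/x)) * - (- (1/x * (1/x))) * poly p (1/x)
         = pexp ([:0,0,1:] * (p - pderiv p)) x"
        using 1 by (simp add: pexp_def algebra_simps)
      ultimately show ?thesis by (simp only:)
    qed
    then show ?thesis
      by (rule has_field_derivative_transform_within_open[where S="{0<..}"]) (use 1 in \<open>auto simp: pexp_def\<close>)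
  next
    case 2
    have "((\<lambda>x. 0) has_real_derivative pexp ([:0,0,1:] * (p - pderiv p)) x) (at x)"
      using 2 by (simp add: pexp_def)
    then show ?thesis
      by (rule has_field_derivative_transform_within_open[where S="{..<0}"]) (use 2 in \<open>auto simp: pexp_def\<close>)
  next
    case 3
    have l: "((\<lambda>h. pexp p h / h) \<longlongrightarrow> 0) (at_left 0)"
      by (rule tendsto_eventually) (auto simp: pexp_def eventually_at_filter)
    have "((\<lambda>y. poly ([:0,1:]*p) y * exp (- y)) \<longlongrightarrow> 0) at_top" by (rule poly_exp_tendsto_0)
    then have "((\<lambda>h. poly ([:0,1:]*p) (inverse h) * exp (- inverse h)) \<longlongrightarrow> 0) (at_right 0)"
      by (rule filterlim_compose) (rule filterlim_inverse_at_top_right)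
    then have r: "((\<lambda>h. pexp p h / h) \<longlongrightarrow> 0) (at_right 0)"
      by (rule Lim_transform_eventually) (auto simp: pexp_def eventually_at_filter divide_inverse)
    have "((\<lambda>h. pexp p h / h) \<longlongrightarrow> 0) (at 0)"
      using l r by (simp add: filterlim_at_split)
    then show ?thesis using 3 by (simp add: DERIV_def pexp_def)
  qed
qed

lemma pexp_smult: "c * pexp p x = pexp (smult c p) x"
  by (simp add: pexp_def)

text \<open>A left and a right cut-off are multiplied, so that supports can be intervals; sums are
  included because the product rule leaves single products. The polynomials absorb the factor
  \<open>n\<close> of the chain rule, and large \<open>n\<close> makes the products approximate
  indicators of intervals.\<close>

inductive_set bumps :: "(real \<Rightarrow> real) set" where
  base: "(\<lambda>x. pexp p (n * (x - a)) * pexp r (n * (b - x))) \<in> bumps"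
| add: "f \<in> bumps \<Longrightarrow> g \<in> bumps \<Longrightarrow> (\<lambda>x. f x + g x) \<in> bumps"

lemma bumps_smult: "f \<in> bumps \<Longrightarrow> (\<lambda>x. c * f x) \<in> bumps"
proof (induction rule: bumps.induct)
  case (base p n a r b)
  show ?case using bumps.base[of "smult c p" n a r b] by (simp add: pexp_smult[symmetric] mult.assoc)
next
  case (add f g)
  then show ?case using bumps.add by (simp add: distrib_left)
qed

lemma bumps_deriv: "f \<in> bumps \<Longrightarrow> \<exists>f'\<in>bumps. \<forall>x. (f has_real_derivative f' x) (at x)"
proof (induction rule: bumps.induct)
  case (base p n a r b)
  let ?D = "\<lambda>p. [:0,0,1:] * (p - pderiv p) :: real poly"
  have "((\<lambda>x. pexp p (n * (x - a)) * pexp r (n * (b - x))) has_real_derivative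
     (n * pexp (?D p) (n * (x - a)) * pexp r (n * (b - x)) + pexp p (n * (x - a)) * (- n * pexp (?D r) (n * (b - x))))) (at x)" for x
    by (rule derivative_eq_intros DERIV_chain2[OF pexp_has_derivative] refl | simp)+
  moreover have "(\<lambda>x. n * pexp (?D p) (n * (x - a)) * pexp r (n * (b - x)) + pexp p (n * (x - a)) * (- n * pexp (?D r) (n * (b - x)))) \<in> bumps"
    using bumps.add[OF bumps.base[of "smult n (?D p)" n a r b] bumps.base[of p n a "smult (-n) (?D r)" b]]
    by (simp only: pexp_smult[symmetric])
  ultimately show ?case by (intro bexI[rotated]) auto
next
  case (add f g)
  then obtain f' g' where "f'\<in>bumps" "\<forall>x. (f has_real_derivative f' x) (at x)"
    "g'\<in>bumps" "\<forall>x. (g has_real_derivative g' x) (at x)" by blast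
  then show ?case by (intro bexI[of _ "\<lambda>x. f' x + g' x"]) (auto intro!: DERIV_add bumps.add)
qed

lemma bumps_iterated_deriv:
  assumes "f \<in> bumps"
  shows "(deriv ^^ k) f \<in> bumps \<and> (\<forall>x. ((deriv ^^ k) f has_real_derivative (deriv ^^ Suc k) f x) (at x))"
proof -
  have *: "deriv g \<in> bumps \<and> (\<forall>x. (g has_real_derivative deriv g x) (at x))" if "g \<in> bumps" for g
  proof -
    obtain g' where g': "g' \<in> bumps" "\<And>x. (g has_real_derivative g' x) (at x)" using bumps_deriv[OF \<open>g \<in> bumps\<close>] by metis
    then have "deriv g = g'" by (intro ext DERIV_imp_deriv)
    with g' show ?thesis by simp
  qed
  have "(deriv ^^ k) f \<in> bumps" by (induction k) (use assms * in auto)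
  then show ?thesis using *[of "(deriv ^^ k) f"] by simp
qed

lemma bumps_continuous: "f \<in> bumps \<Longrightarrow> continuous_on S f"
  using bumps_iterated_deriv[of f 0]
  by (intro DERIV_continuous_on[of S f "deriv f"], rule_tac has_field_derivative_at_within) simp

lemma integral_zero:
  fixes f :: "real \<Rightarrow> real"
  assumes "\<And>x. x \<in> S \<Longrightarrow> f x = 0"
  shows "integral S f = 0"
  using integral_cong[of S f "\<lambda>x. 0"] assms by simp

text \<open>Every bump of integral zero is the derivative of a test function; this is the step that turns
  a vanishing weak derivative into a constant.\<close>
lemma test_fun_antideriv:
  assumes f: "f \<in> bumps" and ab: "-1 < a" "b < 1" and z: "\<And>x. x \<notin> {a..b} \<Longrightarrow> f x = 0"
    and I: "integral II f = 0"
  shows "test_fun (\<lambda>x. integral {-1..x} f)" and "deriv (\<lambda>x. integral {-1..x} f) = f"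
proof -
  let ?F = "\<lambda>x. integral {-1..x} f"
  have F0: "?F x = 0" if "x < a" for x
    by (rule integral_zero) (use that z in auto) 
  have int: "f integrable_on {c..d}" for c d
    by (intro integrable_continuous_interval bumps_continuous f)
  have F1: "?F x = 0" if "x > b" "x \<ge> a" for x
  proof (cases "x \<le> 1")
    case True
    have "?F x + integral {x..1} f = integral II f"
      by (rule Henstock_Kurzweil_Integration.integral_combine) (use True that ab int in simp_all)
    moreover have "integral {x..1} f = 0" by (rule integral_zero) (use that z in auto) 
    ultimately show ?thesis using I by simp
  next
    \<comment> \<open>\<open>test_fun\<close> constrains the primitive on the whole line, hence also
      beyond \<open>1\<close>, where the integral over \<open>II\<close> is complete.\<close>
    case False
    have "integral II f + integral {1..x} f = ?F x"
      by (rule Henstock_Kurzweil_Integration.integral_combine) (use False int in simp_all)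
    moreover have "integral {1..x} f = 0" by (rule integral_zero) (use ab z in auto) 
    ultimately show ?thesis using I by simp
  qed
  have d: "(?F has_real_derivative f x) (at x)" for x
  proof (cases "x < a")
    case True
    have "((\<lambda>x. 0) has_real_derivative f x) (at x)" using True z by simp
    then show ?thesis
      by (rule has_field_derivative_transform_within_open[where S="{..<a}"]) (use True F0 in auto)
  next
    case False
    \<comment> \<open>The endpoint \<open>x + 1\<close> makes \<open>x\<close> an interior point, so
      that the one-sided statement yields the full derivative.\<close>
    have "(?F has_real_derivative f x) (at x within {-1..x+1})"
      by (rule integral_has_real_derivative) (use False ab in \<open>auto intro: bumps_continuous f\<close>)
    moreover have "at x within {-1..x+1} = at x"
      by (rule at_within_interior) (use False ab in \<open>simp add: interior_atLeastAtMost_real\<close>)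
    ultimately show ?thesis by simp
  qed
  show dF: "deriv ?F = f" by (auto intro: DERIV_imp_deriv d)
  have "((deriv ^^ k) ?F has_real_derivative (deriv ^^ Suc k) ?F x) (at x)" for k x
  proof (cases k)
    case 0 then show ?thesis using d dF by simp
  next
    case (Suc j)
    have e: "(deriv ^^ Suc i) ?F = (deriv ^^ i) f" for i
      by (simp only: funpow_Suc_right o_apply dF)
    show ?thesis unfolding Suc e using bumps_iterated_deriv[OF f, of j] by blast
  qed
  moreover have "?F x = 0" if "x \<notin> {a..b}" for x using F0[of x] F1[of x] that by (cases "x < a") auto
  ultimately show "test_fun ?F" unfolding test_fun_def using ab by blast
qed

section \<open>Functions orthogonal to all bumps\<close>

lemma indicator_integral_eq:
  fixes q :: "real \<Rightarrow> complex"
  assumes q: "q absolutely_integrable_on II" and "-1 \<le> a" "b \<le> 1"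
  shows "(\<integral>t. indicator {a..b} t *\<^sub>R q t \<partial>lebesgue_on II) = integral {a..b} q"
proof -
  have sub: "{a..b} \<subseteq> II" using assms by auto
  have "(\<integral>t. indicator {a..b} t *\<^sub>R q t \<partial>lebesgue_on II) = (\<integral>t. q t \<partial>lebesgue_on {a..b})"
    by (simp add: integral_restrict_space) (rule Bochner_Integration.integral_cong, use sub in \<open>auto simp: indicator_def\<close>)
  also have "\<dots> = integral {a..b} q"
    by (rule lebesgue_integral_eq_integral)
      (use absolutely_integrable_on_subinterval[OF q sub] in \<open>auto simp: integrable_iff_abs\<close>)
  finally show ?thesis .
qed

text \<open>Dynkin's argument: the half-lines form an intersection stable generator of the Borel
  sets, and the sets on which \<open>q\<close> integrates to \<open>0\<close> are closed under
  complements and disjoint countable unions. Vanishing integrals over all measurable sets then force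
  \<open>q = 0\<close> almost everywhere.\<close>

lemma AE_zero_if_interval_integrals_zero:
  fixes q :: "real \<Rightarrow> complex"
  assumes q: "q absolutely_integrable_on II"
    and z: "\<And>x. x \<in> II \<Longrightarrow> integral {-1..x} q = 0"
  shows "AE x in lebesgue_on II. q x = 0"
proof -
  let ?M = "lebesgue_on II"
  interpret finite_measure ?M by (rule finite_measure_lebesgue_on) auto
  have qi: "integrable ?M q" using q by (simp add: integrable_iff_abs)
  have Bm: "B \<inter> II \<in> sets ?M" if "B \<in> sets borel" for B
    using that by (auto simp: sets_restrict_space)
  let ?P = "\<lambda>B. (\<integral>t. indicator B t *\<^sub>R q t \<partial>?M) = 0"
  have intB: "integrable ?M (\<lambda>t. indicator B t *\<^sub>R q t)" if "B \<in> sets borel" for B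
  proof -
    have "integrable ?M (\<lambda>t. indicator (B \<inter> II) t *\<^sub>R q t)"
      by (rule integrable_mult_indicator[OF Bm[OF that] qi])
    then show ?thesis
      by (rule Bochner_Integration.integrable_cong[OF refl, THEN iffD1, rotated]) (auto simp: indicator_def)
  qed
  have tot: "integral\<^sup>L ?M q = 0"
    using lebesgue_integral_eq_integral[OF qi] z[of 1] by simp
  have borel: "?P B" if "B \<in> sets borel" for B
  proof -
    have "B \<in> sigma_sets UNIV (range (\<lambda>x::real. {..x}))"
      using that by (simp add: borel_eq_atMost)
    moreover have IS: "Int_stable (range (\<lambda>x::real. {..x}))" by (auto simp: Int_stable_def)
    moreover have cl: "range (\<lambda>x::real. {..x}) \<subseteq> Pow UNIV" by simp
    ultimately have "B \<in> sigma_sets UNIV (range (\<lambda>x::real. {..x}))" by blast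
    then show ?thesis
    proof (induction B rule: sigma_sets_induct_disjoint[OF IS cl, consumes 1, case_names basic empty compl union])
      case (basic A)
      then obtain x where A: "A = {..x}" by auto
      consider "x < -1" | "x \<in> II" | "x > 1" by fastforce
      then show ?case
      proof cases
        case 1
        have "(\<integral>t. indicator A t *\<^sub>R q t \<partial>?M) = (\<integral>t. 0 \<partial>?M)"
          by (rule Bochner_Integration.integral_cong) (use 1 in \<open>auto simp: A indicator_def\<close>)
        then show ?thesis by simp
      next
        case 2
        have "(\<integral>t. indicator A t *\<^sub>R q t \<partial>?M) = (\<integral>t. indicator {-1..x} t *\<^sub>R q t \<partial>?M)"
          by (rule Bochner_Integration.integral_cong) (auto simp: A indicator_def)
        also have "\<dots> = 0" using indicator_integral_eq[OF q, of "-1" x] z[of x] 2 by simp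
        finally show ?thesis .
      next
        case 3
        have "(\<integral>t. indicator A t *\<^sub>R q t \<partial>?M) = (\<integral>t. q t \<partial>?M)"
          by (rule Bochner_Integration.integral_cong) (use 3 in \<open>auto simp: A indicator_def\<close>)
        then show ?thesis using tot by simp
      qed
    next
      case empty show ?case by simp
    next
      case (compl A)
      then have Ab: "A \<in> sets borel" by (simp add: borel_eq_atMost)
      have "(\<integral>t. indicator (UNIV - A) t *\<^sub>R q t \<partial>?M) = (\<integral>t. q t - indicator A t *\<^sub>R q t \<partial>?M)"
        by (rule Bochner_Integration.integral_cong) (auto simp: indicator_def)
      also have "\<dots> = 0" using tot compl intB[OF Ab] qi by simp
      finally show ?case .
    next
      case (union A)
      have Ab: "A i \<in> sets borel" for i using union(2) by (auto simp: borel_eq_atMost)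
      have "(\<integral>t. indicator (\<Union>i. A i) t *\<^sub>R q t \<partial>?M) = (LINT t:(\<Union>i. A i \<inter> II)|?M. q t)"
        unfolding set_lebesgue_integral_def
        by (rule Bochner_Integration.integral_cong) (auto simp: indicator_def)
      also have "\<dots> = (\<Sum>i. (LINT t:(A i \<inter> II)|?M. q t))"
      proof (rule lebesgue_integral_countable_add)
        show "A i \<inter> II \<in> sets ?M" for i by (rule Bm[OF Ab])
        show "(A i \<inter> II) \<inter> (A j \<inter> II) = {}" if "i \<noteq> j" for i j
          using union(1) that by (auto simp: disjoint_family_on_def)
        have "(\<Union>i. A i) \<in> sets borel" using Ab by auto
        then have "(\<Union>i. A i \<inter> II) \<in> sets ?M" using Bm[of "\<Union>i. A i"] by simp
        then show "set_integrable ?M (\<Union>i. A i \<inter> II) q"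
          unfolding set_integrable_def by (rule integrable_mult_indicator[OF _ qi])
      qed
      also have "(LINT t:(A i \<inter> II)|?M. q t) = (\<integral>t. indicator (A i) t *\<^sub>R q t \<partial>?M)" for i
        unfolding set_lebesgue_integral_def
        by (rule Bochner_Integration.integral_cong) (auto simp: indicator_def)
      then have "(\<Sum>i. (LINT t:(A i \<inter> II)|?M. q t)) = 0" using union(3) by simp
      finally show ?case .
    qed
  qed
  show ?thesis
  proof (rule density_zero[OF qi])
    fix A assume "A \<in> sets ?M"
    then have "A \<in> sets lebesgue" by (auto simp: sets_restrict_space)
    \<comment> \<open>A Lebesgue set is a Borel set up to a subset of a null set, so the Borel case
      suffices.\<close>
    then obtain S N N' where A: "A = S \<union> N" "S \<in> sets lborel" "N' \<in> null_sets lborel" "N \<subseteq> N'"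
      by (auto elim: sets_completionE)
    have N': "N' \<in> null_sets lebesgue" using A(3) by (rule null_sets_completionI)
    have "AE t in lebesgue. t \<notin> N'" by (rule AE_not_in[OF N'])
    then have "AE t in lebesgue. t \<in> II \<longrightarrow> t \<notin> N'" by eventually_elim simp
    then have AE: "AE t in ?M. t \<notin> N'" by (subst AE_restrict_space_iff) auto
    have iA: "A \<in> sets ?M" by fact
    have "(LINT t:A|?M. q t) = (\<integral>t. indicator S t *\<^sub>R q t \<partial>?M)"
      unfolding set_lebesgue_integral_def
    proof (rule integral_cong_AE)
      show "(\<lambda>t. indicat_real A t *\<^sub>R q t) \<in> borel_measurable ?M"
        using integrable_mult_indicator[OF iA qi] by auto
      show "(\<lambda>t. indicat_real S t *\<^sub>R q t) \<in> borel_measurable ?M"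
        using intB[of S] A(2) by auto
      show "AE t in ?M. indicat_real A t *\<^sub>R q t = indicat_real S t *\<^sub>R q t"
        using AE by eventually_elim (use A in \<open>auto simp: indicator_def\<close>)
    qed
    also have "\<dots> = 0" using borel[of S] A(2) by simp
    finally show "(LINT t:A|?M. q t) = 0" .
  qed
qed

text \<open>\<open>pexp 1 (real n * y)\<close> is \<open>exp (-1/(n y))\<close> for
  \<open>n, y > 0\<close> and \<open>0\<close> otherwise, so it tends to \<open>1\<close> or stays
  \<open>0\<close>. Values in \<open>[0,1]\<close> make the convergence to the indicator
  dominated.\<close>

lemma interval_bump:
  assumes "a < b"
  shows "(\<lambda>x. pexp 1 (real n * (x - a)) * pexp 1 (real n * (b - x))) \<in> bumps"
    and "x \<notin> {a..b} \<Longrightarrow> pexp 1 (real n * (x - a)) * pexp 1 (real n * (b - x)) = 0"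
    and "0 \<le> pexp 1 (real n * (x - a)) * pexp 1 (real n * (b - x))"
    and "pexp 1 (real n * (x - a)) * pexp 1 (real n * (b - x)) \<le> 1"
    and "(\<lambda>n. pexp 1 (real n * (x - a)) * pexp 1 (real n * (b - x))) \<longlonglongrightarrow> indicator {a<..<b} x"
proof -
  have le: "0 \<le> pexp 1 y \<and> pexp 1 y \<le> 1" for y by (simp add: pexp_def)
  have neg: "pexp 1 (real n * y) = 0" if "y \<le> 0" for y n
    using that by (auto simp: pexp_def zero_less_mult_iff)
  have lim: "(\<lambda>n. pexp 1 (real n * y)) \<longlonglongrightarrow> 1" if "y > 0" for y
  proof -
    have "(\<lambda>n. exp (- (1 / (real n * y)))) \<longlonglongrightarrow> exp (- 0)"
      by (intro tendsto_exp tendsto_minus tendsto_divide_0[OF tendsto_const] filterlim_at_top_imp_at_infinity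
          filterlim_at_top_mult_tendsto_pos[OF tendsto_const that] filterlim_real_sequentially)
    then show ?thesis
      unfolding minus_zero exp_zero
      by (rule Lim_transform_eventually)
       (rule eventually_sequentiallyI[of 1], use that in \<open>simp add: pexp_def\<close>)
  qed
  show "(\<lambda>x. pexp 1 (real n * (x - a)) * pexp 1 (real n * (b - x))) \<in> bumps" by (rule bumps.base)
  show "x \<notin> {a..b} \<Longrightarrow> pexp 1 (real n * (x - a)) * pexp 1 (real n * (b - x)) = 0"
    using neg[of "x - a" n] neg[of "b - x" n] by auto
  show "0 \<le> pexp 1 (real n * (x - a)) * pexp 1 (real n * (b - x))" using le by simp
  show "pexp 1 (real n * (x - a)) * pexp 1 (real n * (b - x)) \<le> 1" using le by (simp add: mult_le_one)
  show "(\<lambda>n. pexp 1 (real n * (x - a)) * pexp 1 (real n * (b - x))) \<longlonglongrightarrow> indicator {a<..<b} x"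
  proof (cases "a < x \<and> x < b")
    case True
    then show ?thesis using tendsto_mult[OF lim[of "x - a"] lim[of "b - x"]] by simp
  next
    case False
    then have "(\<lambda>n. pexp 1 (real n * (x - a)) * pexp 1 (real n * (b - x))) = (\<lambda>n. 0)"
      using neg[of "x - a"] neg[of "b - x"] by (auto simp: fun_eq_iff not_less)
    then show ?thesis using False by auto
  qed
qed

lemma integrable_mult_continuous:
  fixes q p :: "real \<Rightarrow> complex"
  assumes "integrable (lebesgue_on {a..b}) q" "continuous_on {a..b} p"
  shows "integrable (lebesgue_on {a..b}) (\<lambda>x. q x * p x)"
proof -
  have "compact (p ` {a..b})" using assms(2) by (intro compact_continuous_image) auto
  then obtain B where B: "\<And>x. x \<in> {a..b} \<Longrightarrow> norm (p x) \<le> B"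
    by (meson compact_imp_bounded bounded_iff image_eqI)
  have [measurable]: "p \<in> borel_measurable (lebesgue_on {a..b})"
    by (rule continuous_imp_measurable_on_sets_lebesgue[OF assms(2)]) auto
  have [measurable]: "q \<in> borel_measurable (lebesgue_on {a..b})" using assms(1) by auto
  have "integrable (lebesgue_on {a..b}) (\<lambda>x. B * norm (q x))" using assms(1) by auto
  then show ?thesis
  proof (rule Bochner_Integration.integrable_bound)
    show "AE x in lebesgue_on {a..b}. norm (q x * p x) \<le> norm (B * norm (q x))"
    proof (rule AE_I2)
      fix x assume "x \<in> space (lebesgue_on {a..b})"
      then have "norm (p x) \<le> B" using B by simp
      then have "norm (q x) * norm (p x) \<le> \<bar>B\<bar> * norm (q x)"
        by (subst mult.commute) (rule mult_right_mono, auto)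
      then show "norm (q x * p x) \<le> norm (B * norm (q x))" by (simp add: norm_mult abs_mult)
    qed
  qed measurable
qed

text \<open>Bumps approximate the indicators of intervals that keep a distance from
  \<open>-1\<close> and \<open>1\<close>, and dominated convergence with majorant
  \<open>norm (q x)\<close> transfers the orthogonality to them. The ends are reached by continuity
  of the primitive.\<close>

lemma fundamental_lemma:
  fixes q :: "real \<Rightarrow> complex"
  assumes q: "q absolutely_integrable_on II"
    and z: "\<And>f a b. f \<in> bumps \<Longrightarrow> -1 < a \<Longrightarrow> b < 1 \<Longrightarrow> (\<And>x. x \<notin> {a..b} \<Longrightarrow> f x = 0) \<Longrightarrow>
       integral\<^sup>L (lebesgue_on II) (\<lambda>x. q x * complex_of_real (f x)) = 0"
  shows "AE x in lebesgue_on II. q x = 0"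
proof (rule AE_zero_if_interval_integrals_zero[OF q])
  have qi: "integrable (lebesgue_on II) q" using q by (simp add: integrable_iff_abs)
  then have [measurable]: "q \<in> borel_measurable (lebesgue_on II)" by auto
  have qI: "q integrable_on II" using q set_lebesgue_integral_eq_integral(1) by blast
  have 1: "integral {a..b} q = 0" if ab: "-1 < a" "a < b" "b < 1" for a b
  proof -
    let ?f = "\<lambda>n x. pexp 1 (real n * (x - a)) * pexp 1 (real n * (b - x))"
    have "(\<lambda>n. integral\<^sup>L (lebesgue_on II) (\<lambda>x. q x * complex_of_real (?f n x)))
       \<longlonglongrightarrow> integral\<^sup>L (lebesgue_on II) (\<lambda>x. q x * complex_of_real (indicator {a<..<b} x))"
    proof (rule integral_dominated_convergence[where w="\<lambda>x. norm (q x)"])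
      show "integrable (lebesgue_on II) (\<lambda>x. norm (q x))" using qi by auto
      have "continuous_on II (\<lambda>x. complex_of_real (?f n x))" for n
        by (rule continuous_on_of_real[OF bumps_continuous[OF interval_bump(1)[OF ab(2)]]])
      then show "(\<lambda>x. q x * complex_of_real (?f n x)) \<in> borel_measurable (lebesgue_on II)" for n
        using borel_measurable_integrable[OF integrable_mult_continuous[OF qi]] by blast
      have "(\<lambda>x. indicat_real {a<..<b} x) \<in> borel_measurable (lebesgue_on II)"
        by (rule borel_measurable_indicator) (use ab in \<open>auto simp: sets_restrict_space intro!: image_eqI[of _ _ "{a<..<b}"]\<close>)
      then show "(\<lambda>x. q x * complex_of_real (indicator {a<..<b} x)) \<in> borel_measurable (lebesgue_on II)"
        by measurable
      show "AE x in lebesgue_on II. (\<lambda>n. q x * complex_of_real (?f n x)) \<longlonglongrightarrow> q x * complex_of_real (indicator {a<..<b} x)"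
        by (intro AE_I2 tendsto_mult tendsto_const tendsto_of_real interval_bump ab)
      show "AE x in lebesgue_on II. norm (q x * complex_of_real (?f n x)) \<le> norm (q x)" for n
        using interval_bump(3,4)[OF ab(2)]
        by (intro AE_I2) (simp only: norm_mult norm_of_real, simp add: mult_left_le)
    qed
    moreover have "integral\<^sup>L (lebesgue_on II) (\<lambda>x. q x * complex_of_real (?f n x)) = 0" for n
      by (rule z[OF interval_bump(1)[OF ab(2)] ab(1,3)]) (rule interval_bump(2)[OF ab(2)])
    ultimately have "integral\<^sup>L (lebesgue_on II) (\<lambda>x. q x * complex_of_real (indicator {a<..<b} x)) = 0"
      using LIMSEQ_unique[OF _ tendsto_const] by (simp add: LIMSEQ_const_iff)
    also have "integral\<^sup>L (lebesgue_on II) (\<lambda>x. q x * complex_of_real (indicator {a<..<b} x))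
       = integral\<^sup>L (lebesgue_on II) (\<lambda>x. indicator {a..b} x *\<^sub>R q x)"
    proof (rule integral_cong_AE)
      have "(\<lambda>x. indicat_real {a<..<b} x) \<in> borel_measurable (lebesgue_on II)"
        by (rule borel_measurable_indicator) (use ab in \<open>auto simp: sets_restrict_space intro!: image_eqI[of _ _ "{a<..<b}"]\<close>)
      then show "(\<lambda>x. q x * complex_of_real (indicator {a<..<b} x)) \<in> borel_measurable (lebesgue_on II)"
        by measurable
      show "(\<lambda>x. indicat_real {a..b} x *\<^sub>R q x) \<in> borel_measurable (lebesgue_on II)"
        by (rule borel_measurable_integrable, rule integrable_mult_indicator[OF _ qi])
          (use ab in \<open>auto simp: sets_restrict_space intro!: image_eqI[of _ _ "{a..b}"]\<close>)
      have "{a,b} \<in> null_sets lebesgue" by (simp add: finite_imp_null_set_lborel null_sets_completionI)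
      then have "AE x in lebesgue. x \<notin> {a,b}" by (rule AE_not_in)
      then have "AE x in lebesgue. x \<in> II \<longrightarrow> x \<notin> {a,b}" by eventually_elim simp
      then have "AE x in lebesgue_on II. x \<notin> {a,b}" by (subst AE_restrict_space_iff) auto
      then show "AE x in lebesgue_on II. q x * complex_of_real (indicator {a<..<b} x) = indicat_real {a..b} x *\<^sub>R q x"
        by eventually_elim (auto simp: indicator_def)
    qed
    also have "\<dots> = integral {a..b} q" by (rule indicator_integral_eq[OF q]) (use ab in auto)
    finally show ?thesis .
  qed
  let ?F = "\<lambda>x. integral {-1..x} q"
  have Fc: "continuous_on II ?F" by (rule indefinite_integral_continuous_1[OF qI])
  have comb: "?F x + integral {x..y} q = ?F y" if "-1 \<le> x" "x \<le> y" "y \<le> 1" for x y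
    by (rule Henstock_Kurzweil_Integration.integral_combine)
      (use that in \<open>auto intro: integrable_on_subinterval[OF qI]\<close>)
  have eq: "?F x = ?F 0" if "x \<in> {-1<..<1}" for x
    using comb[of x 0] comb[of 0 x] 1[of x 0] 1[of 0 x] that by (cases x "0::real" rule: linorder_cases) auto
  \<comment> \<open>Constant on the open interval, hence on its closure; and the value at
    \<open>-1\<close> is \<open>0\<close>.\<close>
  have const: "?F x = ?F 0" if "x \<in> II" for x
    by (rule continuous_constant_on_closure[of "{-1<..<1}" ?F, OF _ eq])
      (use that Fc in simp_all)
  show "?F x = 0" if "x \<in> II" for x using const[OF that] const[of "-1"] by simp
qed

section \<open>Functions with bounded derivatives and Sobolev functions\<close>

text \<open>In both definitions \<^term>\<open>g j\<close> is the derivative of order \<^term>\<open>j\<close>. In \<open>CB l \<rho> u\<close> all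
  derivatives up to order \<^term>\<open>l\<close> are classical and the one of order \<^term>\<open>j\<close> is bounded by
  \<^term>\<open>\<rho> j\<close>; in \<open>HB m M w\<close> the derivative of order \<^term>\<open>m\<close> is only an integrable function \<^term>\<open>h\<close>.\<close>
definition CB :: "nat \<Rightarrow> (nat \<Rightarrow> real) \<Rightarrow> (real \<Rightarrow> complex) \<Rightarrow> bool" where
  "CB l \<rho> u \<longleftrightarrow> (\<exists>g. (\<forall>t\<in>II. g 0 t = u t) \<and>
     (\<forall>j<l. \<forall>t\<in>II. (g j has_vector_derivative g (Suc j) t) (at t within II)) \<and>
     (\<forall>j\<le>l. continuous_on II (g j)) \<and> (\<forall>j\<le>l. \<forall>t\<in>II. norm (g j t) \<le> \<rho> j))"

definition HB :: "nat \<Rightarrow> real \<Rightarrow> (real \<Rightarrow> complex) \<Rightarrow> bool" where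
  "HB m M w \<longleftrightarrow> (\<exists>g h. (\<forall>t\<in>II. g 0 t = w t) \<and>
     (\<forall>j. Suc j < m \<longrightarrow> (\<forall>t\<in>II. (g j has_vector_derivative g (Suc j) t) (at t within II))) \<and>
     (\<forall>j<m. continuous_on II (g j)) \<and> (\<forall>j<m. \<forall>t\<in>II. norm (g j t) \<le> M) \<and>
     h absolutely_integrable_on II \<and> integral II (\<lambda>t. norm (h t)) \<le> M \<and>
     (\<forall>a b. -1 \<le> a \<longrightarrow> a \<le> b \<longrightarrow> b \<le> 1 \<longrightarrow> g (m - 1) b - g (m - 1) a = integral {a..b} h))"

lemma CBI:
  assumes "\<And>t. t \<in> II \<Longrightarrow> g 0 t = u t"
    "\<And>j t. j < l \<Longrightarrow> t \<in> II \<Longrightarrow> (g j has_vector_derivative g (Suc j) t) (at t within II)"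
    "\<And>j. j \<le> l \<Longrightarrow> continuous_on II (g j)"
    "\<And>j t. j \<le> l \<Longrightarrow> t \<in> II \<Longrightarrow> norm (g j t) \<le> \<rho> j"
  shows "CB l \<rho> u"
  unfolding CB_def by (rule exI[of _ g]) (simp add: assms)

lemma CBE:
  assumes "CB l \<rho> u"
  obtains g where "\<And>t. t \<in> II \<Longrightarrow> g 0 t = u t"
    "\<And>j t. j < l \<Longrightarrow> t \<in> II \<Longrightarrow> (g j has_vector_derivative g (Suc j) t) (at t within II)"
    "\<And>j. j \<le> l \<Longrightarrow> continuous_on II (g j)"
    "\<And>j t. j \<le> l \<Longrightarrow> t \<in> II \<Longrightarrow> norm (g j t) \<le> \<rho> j"
proof -
  from assms obtain g where "(\<forall>t\<in>II. g 0 t = u t) \<and>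
     (\<forall>j<l. \<forall>t\<in>II. (g j has_vector_derivative g (Suc j) t) (at t within II)) \<and>
     (\<forall>j\<le>l. continuous_on II (g j)) \<and> (\<forall>j\<le>l. \<forall>t\<in>II. norm (g j t) \<le> \<rho> j)"
    unfolding CB_def by (rule exE)
  then show thesis by (intro that[of g]) simp_all
qed

lemma HBI:
  assumes "\<And>t. t \<in> II \<Longrightarrow> g 0 t = w t"
    "\<And>j t. Suc j < m \<Longrightarrow> t \<in> II \<Longrightarrow> (g j has_vector_derivative g (Suc j) t) (at t within II)"
    "\<And>j. j < m \<Longrightarrow> continuous_on II (g j)"
    "\<And>j t. j < m \<Longrightarrow> t \<in> II \<Longrightarrow> norm (g j t) \<le> M"
    "h absolutely_integrable_on II" "integral II (\<lambda>t. norm (h t)) \<le> M"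
    "\<And>a b. -1 \<le> a \<Longrightarrow> a \<le> b \<Longrightarrow> b \<le> 1 \<Longrightarrow> g (m - 1) b - g (m - 1) a = integral {a..b} h"
  shows "HB m M w"
  unfolding HB_def using assms by (intro exI[of _ g] exI[of _ h]) simp

lemma HBE:
  assumes "HB m M w"
  obtains g h where "\<And>t. t \<in> II \<Longrightarrow> g 0 t = w t"
    "\<And>j t. Suc j < m \<Longrightarrow> t \<in> II \<Longrightarrow> (g j has_vector_derivative g (Suc j) t) (at t within II)"
    "\<And>j. j < m \<Longrightarrow> continuous_on II (g j)"
    "\<And>j t. j < m \<Longrightarrow> t \<in> II \<Longrightarrow> norm (g j t) \<le> M"
    "h absolutely_integrable_on II" "integral II (\<lambda>t. norm (h t)) \<le> M"
    "\<And>a b. -1 \<le> a \<Longrightarrow> a \<le> b \<Longrightarrow> b \<le> 1 \<Longrightarrow> g (m - 1) b - g (m - 1) a = integral {a..b} h"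
proof -
  from assms obtain g h where "(\<forall>t\<in>II. g 0 t = w t) \<and>
     (\<forall>j. Suc j < m \<longrightarrow> (\<forall>t\<in>II. (g j has_vector_derivative g (Suc j) t) (at t within II))) \<and>
     (\<forall>j<m. continuous_on II (g j)) \<and> (\<forall>j<m. \<forall>t\<in>II. norm (g j t) \<le> M) \<and>
     h absolutely_integrable_on II \<and> integral II (\<lambda>t. norm (h t)) \<le> M \<and>
     (\<forall>a b. -1 \<le> a \<longrightarrow> a \<le> b \<longrightarrow> b \<le> 1 \<longrightarrow> g (m - 1) b - g (m - 1) a = integral {a..b} h)"
    unfolding HB_def by (elim exE)
  then show thesis by (intro that[of g h]) simp_all
qed

lemma L2_integrable:
  assumes "L2_I g"
  shows "integrable (lebesgue_on II) g"
proof -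
  have [measurable]: "g \<in> borel_measurable (lebesgue_on II)" using assms by (simp add: L2_I_def)
  have "integrable (lebesgue_on II) (\<lambda>x. (norm (g x))^2 + 1)"
    using assms by (auto simp: L2_I_def integrable_restrict_space intro!: integrable_add)
  then show ?thesis
  proof (rule Bochner_Integration.integrable_bound)
    have "a \<le> a\<^sup>2 + 1" for a :: real
    proof -
      have "0 \<le> (a - 1)\<^sup>2 + a\<^sup>2 + 1" by simp
      then show ?thesis by (simp add: power2_diff)
    qed
    then show "AE x in lebesgue_on II. norm (g x) \<le> norm ((norm (g x))\<^sup>2 + 1)"
      by (intro AE_I2) (simp add: order_trans[OF _ abs_ge_self])
  qed measurable
qed

text \<open>Pointwise \<open>|g| \<le> |g|\<^sup>2 / (2 c) + c / 2\<close>, which replaces the Cauchy--Schwarz inequality.\<close>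
lemma L2_norm_L1:
  assumes "L2_I g" "L2_norm_sq_I g \<le> c\<^sup>2" "c > 0"
  shows "integral II (\<lambda>x. norm (g x)) \<le> 3/2 * c"
proof -
  let ?M = "lebesgue_on II"
  have i: "integrable ?M (\<lambda>x. (norm (g x))\<^sup>2)" using assms(1) by (simp add: L2_I_def)
  have ni: "integrable ?M (\<lambda>x. norm (g x))" using L2_integrable[OF assms(1)] by auto
  have ci: "integrable ?M (\<lambda>x. c / 2)" by (simp add: integrable_restrict_space)
  have "integral II (\<lambda>x. norm (g x)) = integral\<^sup>L ?M (\<lambda>x. norm (g x))"
    using lebesgue_integral_eq_integral[OF ni] by simp
  also have "\<dots> \<le> integral\<^sup>L ?M (\<lambda>x. (norm (g x))\<^sup>2 / (2 * c) + c / 2)"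
  proof (rule integral_mono[OF ni])
    show "integrable ?M (\<lambda>x. (norm (g x))\<^sup>2 / (2 * c) + c / 2)" using i ci by auto
    fix x
    have "0 \<le> (norm (g x) - c)\<^sup>2 / (2*c)" using assms(3) by simp
    also have "\<dots> = (norm (g x))\<^sup>2 / (2 * c) + c / 2 - norm (g x)"
      using assms(3) by (simp add: field_simps power2_eq_square)
    finally show "norm (g x) \<le> (norm (g x))\<^sup>2 / (2 * c) + c / 2" by simp
  qed
  also have "\<dots> = L2_norm_sq_I g / (2 * c) + integral\<^sup>L ?M (\<lambda>x. c / 2)"
    using i ci by (simp add: L2_norm_sq_I_def)
  also have "integral\<^sup>L ?M (\<lambda>x. c / 2) = c"
    using lebesgue_integral_eq_integral[OF ci] by simp
  also have "L2_norm_sq_I g / (2 * c) + c \<le> c\<^sup>2 / (2 * c) + c"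
    using assms by (simp add: divide_right_mono)
  also have "\<dots> = 3/2 * c" using assms(3) by (simp add: power2_eq_square)
  finally show ?thesis .
qed

section \<open>Weak derivatives and primitives\<close>

lemma test_fun_boundary:
  assumes "test_fun \<phi>"
  shows "\<phi> 1 = 0" "\<phi> (-1) = 0" "(\<phi> has_real_derivative deriv \<phi> x) (at x)" "continuous_on S \<phi>" "continuous_on S (deriv \<phi>)"
proof -
  have d: "((deriv ^^ k) \<phi> has_real_derivative (deriv ^^ Suc k) \<phi> x) (at x)" for k x
    using assms by (simp add: test_fun_def)
  obtain a b where ab: "-1 < a" "b < 1" "\<And>x. x \<notin> {a..b} \<Longrightarrow> \<phi> x = 0"
    using assms by (auto simp: test_fun_def)
  show "\<phi> 1 = 0" "\<phi> (-1) = 0" using ab(3)[of 1] ab(3)[of "-1"] ab(1,2) by auto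
  show "(\<phi> has_real_derivative deriv \<phi> x) (at x)" using d[of 0 x] by simp
  show "continuous_on S \<phi>"
    by (rule DERIV_continuous_on) (rule has_field_derivative_at_within[OF d[of 0, simplified]])
  show "continuous_on S (deriv \<phi>)"
    by (rule DERIV_continuous_on) (rule has_field_derivative_at_within[OF d[of 1, simplified]])
qed

lemma test_fun_complex_deriv:
  assumes "test_fun \<phi>"
  shows "((\<lambda>x. complex_of_real (\<phi> x)) has_vector_derivative complex_of_real (deriv \<phi> x)) (at x within S)"
  using test_fun_boundary(3)[OF assms, of x]
  by (intro has_vector_derivative_of_real) (auto intro: has_field_derivative_at_within)

text \<open>\<open>ac_by_parts\<close> against \<phi>, whose boundary values vanish.\<close>

lemma weak_deriv_antideriv:
  fixes w h :: "real \<Rightarrow> complex"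
  assumes h: "h absolutely_integrable_on II"
    and w: "\<And>t. t \<in> II \<Longrightarrow> w t = w (-1) + integral {-1..t} h"
  shows "weak_deriv_I w h"
  unfolding weak_deriv_I_def
proof (intro allI impI)
  fix \<phi> assume \<phi>: "test_fun \<phi>"
  note tf = test_fun_boundary[OF \<phi>]
  have hi: "integrable (lebesgue_on II) h" using h by (simp add: integrable_iff_abs)
  have hI: "h integrable_on II" using h set_lebesgue_integral_eq_integral(1) by blast
  have "continuous_on II (\<lambda>t. w (-1) + integral {-1..t} h)"
    by (intro continuous_intros indefinite_integral_continuous_1[OF hI])
  then have wc: "continuous_on II w"
    by (rule continuous_on_eq) (metis w)
  then have wi: "integrable (lebesgue_on II) w"
    by (simp add: integrable_iff_abs absolutely_integrable_continuous_real)
  have "((\<lambda>x. complex_of_real (deriv \<phi> x) * w x + complex_of_real (\<phi> x) * h x) has_integral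
     (complex_of_real (\<phi> 1) * w 1 - complex_of_real (\<phi> (-1)) * w (-1))) II"
    by (rule ac_by_parts[OF _ test_fun_complex_deriv[OF \<phi>] continuous_on_of_real[OF tf(5)] h w]) auto
  then have "integral II (\<lambda>x. complex_of_real (deriv \<phi> x) * w x + complex_of_real (\<phi> x) * h x) = 0"
    using tf by (simp add: integral_unique)
  moreover have i1: "integrable (lebesgue_on II) (\<lambda>x. w x * complex_of_real (deriv \<phi> x))"
    by (rule integrable_mult_continuous[OF wi continuous_on_of_real[OF tf(5)]])
  moreover have i2: "integrable (lebesgue_on II) (\<lambda>x. h x * complex_of_real (\<phi> x))"
    by (rule integrable_mult_continuous[OF hi continuous_on_of_real[OF tf(4)]])
  moreover have "integral II (\<lambda>x. complex_of_real (deriv \<phi> x) * w x + complex_of_real (\<phi> x) * h x)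
     = integral\<^sup>L (lebesgue_on II) (\<lambda>x. w x * complex_of_real (deriv \<phi> x) + h x * complex_of_real (\<phi> x))"
    using lebesgue_integral_eq_integral[OF Bochner_Integration.integrable_add[OF i1 i2]] by (simp add: mult.commute)
  ultimately show "integral\<^sup>L (lebesgue_on II) (\<lambda>x. w x * complex_of_real (deriv \<phi> x))
     = - integral\<^sup>L (lebesgue_on II) (\<lambda>x. h x * complex_of_real (\<phi> x))"
    by (simp add: eq_neg_iff_add_eq_0)
qed

text \<open>The lemma of du Bois-Reymond: \<open>u\<close> minus the primitive of \<open>g\<close>
  has weak derivative \<open>0\<close>. Only bumps of integral \<open>0\<close> are derivatives of
  test functions, so an arbitrary bump is first corrected by a multiple of a fixed bump
  \<open>r\<close>.\<close>

lemma weak_deriv_imp_antideriv: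
  fixes u g :: "real \<Rightarrow> complex"
  assumes u: "integrable (lebesgue_on II) u" and g: "integrable (lebesgue_on II) g"
    and wd: "weak_deriv_I u g"
  shows "\<exists>c. AE x in lebesgue_on II. u x = c + integral {-1..x} g"
proof -
  let ?M = "lebesgue_on II"
  define w where "w = (\<lambda>x. integral {-1..x} g)"
  have gabs: "g absolutely_integrable_on II" using g by (simp add: integrable_iff_abs)
  have gI: "g integrable_on II" using gabs set_lebesgue_integral_eq_integral(1) by blast
  have ww: "weak_deriv_I w g"
    by (rule weak_deriv_antideriv[OF gabs]) (simp add: w_def)
  have "continuous_on II w" unfolding w_def by (rule indefinite_integral_continuous_1[OF gI])
  then have wi: "integrable ?M w"
    by (simp add: integrable_iff_abs absolutely_integrable_continuous_real)
  let ?q = "\<lambda>x. u x - w x"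
  have qi: "integrable ?M ?q" using u wi by auto
  have ort: "integral\<^sup>L ?M (\<lambda>x. ?q x * complex_of_real (deriv \<phi> x)) = 0" if "test_fun \<phi>" for \<phi>
  proof -
    have c: "continuous_on II (\<lambda>x. complex_of_real (deriv \<phi> x))"
      by (rule continuous_on_of_real[OF test_fun_boundary(5)[OF that]])
    show ?thesis
      using wd ww that integrable_mult_continuous[OF u c] integrable_mult_continuous[OF wi c]
      by (simp add: weak_deriv_I_def left_diff_distrib)
  qed
  define r where "r = (\<lambda>x. pexp 1 (real 1 * (x - (-1/2))) * pexp 1 (real 1 * (1/2 - x)))"
  have r: "r \<in> bumps" "\<And>x. x \<notin> {-1/2..1/2} \<Longrightarrow> r x = 0" "\<And>x. 0 \<le> r x"
    unfolding r_def by (rule interval_bump; simp)+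
  have fint: "(\<lambda>x. f x) integrable_on II" if "f \<in> bumps" for f
    by (intro integrable_continuous_interval bumps_continuous that)
  have rpos: "integral II r > 0"
  proof -
    have "integral II r \<noteq> 0"
    proof
      assume "integral II r = 0"
      moreover have "continuous_on (cbox (-1) 1) r" by (rule bumps_continuous[OF r(1)])
      ultimately have "r 0 = 0"
        using integral_cbox_eq_0_iff[of "-1" 1 r] r(3) by (auto simp: box_real)
      then show False by (simp add: r_def pexp_def)
    qed
    moreover have "integral II r \<ge> 0" by (rule integral_nonneg[OF fint[OF r(1)]]) (rule r(3))
    ultimately show ?thesis by simp
  qed
  \<comment> \<open>The future constant, the mean of the difference weighted by \<open>r\<close>. It
    is forced, since the difference minus \<open>Q\<close> has to be orthogonal to
    \<open>r\<close>.\<close>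
  define Q where "Q = integral\<^sup>L ?M (\<lambda>x. ?q x * complex_of_real (r x)) / complex_of_real (integral II r)"
  have cf: "continuous_on II (\<lambda>x. complex_of_real (f x))" if "f \<in> bumps" for f
    by (rule continuous_on_of_real[OF bumps_continuous[OF that]])
  have "AE x in ?M. ?q x - Q = 0"
  proof (rule fundamental_lemma)
    have "integrable ?M (\<lambda>x. Q)" by (simp add: integrable_restrict_space)
    then have qQ: "integrable ?M (\<lambda>x. ?q x - Q)" using qi by auto
    then show "(\<lambda>x. ?q x - Q) absolutely_integrable_on II" by (simp only: integrable_iff_abs)
    fix f a b assume f: "f \<in> bumps" "-1 < a" "b < (1::real)" "\<And>x. x \<notin> {a..b} \<Longrightarrow> f x = 0"
    \<comment> \<open>Chosen so that \<open>f - k * r\<close> has integral \<open>0\<close> and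
      hence is the derivative of a test function.\<close>
    define k where "k = integral II f / integral II r"
    let ?f = "\<lambda>x. f x + (- k) * r x"
    have fb: "?f \<in> bumps" by (rule bumps.add[OF f(1) bumps_smult[OF r(1)]])
    have "integral II ?f = integral II f + integral II (\<lambda>x. (- k) * r x)"
      by (intro Henstock_Kurzweil_Integration.integral_add fint f bumps_smult r)
    also have "integral II (\<lambda>x. (- k) * r x) = (- k) * integral II r" by (rule integral_mult_right)
    finally have I0: "integral II ?f = 0" using rpos by (simp add: k_def)
    have sup: "?f x = 0" if "x \<notin> {min a (-1/2)..max b (1/2)}" for x
    proof -
      have "x \<notin> {a..b}" "x \<notin> {-1/2..1/2}" using that by auto
      then show ?thesis using f(4) r(2) by simp
    qed
    have "test_fun (\<lambda>x. integral {-1..x} ?f)" "deriv (\<lambda>x. integral {-1..x} ?f) = ?f"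
      by (rule test_fun_antideriv[OF fb _ _ sup I0]; use f in simp)+
    then have 0: "integral\<^sup>L ?M (\<lambda>x. ?q x * complex_of_real (?f x)) = 0" using ort by metis
    have i1: "integrable ?M (\<lambda>x. ?q x * complex_of_real (f x))" "integrable ?M (\<lambda>x. ?q x * complex_of_real (r x))"
      by (intro integrable_mult_continuous[OF qi] cf f r)+
    have fi: "integrable ?M (\<lambda>x. complex_of_real (f x))"
      using cf[OF f(1)] by (simp add: integrable_iff_abs absolutely_integrable_continuous_real)
    have fI: "integral\<^sup>L ?M (\<lambda>x. complex_of_real (f x)) = complex_of_real (integral II f)"
    proof -
      have "integrable ?M f" using fi by (simp add: complex_of_real_integrable_eq)
      then show ?thesis using lebesgue_integral_eq_integral[of II f] by simp
    qed
    have "integral\<^sup>L ?M (\<lambda>x. ?q x * complex_of_real (?f x)) = integral\<^sup>L ?M (\<lambda>x. ?q x * complex_of_real (f x) - complex_of_real k * (?q x * complex_of_real (r x)))"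
      by (rule Bochner_Integration.integral_cong) (auto simp: algebra_simps)
    also have "\<dots> = integral\<^sup>L ?M (\<lambda>x. ?q x * complex_of_real (f x)) - complex_of_real k * integral\<^sup>L ?M (\<lambda>x. ?q x * complex_of_real (r x))"
      by (subst Bochner_Integration.integral_diff) (auto intro: i1 integrable_mult_right simp del: of_real_mult)
    finally have 1: "integral\<^sup>L ?M (\<lambda>x. ?q x * complex_of_real (f x)) = complex_of_real k * integral\<^sup>L ?M (\<lambda>x. ?q x * complex_of_real (r x))"
      using 0 by simp
    have "integral\<^sup>L ?M (\<lambda>x. (?q x - Q) * complex_of_real (f x)) = integral\<^sup>L ?M (\<lambda>x. ?q x * complex_of_real (f x) - Q * complex_of_real (f x))"
      by (rule Bochner_Integration.integral_cong) (auto simp: algebra_simps)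
    also have "\<dots> = integral\<^sup>L ?M (\<lambda>x. ?q x * complex_of_real (f x)) - Q * integral\<^sup>L ?M (\<lambda>x. complex_of_real (f x))"
      by (subst Bochner_Integration.integral_diff) (auto intro: i1 fi integrable_mult_right)
    also have "\<dots> = 0" unfolding 1 fI Q_def k_def by simp
    finally show "integral\<^sup>L ?M (\<lambda>x. (?q x - Q) * complex_of_real (f x)) = 0" .
  qed
  then have "AE x in ?M. u x = Q + integral {-1..x} g"
    by eventually_elim (simp add: w_def algebra_simps)
  then show ?thesis by blast
qed

lemma abs_integral_increment:
  fixes h :: "real \<Rightarrow> complex"
  assumes h: "h absolutely_integrable_on II" and ab: "-1 \<le> a" "a \<le> b" "b \<le> 1"
  shows "integral {-1..b} h - integral {-1..a} h = integral {a..b} h"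
    and "norm (integral {a..b} h) \<le> integral II (\<lambda>t. norm (h t))"
proof -
  have hI: "h integrable_on II" using h set_lebesgue_integral_eq_integral(1) by blast
  have nI: "(\<lambda>t. norm (h t)) integrable_on II" using h absolutely_integrable_on_def by blast
  have sub: "h integrable_on {c..d}" "(\<lambda>t. norm (h t)) integrable_on {c..d}" if "-1 \<le> c" "d \<le> 1" for c d
    using integrable_on_subinterval[OF hI, of c d] integrable_on_subinterval[OF nI, of c d] that by auto
  have "integral {-1..a} h + integral {a..b} h = integral {-1..b} h"
    by (rule Henstock_Kurzweil_Integration.integral_combine) (use ab sub in auto)
  then show "integral {-1..b} h - integral {-1..a} h = integral {a..b} h" by (simp add: algebra_simps)
  have "norm (integral {a..b} h) \<le> integral {a..b} (\<lambda>t. norm (h t))"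
    by (rule integral_norm_bound_integral) (use sub ab in auto)
  also have "\<dots> \<le> integral II (\<lambda>t. norm (h t))"
    by (rule integral_subset_le) (use sub ab nI in auto)
  finally show "norm (integral {a..b} h) \<le> integral II (\<lambda>t. norm (h t))" .
qed

section \<open>Continuous representatives of Sobolev functions\<close>

lemma AE_eq_integral:
  fixes f g :: "real \<Rightarrow> 'a::banach"
  assumes "AE x in lebesgue_on II. f x = g x" "S \<subseteq> II"
  shows "integral S f = integral S g"
proof -
  have "AE x in lebesgue. x \<in> II \<longrightarrow> f x = g x" using assms(1) by (subst (asm) AE_restrict_space_iff) auto
  then obtain N where N: "negligible N" "{x. \<not> (x \<in> II \<longrightarrow> f x = g x)} \<subseteq> N"
    by (auto simp: eventually_ae_filter_negligible)
  have "g x = f x" if "x \<in> S - N" for x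
  proof (rule ccontr)
    have "x \<in> II" using that assms(2) by (metis DiffD1 subsetD)
    moreover assume "g x \<noteq> f x"
    ultimately have "x \<in> {x. \<not> (x \<in> II \<longrightarrow> f x = g x)}" by simp
    then show False using N(2) that by (metis DiffD2 subsetD)
  qed
  then show ?thesis
    by (intro integral_spike[OF N(1)])
qed

text \<open>Every member of the weak chain below order \<open>m\<close> is almost everywhere a
  primitive of the next one, so replacing it by this primitive gives classical derivatives. Only the
  member of order \<open>m\<close> remains a mere integrable function, which is why
  \<open>HB\<close> treats the top order separately.\<close>

lemma H_bound_imp_HB:
  assumes m: "m \<ge> 1" and H: "H_bound m u c" and c: "c > 0"
  shows "\<exists>v. HB m (3 * c) v \<and> (AE x in lebesgue_on II. u x = v x)"
proof -
  obtain g where g: "g 0 = u" "\<And>j. j \<le> m \<Longrightarrow> L2_I (g j)" "\<And>j. j < m \<Longrightarrow> weak_deriv_I (g j) (g (Suc j))"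
    "sqrt (\<Sum>j\<le>m. L2_norm_sq_I (g j)) \<le> c"
    using H unfolding H_bound_def by blast
  have nn: "0 \<le> L2_norm_sq_I (g j)" for j by (simp add: L2_norm_sq_I_def)
  have S: "(\<Sum>j\<le>m. L2_norm_sq_I (g j)) \<le> c\<^sup>2" using g(4) by (rule sqrt_le_D)
  have sq: "L2_norm_sq_I (g j) \<le> c\<^sup>2" if "j \<le> m" for j
    using member_le_sum[of j "{..m}" "\<lambda>j. L2_norm_sq_I (g j)"] nn that S by auto
  have L1: "integral II (\<lambda>t. norm (g j t)) \<le> 3/2 * c" if "j \<le> m" for j
    by (rule L2_norm_L1[OF g(2)[OF that] sq[OF that] c])
  have gi: "integrable (lebesgue_on II) (g j)" if "j \<le> m" for j
    by (rule L2_integrable[OF g(2)[OF that]])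
  then have ga: "g j absolutely_integrable_on II" if "j \<le> m" for j
    using that by (simp add: integrable_iff_abs)
  have gI: "g j integrable_on II" "(\<lambda>t. norm (g j t)) integrable_on II" if "j \<le> m" for j
    using ga[OF that] set_lebesgue_integral_eq_integral(1) absolutely_integrable_on_def by blast+
  have "\<forall>j. \<exists>k. j < m \<longrightarrow> (AE x in lebesgue_on II. g j x = k + integral {-1..x} (g (Suc j)))"
    using weak_deriv_imp_antideriv[OF gi gi g(3)] by (metis Suc_leI less_imp_le)
  then obtain k where k: "\<And>j. j < m \<Longrightarrow> AE x in lebesgue_on II. g j x = k j + integral {-1..x} (g (Suc j))"
    by metis
  define v where "v = (\<lambda>j x. k j + integral {-1..x} (g (Suc j)))"
  have AE: "AE x in lebesgue_on II. g j x = v j x" if "j < m" for j using k[OF that] by (simp add: v_def)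
  have vc: "continuous_on II (v j)" if "j < m" for j
    unfolding v_def using that by (intro continuous_intros indefinite_integral_continuous_1 gI) simp
  have vd: "(v j has_vector_derivative v (Suc j) t) (at t within II)" if "Suc j < m" "t \<in> II" for j t
  proof -
    have eq: "v j x = k j + integral {-1..x} (v (Suc j))" if "x \<in> II" for x
    proof -
      have "integral {-1..x} (g (Suc j)) = integral {-1..x} (v (Suc j))"
        by (rule AE_eq_integral[OF AE[OF \<open>Suc j < m\<close>]]) (use that in auto)
      then show ?thesis by (simp only: v_def)
    qed
    have "((\<lambda>x. k j + integral {-1..x} (v (Suc j))) has_vector_derivative (0 + v (Suc j) t)) (at t within II)"
      by (intro has_vector_derivative_add has_vector_derivative_const integral_has_vector_derivative vc that)
    then show ?thesis
      by (intro has_vector_derivative_transform[OF that(2) eq]) simp_all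
  qed
  have inc: "v j b - v j a = integral {a..b} (g (Suc j))" if "j < m" "-1 \<le> a" "a \<le> b" "b \<le> 1" for j a b
    using abs_integral_increment(1)[OF ga[of "Suc j"], of a b] that by (simp add: v_def)
  have bnd: "norm (v j x) \<le> 3 * c" if j: "j < m" and x: "x \<in> II" for j x
  proof -
    have 1: "norm (v j x) \<le> norm (v j t) + 3/2 * c" if t: "t \<in> II" for t
    proof -
      have "norm (v j x - v j t) \<le> integral II (\<lambda>t. norm (g (Suc j) t))"
      proof (cases "t \<le> x")
        case True
        then show ?thesis using inc[OF j, of t x] abs_integral_increment(2)[OF ga[of "Suc j"], of t x] t x j by simp
      next
        case False
        then show ?thesis using inc[OF j, of x t] abs_integral_increment(2)[OF ga[of "Suc j"], of x t] t x j
          by (simp add: norm_minus_commute)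
      qed
      then have "norm (v j x - v j t) \<le> 3/2 * c" using L1[of "Suc j"] j by linarith
      then show ?thesis using norm_triangle_sub[of "v j x" "v j t"] by linarith
    qed
    \<comment> \<open>Averaging over \<open>t\<close> in the interval of length \<open>2\<close>
      gives \<open>2 * norm (v j x) \<le> 3/2 * c + 3 * c\<close>, which is slightly better than
      claimed.\<close>
    have "integral II (\<lambda>t. norm (v j x)) \<le> integral II (\<lambda>t. norm (v j t) + 3/2 * c)"
      by (rule integral_le) (use 1 vc[OF j] in \<open>auto intro!: integrable_continuous_interval continuous_intros\<close>)
    also have "\<dots> = integral II (\<lambda>t. norm (v j t)) + integral II (\<lambda>t. 3/2 * c)"
      by (rule Henstock_Kurzweil_Integration.integral_add) (use vc[OF j] in \<open>auto intro!: integrable_continuous_interval continuous_intros\<close>)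
    also have "integral II (\<lambda>t. norm (v j t)) = integral II (\<lambda>t. norm (g j t))"
      by (rule AE_eq_integral[symmetric]) (use AE[OF j] in \<open>auto elim: eventually_mono\<close>)
    also have "\<dots> \<le> 3/2 * c" using L1[of j] j by simp
    finally show ?thesis using c by simp
  qed
  have "HB m (3 * c) (v 0)"
  proof (rule HBI[of v, where h = "g m"])
    show "integral II (\<lambda>t. norm (g m t)) \<le> 3 * c" using L1[of m] c by simp
    show "v (m - 1) b - v (m - 1) a = integral {a..b} (g m)" if "-1 \<le> a" "a \<le> b" "b \<le> 1" for a b
      using inc[of "m - 1" a b] that m by simp
  qed (use vd vc bnd ga in auto)
  moreover have "AE x in lebesgue_on II. u x = v 0 x" using AE[of 0] m g(1) by simp
  ultimately show ?thesis by blast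
qed

section \<open>Sobolev bounds from classical derivatives, and sums\<close>

lemma chain_continuous_L2:
  assumes "continuous_on II g" "\<And>t. t \<in> II \<Longrightarrow> norm (g t) \<le> M"
  shows "L2_I g \<and> L2_norm_sq_I g \<le> 2 * M\<^sup>2"
proof -
  let ?M = "lebesgue_on II"
  have c: "continuous_on II (\<lambda>x. (norm (g x))\<^sup>2)" using assms(1) by (intro continuous_intros)
  have i: "integrable ?M (\<lambda>x. (norm (g x))\<^sup>2)"
    using absolutely_integrable_continuous_real[OF c]
    by (simp add: absolutely_integrable_on_def set_integrable_def integrable_restrict_space)
  have [measurable]: "g \<in> borel_measurable ?M"
    by (rule continuous_imp_measurable_on_sets_lebesgue[OF assms(1)]) auto
  have ci: "integrable ?M (\<lambda>x. M\<^sup>2)" by (simp add: integrable_restrict_space)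
  have "L2_norm_sq_I g \<le> integral\<^sup>L ?M (\<lambda>x. M\<^sup>2)"
    unfolding L2_norm_sq_I_def
    by (rule integral_mono_AE[OF i ci], rule AE_I2) (use assms(2) in \<open>auto intro: power_mono\<close>)
  also have "\<dots> = 2 * M\<^sup>2" using lebesgue_integral_eq_integral[OF ci] by simp
  finally show ?thesis using i by (simp add: L2_I_def)
qed

lemma CB_imp_H_bound:
  assumes u: "CB m (\<lambda>_. M) u"
  shows "H_bound m u (sqrt (2 * (real m + 1)) * M)"
proof -
  obtain g where g: "\<And>t. t \<in> II \<Longrightarrow> g 0 t = u t"
    "\<And>j t. j < m \<Longrightarrow> t \<in> II \<Longrightarrow> (g j has_vector_derivative g (Suc j) t) (at t within II)"
    "\<And>j. j \<le> m \<Longrightarrow> continuous_on II (g j)" "\<And>j t. j \<le> m \<Longrightarrow> t \<in> II \<Longrightarrow> norm (g j t) \<le> M"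
    using that by (rule CBE[OF u])
  \<comment> \<open>\<open>H_bound\<close> asks for \<open>g 0 = u\<close> on the whole line,
    whereas a \<open>CB\<close> chain agrees with \<open>u\<close> only on
    \<open>II\<close>.\<close>
  define G where "G = g(0 := u)"
  have Gg: "G j t = g j t" if "t \<in> II" for j t using g(1) that by (auto simp: G_def)
  have M: "M \<ge> 0" using order_trans[OF norm_ge_zero g(4)[of 0 0]] by simp
  have Gc: "continuous_on II (G j)" if "j \<le> m" for j
    by (rule continuous_on_eq[OF g(3)[OF that]]) (simp add: Gg)
  have Gb: "norm (G j t) \<le> M" if "j \<le> m" "t \<in> II" for j t using g(4) that by (simp add: Gg)
  have L2: "L2_I (G j)" "L2_norm_sq_I (G j) \<le> 2 * M\<^sup>2" if "j \<le> m" for j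
    using chain_continuous_L2[OF Gc[OF that] Gb[OF that]] by auto
  have wd: "weak_deriv_I (G j) (G (Suc j))" if j: "j < m" for j
  proof (rule weak_deriv_antideriv)
    have c: "continuous_on II (G (Suc j))" using Gc[of "Suc j"] j by simp
    then show "G (Suc j) absolutely_integrable_on II" by (rule absolutely_integrable_continuous_real)
    fix t :: real assume t: "t \<in> II"
    have "(g (Suc j) has_integral (g j t - g j (-1))) {-1..t}"
      by (rule fundamental_theorem_of_calculus) (use t j in \<open>auto intro!: has_vector_derivative_within_subset[OF g(2)]\<close>)
    then have "integral {-1..t} (g (Suc j)) = g j t - g j (-1)" by (rule integral_unique)
    moreover have "integral {-1..t} (g (Suc j)) = integral {-1..t} (G (Suc j))"
      by (rule integral_cong) (simp add: G_def)
    ultimately show "G j t = G j (-1) + integral {-1..t} (G (Suc j))" using t by (simp add: Gg)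
  qed
  have "(\<Sum>j\<le>m. L2_norm_sq_I (G j)) \<le> (\<Sum>j\<le>m. 2 * M\<^sup>2)" by (rule sum_mono) (use L2 in auto)
  then have "sqrt (\<Sum>j\<le>m. L2_norm_sq_I (G j)) \<le> sqrt (2 * (real m + 1) * M\<^sup>2)"
    by (simp add: algebra_simps)
  also have "\<dots> = sqrt (2 * (real m + 1)) * M" using M by (simp add: real_sqrt_mult)
  finally show ?thesis
    unfolding H_bound_def using L2(1) wd by (intro exI[of _ G]) (auto simp: G_def)
qed

lemma L2_I_add:
  assumes a: "L2_I a" and b: "L2_I b"
  shows "L2_I (\<lambda>x. a x + b x)" "L2_norm_sq_I (\<lambda>x. a x + b x) \<le> 2 * L2_norm_sq_I a + 2 * L2_norm_sq_I b"
proof -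
  let ?M = "lebesgue_on II"
  have [measurable]: "a \<in> borel_measurable ?M" "b \<in> borel_measurable ?M" using a b by (auto simp: L2_I_def)
  have i: "integrable ?M (\<lambda>x. 2 * (norm (a x))\<^sup>2 + 2 * (norm (b x))\<^sup>2)" using a b by (auto simp: L2_I_def)
  have le: "(norm (a x + b x))\<^sup>2 \<le> 2 * (norm (a x))\<^sup>2 + 2 * (norm (b x))\<^sup>2" for x
  proof -
    have "(norm (a x + b x))\<^sup>2 \<le> (norm (a x) + norm (b x))\<^sup>2" by (intro power_mono norm_triangle_ineq) simp
    also have "\<dots> \<le> 2 * (norm (a x))\<^sup>2 + 2 * (norm (b x))\<^sup>2"
      using zero_le_power2[of "norm (a x) - norm (b x)"] by (simp add: power2_eq_square algebra_simps)
    finally show ?thesis .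
  qed
  have i2: "integrable ?M (\<lambda>x. (norm (a x + b x))\<^sup>2)"
    by (rule Bochner_Integration.integrable_bound[OF i]) (auto intro!: AE_I2 order_trans[OF le])
  then show "L2_I (\<lambda>x. a x + b x)" by (simp add: L2_I_def)
  have "L2_norm_sq_I (\<lambda>x. a x + b x) \<le> integral\<^sup>L ?M (\<lambda>x. 2 * (norm (a x))\<^sup>2 + 2 * (norm (b x))\<^sup>2)"
    unfolding L2_norm_sq_I_def by (rule integral_mono[OF i2 i le])
  also have "\<dots> = 2 * L2_norm_sq_I a + 2 * L2_norm_sq_I b"
    using a b by (simp add: L2_norm_sq_I_def L2_I_def)
  finally show "L2_norm_sq_I (\<lambda>x. a x + b x) \<le> 2 * L2_norm_sq_I a + 2 * L2_norm_sq_I b" .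
qed

lemma weak_deriv_add:
  assumes "weak_deriv_I a a'" "weak_deriv_I b b'" and L: "L2_I a" "L2_I a'" "L2_I b" "L2_I b'"
  shows "weak_deriv_I (\<lambda>x. a x + b x) (\<lambda>x. a' x + b' x)"
  unfolding weak_deriv_I_def
proof (intro allI impI)
  fix \<phi> assume t: "test_fun \<phi>"
  have i: "integrable (lebesgue_on II) (\<lambda>x. f x * complex_of_real (\<phi> x))"
    "integrable (lebesgue_on II) (\<lambda>x. f x * complex_of_real (deriv \<phi> x))" if "L2_I f" for f
    by (intro integrable_mult_continuous L2_integrable that continuous_on_of_real test_fun_boundary t)+
  show "integral\<^sup>L (lebesgue_on II) (\<lambda>x. (a x + b x) * complex_of_real (deriv \<phi> x)) =
     - integral\<^sup>L (lebesgue_on II) (\<lambda>x. (a' x + b' x) * complex_of_real (\<phi> x))"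
    using assms(1,2) t i L by (simp add: weak_deriv_I_def distrib_right)
qed

text \<open>The factor \<open>2\<close> comes from \<open>(a + b)^2 \<le> 2 a^2 + 2 b^2\<close>,
  used in place of Minkowski's inequality.\<close>

lemma H_bound_add:
  assumes "H_bound m u c" "H_bound m v d"
  shows "H_bound m (\<lambda>x. u x + v x) (2 * (c + d))"
proof -
  obtain g where g: "g 0 = u" "\<And>j. j \<le> m \<Longrightarrow> L2_I (g j)" "\<And>j. j < m \<Longrightarrow> weak_deriv_I (g j) (g (Suc j))"
    "sqrt (\<Sum>j\<le>m. L2_norm_sq_I (g j)) \<le> c"
    using assms(1) unfolding H_bound_def by blast
  obtain h where h: "h 0 = v" "\<And>j. j \<le> m \<Longrightarrow> L2_I (h j)" "\<And>j. j < m \<Longrightarrow> weak_deriv_I (h j) (h (Suc j))"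
    "sqrt (\<Sum>j\<le>m. L2_norm_sq_I (h j)) \<le> d"
    using assms(2) unfolding H_bound_def by blast
  have nn: "0 \<le> (\<Sum>j\<le>m. L2_norm_sq_I (f j))" for f by (auto intro!: sum_nonneg simp: L2_norm_sq_I_def)
  have cd: "0 \<le> c" "0 \<le> d" using g(4) h(4) nn[of g] nn[of h] real_sqrt_ge_zero order_trans by blast+
  let ?k = "\<lambda>j x. g j x + h j x"
  have "(\<Sum>j\<le>m. L2_norm_sq_I (?k j)) \<le> (\<Sum>j\<le>m. 2 * L2_norm_sq_I (g j) + 2 * L2_norm_sq_I (h j))"
    by (rule sum_mono) (use L2_I_add g h in auto)
  also have "\<dots> = 2 * (\<Sum>j\<le>m. L2_norm_sq_I (g j)) + 2 * (\<Sum>j\<le>m. L2_norm_sq_I (h j))"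
    by (simp add: sum.distrib sum_distrib_left)
  also have "\<dots> \<le> 2 * c\<^sup>2 + 2 * d\<^sup>2" using sqrt_le_D[OF g(4)] sqrt_le_D[OF h(4)] by simp
  also have "\<dots> \<le> (2 * (c + d))\<^sup>2" using cd by (simp add: power2_eq_square algebra_simps)
  finally have "sqrt (\<Sum>j\<le>m. L2_norm_sq_I (?k j)) \<le> 2 * (c + d)"
    using cd by (intro real_le_lsqrt) auto
  then show ?thesis
    unfolding H_bound_def using g h
    by (intro exI[of _ ?k]) (auto intro!: L2_I_add weak_deriv_add)
qed

section \<open>Derivatives along the diagonal\<close>

text \<open>If \<^term>\<open>G i j\<close> stands for the partial derivative of order \<open>(i, j)\<close> of a function of two
  variables, \<^term>\<open>diag n G\<close> is the derivative of order \<^term>\<open>n\<close> along the diagonal. With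
  \<open>G i j = a\<^sub>i b\<^sub>j\<close> it is the Leibniz formula.\<close>
fun diag :: "nat \<Rightarrow> (nat \<Rightarrow> nat \<Rightarrow> complex) \<Rightarrow> complex" where
  "diag 0 G = G 0 0"
| "diag (Suc n) G = diag n (\<lambda>i j. G (Suc i) j) + diag n (\<lambda>i j. G i (Suc j))"

text \<open>The recursion only adds, so any relation compatible with pointwise addition passes from
  the entries to \<open>diag\<close>. Continuity, differentiability and \<open>AC\<close> are the
  instances.\<close>

lemma diag_rel:
  fixes A B :: "nat \<Rightarrow> nat \<Rightarrow> 'b \<Rightarrow> complex"
  assumes add: "\<And>a a' b b'. R a a' \<Longrightarrow> R b b' \<Longrightarrow> R (\<lambda>t. a t + b t) (\<lambda>t. a' t + b' t)"
    and "\<And>i j. i + j = n \<Longrightarrow> R (A i j) (B i j)"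
  shows "R (\<lambda>t. diag n (\<lambda>i j. A i j t)) (\<lambda>t. diag n (\<lambda>i j. B i j t))"
  using assms(2) by (induction n arbitrary: A B) (auto intro!: add)

lemma diag_plus: "diag n (\<lambda>i j. A i j + B i j) = diag n A + diag n B"
  by (induction n arbitrary: A B) (auto simp: algebra_simps)

lemma diag_Suc: "diag (Suc n) G = diag n (\<lambda>i j. G (Suc i) j + G i (Suc j))"
  by (simp add: diag_plus)

lemma diag_norm:
  assumes "\<And>i j. i + j = n \<Longrightarrow> norm (G i j) \<le> B"
  shows "norm (diag n G) \<le> 2 ^ n * B"
  using assms
proof (induction n arbitrary: G)
  case (Suc n)
  have "norm (diag n (\<lambda>i j. G (Suc i) j)) \<le> 2 ^ n * B" "norm (diag n (\<lambda>i j. G i (Suc j))) \<le> 2 ^ n * B"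
    by (auto intro!: Suc)
  then show ?case by (simp add: norm_triangle_le)
qed simp

lemma diag_continuous:
  assumes "\<And>i j. i + j = n \<Longrightarrow> continuous_on S (A i j)"
  shows "continuous_on S (\<lambda>t. diag n (\<lambda>i j. A i j t))"
  using diag_rel[where R="\<lambda>f g. continuous_on S f" and A=A and B=A and n=n] assms
  by (auto intro: continuous_on_add)

lemma diag_has_vector_derivative:
  assumes "\<And>i j. i + j = n \<Longrightarrow> (A i j has_vector_derivative B i j t) (at t within S)"
  shows "((\<lambda>t. diag n (\<lambda>i j. A i j t)) has_vector_derivative diag n (\<lambda>i j. B i j t)) (at t within S)"
  by (rule diag_rel[where R="\<lambda>f g. (f has_vector_derivative g t) (at t within S)" and A=A and B=B and n=n])
    (use assms in \<open>auto intro: has_vector_derivative_add\<close>)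

text \<open>The mixed derivatives form one doubly indexed family, so their symmetry is built in and
  Schwarz's theorem is never invoked.\<close>

definition Ck2 :: "nat \<Rightarrow> (nat \<Rightarrow> nat \<Rightarrow> real \<Rightarrow> real \<Rightarrow> complex) \<Rightarrow> bool" where
  "Ck2 n G \<longleftrightarrow> (\<forall>i j. i + j \<le> n \<longrightarrow> continuous_on (II \<times> II) (\<lambda>(s,t). G i j s t)) \<and>
    (\<forall>i j s t. i + j < n \<longrightarrow> s \<in> II \<longrightarrow> t \<in> II \<longrightarrow>
       ((\<lambda>s'. G i j s' t) has_vector_derivative G (Suc i) j s t) (at s within II) \<and>
       ((\<lambda>t'. G i j s t') has_vector_derivative G i (Suc j) s t) (at t within II))"

text \<open>Continuity of one partial derivative turns partial into total differentiability; the
  chain rule along \<open>s \<mapsto> (s, s)\<close> does the rest.\<close>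

lemma diagonal_has_vector_derivative:
  fixes G :: "real \<Rightarrow> real \<Rightarrow> complex"
  assumes s: "\<And>s t. s \<in> II \<Longrightarrow> t \<in> II \<Longrightarrow> ((\<lambda>s'. G s' t) has_vector_derivative Gs s t) (at s within II)"
    and t: "\<And>s t. s \<in> II \<Longrightarrow> t \<in> II \<Longrightarrow> ((\<lambda>t'. G s t') has_vector_derivative Gt s t) (at t within II)"
    and c: "continuous_on (II \<times> II) (\<lambda>(s,t). Gt s t)" and x: "x \<in> II"
  shows "((\<lambda>s. G s s) has_vector_derivative (Gs x x + Gt x x)) (at x within II)"
proof -
  have "((\<lambda>(x, y). G x y) has_derivative (\<lambda>(tx, ty). tx *\<^sub>R Gs x x + blinfun_scaleR_left (Gt x x) ty)) (at (x, x) within II \<times> II)"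
  proof (rule has_derivative_partialsI[where fy="\<lambda>a b. blinfun_scaleR_left (Gt a b)"])
    show "((\<lambda>s. G s x) has_derivative (\<lambda>tx. tx *\<^sub>R Gs x x)) (at x within II)"
      using s[OF x x] by (simp add: has_vector_derivative_def)
    show "((\<lambda>t. G a t) has_derivative blinfun_apply (blinfun_scaleR_left (Gt a b))) (at b within II)"
      if "a \<in> II" "b \<in> II" for a b
      using t[OF that] by (simp add: has_vector_derivative_def)
    have "continuous_on (II \<times> II) (\<lambda>z. blinfun_scaleR_left (case z of (a, b) \<Rightarrow> Gt a b))"
      by (intro continuous_intros c)
    then have "continuous_on (II \<times> II) (\<lambda>(a, b). blinfun_scaleR_left (Gt a b))"
      by (simp add: split_beta)
    then show "continuous (at (x, x) within II \<times> II) (\<lambda>(a, b). blinfun_scaleR_left (Gt a b))"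
      using x by (auto simp: continuous_on_eq_continuous_within)
  qed (use x in auto)
  then have A: "((\<lambda>(x, y). G x y) has_derivative (\<lambda>(tx, ty). tx *\<^sub>R Gs x x + blinfun_scaleR_left (Gt x x) ty))
      (at ((\<lambda>s. (s, s)) x) within (\<lambda>s. (s, s)) ` II)"
    by (rule has_derivative_subset) auto
  have B: "((\<lambda>s. (s, s)) has_derivative (\<lambda>h. (h, h))) (at x within II)"
    by (intro has_derivative_Pair has_derivative_ident)
  from diff_chain_within[OF B A] show ?thesis
    by (simp add: has_vector_derivative_def o_def scaleR_add_right)
qed

text \<open>The Leibniz sum of order \<open>k\<close> has \<open>2 ^ k\<close> terms, all of total
  order \<open>k\<close>; hence a bound that depends on \<open>i + j\<close> alone is the right
  input.\<close>

lemma Ck2_diagonal: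
  assumes G: "Ck2 n G"
    and bd: "\<And>i j s t. i + j \<le> n \<Longrightarrow> s \<in> II \<Longrightarrow> t \<in> II \<Longrightarrow> norm (G i j s t) \<le> \<rho> (i + j)"
  shows "CB n (\<lambda>k. 2 ^ k * \<rho> k) (\<lambda>s. G 0 0 s s)"
proof (rule CBI[of "\<lambda>k s. diag k (\<lambda>i j. G i j s s)"])
  have cont: "continuous_on (II \<times> II) (\<lambda>(s,t). G i j s t)" if "i + j \<le> n" for i j
    using G that by (simp add: Ck2_def)
  have c1: "continuous_on II (\<lambda>s. G i j s s)" if "i + j \<le> n" for i j
  proof -
    have "continuous_on II (\<lambda>s::real. (s, s))" by (intro continuous_intros)
    from continuous_on_compose2[OF cont[OF that] this] show ?thesis by (simp add: image_subset_iff)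
  qed
  show "continuous_on II (\<lambda>s. diag k (\<lambda>i j. G i j s s))" if "k \<le> n" for k
    by (rule diag_continuous) (use c1 that in auto)
  show "((\<lambda>s. diag k (\<lambda>i j. G i j s s)) has_vector_derivative diag (Suc k) (\<lambda>i j. G i j t t)) (at t within II)"
    if "k < n" "t \<in> II" for k t
    unfolding diag_Suc
  proof (rule diag_has_vector_derivative)
    fix i j assume ij: "i + j = k"
    show "((\<lambda>s. G i j s s) has_vector_derivative (G (Suc i) j t t + G i (Suc j) t t)) (at t within II)"
      by (rule diagonal_has_vector_derivative[OF _ _ cont]) (use G ij that in \<open>simp_all add: Ck2_def\<close>)
  qed
  show "norm (diag k (\<lambda>i j. G i j t t)) \<le> 2 ^ k * \<rho> k" if "k \<le> n" "t \<in> II" for k t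
    by (rule diag_norm) (use bd that in auto)
qed simp

section \<open>Primitives in one variable of functions of two variables\<close>

lemma continuous_on_section:
  assumes "continuous_on (II \<times> II) (\<lambda>(s,t). k s t)" "s \<in> II"
  shows "continuous_on II (k s)"
proof -
  have "continuous_on II (\<lambda>t::real. (s, t))" by (intro continuous_intros)
  from continuous_on_compose2[OF assms(1) this] show ?thesis using assms(2) by (simp add: image_subset_iff)
qed

lemma integral_increment_bound:
  fixes f :: "real \<Rightarrow> complex"
  assumes f: "continuous_on II f" "\<And>r. r \<in> II \<Longrightarrow> norm (f r) \<le> B" and "a \<in> II" "b \<in> II"
  shows "norm (integral {-1..b} f - integral {-1..a} f) \<le> B * \<bar>b - a\<bar>"
proof -
  have *: "norm (integral {-1..b} f - integral {-1..a} f) \<le> B * (b - a)" if "a \<le> b" "a \<in> II" "b \<in> II" for a b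
  proof -
    have "integral {-1..b} f - integral {-1..a} f = integral {a..b} f"
      by (rule abs_integral_increment) (use that f in \<open>auto intro: absolutely_integrable_continuous_real\<close>)
    also have "norm \<dots> \<le> B * (b - a)"
      by (rule integral_bound) (use that f in \<open>auto intro: continuous_on_subset\<close>)
    finally show ?thesis .
  qed
  show ?thesis
    using *[of a b] *[of b a] assms(3,4) by (cases "a \<le> b") (auto simp: norm_minus_commute)
qed

lemma compact_bound2:
  fixes k :: "real \<Rightarrow> real \<Rightarrow> complex"
  assumes "continuous_on (II \<times> II) (\<lambda>(s,t). k s t)"
  obtains B where "\<And>s t. s \<in> II \<Longrightarrow> t \<in> II \<Longrightarrow> norm (k s t) \<le> B"
proof -
  have "compact ((\<lambda>(s,t). k s t) ` (II \<times> II))"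
    by (intro compact_continuous_image assms compact_Times) auto
  then have "bounded ((\<lambda>(s,t). k s t) ` (II \<times> II))" by (rule compact_imp_bounded)
  then obtain B where "\<And>z. z \<in> (\<lambda>(s,t). k s t) ` (II \<times> II) \<Longrightarrow> norm z \<le> B" 
    unfolding bounded_iff by blast
  from this[OF imageI] show thesis by (intro that[of B]) force
qed

text \<open>Continuity in \<open>s\<close> for fixed \<open>t0\<close> comes from the theorem on
  parameter integrals; the change in \<open>t\<close> is Lipschitz with a constant independent of
  \<open>s\<close>, so the two combine to joint continuity.\<close>

lemma antiderivative_continuous2:
  fixes k :: "real \<Rightarrow> real \<Rightarrow> complex"
  assumes k: "continuous_on (II \<times> II) (\<lambda>(s,t). k s t)"
  shows "continuous_on (II \<times> II) (\<lambda>(s,t). integral {-1..t} (k s))"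
proof -
  obtain B where B: "\<And>s t. s \<in> II \<Longrightarrow> t \<in> II \<Longrightarrow> norm (k s t) \<le> B" using that by (rule compact_bound2[OF k])
  have "((\<lambda>(s,t). integral {-1..t} (k s)) \<longlongrightarrow> integral {-1..t0} (k s0)) (at (s0,t0) within II \<times> II)"
    if st: "s0 \<in> II" "t0 \<in> II" for s0 t0
  proof -
    have "continuous_on (II \<times> cbox (-1) t0) (\<lambda>(s,t). k s t)"
      by (rule continuous_on_subset[OF k]) (use st in auto)
    then have "continuous_on II (\<lambda>s. integral (cbox (-1) t0) (k s))"
      by (rule integral_continuous_on_param)
    from continuous_on_compose2[OF this continuous_on_fst[OF continuous_on_id], of "II \<times> II"]
    have "continuous_on (II \<times> II) (\<lambda>z. integral {-1..t0} (k (fst z)))"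
      by (simp add: image_subset_iff mem_Times_iff)
    then have c: "((\<lambda>z. integral {-1..t0} (k (fst z))) \<longlongrightarrow> integral {-1..t0} (k s0)) (at (s0,t0) within II \<times> II)"
      using st by (auto simp: continuous_on_def)
    have d: "((\<lambda>z. integral {-1..snd z} (k (fst z)) - integral {-1..t0} (k (fst z))) \<longlongrightarrow> 0) (at (s0,t0) within II \<times> II)"
    proof (rule Lim_null_comparison)
      show "\<forall>\<^sub>F z in at (s0,t0) within II \<times> II. norm (integral {-1..snd z} (k (fst z)) - integral {-1..t0} (k (fst z))) \<le> B * \<bar>snd z - t0\<bar>"
        unfolding eventually_at_filter
      proof (rule always_eventually, intro allI impI)
        fix z assume "z \<in> II \<times> II"
        then have z: "fst z \<in> II" "snd z \<in> II" by (auto simp: mem_Times_iff)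
        show "norm (integral {-1..snd z} (k (fst z)) - integral {-1..t0} (k (fst z))) \<le> B * \<bar>snd z - t0\<bar>"
          by (rule integral_increment_bound[OF continuous_on_section[OF k z(1)] B[OF z(1)] st(2) z(2)])
      qed
      have "((\<lambda>z. B * \<bar>snd z - t0\<bar>) \<longlongrightarrow> B * \<bar>snd (s0,t0) - t0\<bar>) (at (s0,t0) within II \<times> II)"
        by (intro tendsto_intros)
      then show "((\<lambda>z. B * \<bar>snd z - t0\<bar>) \<longlongrightarrow> 0) (at (s0,t0) within II \<times> II)" by simp
    qed
    show ?thesis unfolding case_prod_unfold using tendsto_add[OF d c] by simp
  qed
  then show ?thesis by (auto simp: continuous_on_def)
qed

lemma antiderivative_param:
  fixes k k' :: "real \<Rightarrow> real \<Rightarrow> complex"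
  assumes k: "continuous_on (II \<times> II) (\<lambda>(s,t). k s t)" and k': "continuous_on (II \<times> II) (\<lambda>(s,t). k' s t)"
    and d: "\<And>s t. s \<in> II \<Longrightarrow> t \<in> II \<Longrightarrow> ((\<lambda>s. k s t) has_vector_derivative k' s t) (at s within II)"
    and "s \<in> II" "t \<in> II"
  shows "((\<lambda>s. integral {-1..t} (k s)) has_vector_derivative integral {-1..t} (k' s)) (at s within II)"
proof -
  have sub: "continuous_on (II \<times> cbox (-1) t) (\<lambda>(s,t). k' s t)"
    by (rule continuous_on_subset[OF k']) (use assms in auto)
  have "((\<lambda>s. integral (cbox (-1) t) (k s)) has_vector_derivative integral (cbox (-1) t) (k' s)) (at s within II)"
    by (rule leibniz_rule_vector_derivative[OF _ _ sub])
      (use assms in \<open>auto intro!: integrable_continuous_interval continuous_on_subset[OF continuous_on_section[OF k]]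
        has_vector_derivative_within_subset[OF d]\<close>)
  then show ?thesis by simp
qed

lemma antiderivative_deriv:
  fixes f :: "real \<Rightarrow> complex"
  assumes "continuous_on II f" "t \<in> II"
  shows "((\<lambda>t. integral {-1..t} f) has_vector_derivative f t) (at t within II)"
  by (rule integral_has_vector_derivative[OF assms])

text \<open>The bound \<open>M \<ge> 1\<close> keeps the later constants monotone. The assumptions
  survive the reflection of both variables with the same \<open>m\<close> and \<open>M\<close>, so
  an estimate for the part \<open>t \<le> s\<close> can be interpreted again for the other part with
  unchanged constants.\<close>

locale kernel =
  fixes m :: nat and D :: "nat \<Rightarrow> nat \<Rightarrow> real \<Rightarrow> real \<Rightarrow> complex" and M :: real
  assumes m_ge: "m \<ge> 1" and M_ge: "M \<ge> 1"
    and D_cont: "\<And>i j. i \<le> m \<Longrightarrow> j \<le> m \<Longrightarrow> continuous_on (II \<times> II) (\<lambda>(s,t). D i j s t)"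
    and D_bound: "\<And>i j s t. i \<le> m \<Longrightarrow> j \<le> m \<Longrightarrow> s \<in> II \<Longrightarrow> t \<in> II \<Longrightarrow> norm (D i j s t) \<le> M"
    and D_ds: "\<And>i j s t. i < m \<Longrightarrow> j \<le> m \<Longrightarrow> s \<in> II \<Longrightarrow> t \<in> II \<Longrightarrow>
       ((\<lambda>s'. D i j s' t) has_vector_derivative D (Suc i) j s t) (at s within II)"
    and D_dt: "\<And>i j s t. i \<le> m \<Longrightarrow> j < m \<Longrightarrow> s \<in> II \<Longrightarrow> t \<in> II \<Longrightarrow>
       ((\<lambda>t'. D i j s t') has_vector_derivative D i (Suc j) s t) (at t within II)"

lemma II_at_ne: "x \<in> II \<Longrightarrow> at x within II \<noteq> bot"
  by (subst trivial_limit_within) (auto simp: islimpt_Icc)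

text \<open>\<^const>\<open>C_bracket\<close> provides the derivatives in \<^term>\<open>t\<close> only for \<^term>\<open>\<alpha> = (0::nat)\<close>; the others
  follow by differentiating the fundamental theorem of calculus under the integral sign.\<close>
lemma C_bracket_kernel:
  assumes m: "m \<ge> 1" and C: "C_bracket m K"
  shows "\<exists>D M. kernel m D M \<and> (\<forall>s\<in>II. \<forall>t\<in>II. D 0 0 s t = K s t)"
proof -
  obtain D :: "nat \<Rightarrow> nat \<Rightarrow> real \<Rightarrow> real \<Rightarrow> complex" where D: "(\<forall>s\<in>II. \<forall>t\<in>II. D 0 0 s t = K s t) \<and>
     (\<forall>\<beta><m. \<forall>s\<in>II. \<forall>t\<in>II.
        ((\<lambda>t'. D 0 \<beta> s t') has_vector_derivative D 0 (Suc \<beta>) s t) (at t within II)) \<and>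
     (\<forall>\<alpha><m. \<forall>\<beta>\<le>m. \<forall>s\<in>II. \<forall>t\<in>II.
        ((\<lambda>s'. D \<alpha> \<beta> s' t) has_vector_derivative D (Suc \<alpha>) \<beta> s t) (at s within II)) \<and>
     (\<forall>\<alpha>\<le>m. \<forall>\<beta>\<le>m. continuous_on (II \<times> II) (\<lambda>(s,t). D \<alpha> \<beta> s t))"
    using C unfolding C_bracket_def by (rule exE)
  have cont: "continuous_on (II \<times> II) (\<lambda>(s,t). D i j s t)" if "i \<le> m" "j \<le> m" for i j using D that by simp
  have ds: "((\<lambda>s'. D i j s' t) has_vector_derivative D (Suc i) j s t) (at s within II)"
    if "i < m" "j \<le> m" "s \<in> II" "t \<in> II" for i j s t using D that by simp
  have dt: "((\<lambda>t'. D i j s t') has_vector_derivative D i (Suc j) s t) (at t within II)"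
    if "i \<le> m" "j < m" "s \<in> II" "t \<in> II" for i j s t
    using that
  proof (induction i arbitrary: s t)
    case 0 then show ?case using D by simp
  next
    case (Suc i)
    have ftc: "D i j s t = D i j s (-1) + integral {-1..t} (D i (Suc j) s)" if "s \<in> II" "t \<in> II" for s t
    proof -
      have "(D i (Suc j) s has_integral (D i j s t - D i j s (-1))) {-1..t}"
        by (rule fundamental_theorem_of_calculus)
          (use that Suc in \<open>auto intro!: has_vector_derivative_within_subset[OF Suc.IH]\<close>)
      then show ?thesis by (simp add: integral_unique)
    qed
    \<comment> \<open>Both sides of \<open>ftc\<close> are differentiated in \<open>s\<close>; the
      derivative within \<open>II\<close> is unique, so the results agree.\<close>
    have eq: "D (Suc i) j s t = D (Suc i) j s (-1) + integral {-1..t} (D (Suc i) (Suc j) s)" if st: "s \<in> II" "t \<in> II" for s t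
    proof (rule vector_derivative_unique_within)
      show "at s within II \<noteq> bot" by (rule II_at_ne[OF st(1)])
      show "((\<lambda>s. D i j s t) has_vector_derivative D (Suc i) j s t) (at s within II)"
        using ds st Suc by simp
      have "((\<lambda>s. D i j s (-1) + integral {-1..t} (D i (Suc j) s)) has_vector_derivative
         (D (Suc i) j s (-1) + integral {-1..t} (D (Suc i) (Suc j) s))) (at s within II)"
        by (intro has_vector_derivative_add ds antiderivative_param cont) (use st Suc in auto)
      then show "((\<lambda>s. D i j s t) has_vector_derivative
         (D (Suc i) j s (-1) + integral {-1..t} (D (Suc i) (Suc j) s))) (at s within II)"
        by (intro has_vector_derivative_transform[OF st(1) ftc[OF _ st(2)]])
    qed
    have "((\<lambda>t. D (Suc i) j s (-1) + integral {-1..t} (D (Suc i) (Suc j) s)) has_vector_derivative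
         (0 + D (Suc i) (Suc j) s t)) (at t within II)"
      by (intro has_vector_derivative_add has_vector_derivative_const antiderivative_deriv continuous_on_section[OF cont])
        (use Suc in auto)
    then show ?case
      by (intro has_vector_derivative_transform[OF Suc.prems(4) eq[OF Suc.prems(3)]]) simp_all
  qed
  have ex: "\<forall>i j. \<exists>B. i \<le> m \<longrightarrow> j \<le> m \<longrightarrow> (\<forall>s\<in>II. \<forall>t\<in>II. norm (D i j s t) \<le> B)"
  proof (intro allI)
    fix i j
    show "\<exists>B. i \<le> m \<longrightarrow> j \<le> m \<longrightarrow> (\<forall>s\<in>II. \<forall>t\<in>II. norm (D i j s t) \<le> B)"
    proof (cases "i \<le> m \<and> j \<le> m")
      case True
      then have "i \<le> m" "j \<le> m" by auto
      from compact_bound2[OF cont[OF this]] show ?thesis by metis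
    qed auto
  qed
  obtain B where "\<forall>i j. i \<le> m \<longrightarrow> j \<le> m \<longrightarrow> (\<forall>s\<in>II. \<forall>t\<in>II. norm (D i j s t) \<le> B i j)"
    using ex unfolding choice_iff by (rule exE)
  then have B: "norm (D i j s t) \<le> B i j" if "i \<le> m" "j \<le> m" "s \<in> II" "t \<in> II" for i j s t
    using that by simp
  define M where "M = 1 + (\<Sum>i\<le>m. \<Sum>j\<le>m. \<bar>B i j\<bar>)"
  have "B i j \<le> M" if "i \<le> m" "j \<le> m" for i j
  proof -
    have "\<bar>B i j\<bar> \<le> (\<Sum>j\<le>m. \<bar>B i j\<bar>)" by (rule member_le_sum) (use that in auto)
    also have "\<dots> \<le> (\<Sum>i\<le>m. \<Sum>j\<le>m. \<bar>B i j\<bar>)"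
      by (rule member_le_sum[of i "{..m}" "\<lambda>i. \<Sum>j\<le>m. \<bar>B i j\<bar>"]) (use that in \<open>auto intro: sum_nonneg\<close>)
    finally show ?thesis by (simp add: M_def)
  qed
  then have bd: "norm (D i j s t) \<le> M" if "i \<le> m" "j \<le> m" "s \<in> II" "t \<in> II" for i j s t
    using B[OF that] order_trans that by blast
  have M1: "M \<ge> 1" by (simp add: M_def sum_nonneg)
  have "kernel m D M" by (rule kernel.intro[where m=m and D=D and M=M, OF m M1 cont bd ds dt])
  then show ?thesis using D by (intro exI[of _ D] exI[of _ M]) simp
qed

section \<open>Volterra operators and oscillating factors\<close>

lemma CB_cong: "CB l \<rho> u \<Longrightarrow> (\<And>t. t \<in> II \<Longrightarrow> u t = v t) \<Longrightarrow> CB l \<rho> v"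
  unfolding CB_def by (elim exE, rule exI) simp

lemma CB_mono:
  assumes u: "CB l \<rho> u" and "k \<le> l" "\<And>j. j \<le> k \<Longrightarrow> \<rho> j \<le> \<sigma> j"
  shows "CB k \<sigma> u"
proof -
  obtain g where g: "\<And>t. t \<in> II \<Longrightarrow> g 0 t = u t"
    "\<And>j t. j < l \<Longrightarrow> t \<in> II \<Longrightarrow> (g j has_vector_derivative g (Suc j) t) (at t within II)"
    "\<And>j. j \<le> l \<Longrightarrow> continuous_on II (g j)" "\<And>j t. j \<le> l \<Longrightarrow> t \<in> II \<Longrightarrow> norm (g j t) \<le> \<rho> j"
    using that by (rule CBE[OF u])
  show ?thesis
  proof (rule CBI[of g])
    show "norm (g j t) \<le> \<sigma> j" if "j \<le> k" "t \<in> II" for j t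
      using g(4)[of j t] assms(2) assms(3)[of j] that by simp
  qed (use g assms(2) in simp_all)
qed

lemma CB_add:
  assumes u: "CB l \<rho> u" and v: "CB l \<sigma> v"
  shows "CB l (\<lambda>j. \<rho> j + \<sigma> j) (\<lambda>t. u t + v t)"
proof -
  obtain g where g: "\<And>t. t \<in> II \<Longrightarrow> g 0 t = u t"
    "\<And>j t. j < l \<Longrightarrow> t \<in> II \<Longrightarrow> (g j has_vector_derivative g (Suc j) t) (at t within II)"
    "\<And>j. j \<le> l \<Longrightarrow> continuous_on II (g j)" "\<And>j t. j \<le> l \<Longrightarrow> t \<in> II \<Longrightarrow> norm (g j t) \<le> \<rho> j"
    using that by (rule CBE[OF u])
  obtain h where h: "\<And>t. t \<in> II \<Longrightarrow> h 0 t = v t"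
    "\<And>j t. j < l \<Longrightarrow> t \<in> II \<Longrightarrow> (h j has_vector_derivative h (Suc j) t) (at t within II)"
    "\<And>j. j \<le> l \<Longrightarrow> continuous_on II (h j)" "\<And>j t. j \<le> l \<Longrightarrow> t \<in> II \<Longrightarrow> norm (h j t) \<le> \<sigma> j"
    using that by (rule CBE[OF v])
  show ?thesis
  proof (rule CBI[of "\<lambda>j t. g j t + h j t"])
    show "norm (g j t + h j t) \<le> \<rho> j + \<sigma> j" if "j \<le> l" "t \<in> II" for j t
      using norm_triangle_mono[OF g(4) h(4)] that by blast
  qed (use g h in \<open>simp_all add: has_vector_derivative_add continuous_on_add\<close>)
qed

lemma CB_zero: "(\<And>j. j \<le> l \<Longrightarrow> 0 \<le> \<rho> j) \<Longrightarrow> CB l \<rho> (\<lambda>t. 0)"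
  by (rule CBI[of "\<lambda>j t. 0"]) auto

lemma CB_continuous: "CB l \<rho> u \<Longrightarrow> continuous_on II u"
proof (erule CBE)
  fix g assume g: "\<And>t. t \<in> II \<Longrightarrow> g 0 t = u t" "\<And>j. j \<le> l \<Longrightarrow> continuous_on II (g j)"
  show "continuous_on II u" by (rule continuous_on_eq[OF g(2)[of 0] g(1)]) simp_all
qed

lemma CB_norm: "CB l \<rho> u \<Longrightarrow> t \<in> II \<Longrightarrow> norm (u t) \<le> \<rho> 0"
proof (erule CBE)
  fix g assume g: "\<And>t. t \<in> II \<Longrightarrow> g 0 t = u t" "\<And>j t. j \<le> l \<Longrightarrow> t \<in> II \<Longrightarrow> norm (g j t) \<le> \<rho> j" "t \<in> II"
  show "norm (u t) \<le> \<rho> 0" using g(1)[OF g(3)] g(2)[of 0, OF _ g(3)] by simp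
qed

lemma CB_0: "continuous_on II u \<Longrightarrow> (\<And>t. t \<in> II \<Longrightarrow> norm (u t) \<le> B) \<Longrightarrow> CB 0 (\<lambda>j. B * \<kappa> ^ j) u"
  by (rule CBI[of "\<lambda>j. u"]) auto

lemma neg_derivative:
  fixes f :: "real \<Rightarrow> complex"
  assumes "(f has_vector_derivative f') (at (- t) within II)"
  shows "((\<lambda>t. f (- t)) has_vector_derivative - f') (at t within II)"
proof -
  have neg: "uminus ` II = II" by auto
  have "((\<lambda>t. f (- t)) has_vector_derivative (-1) *\<^sub>R f') (at t within II)"
  proof (rule vector_diff_chain_within[of uminus "-1" t II f f', unfolded o_def])
    show "(uminus has_vector_derivative -1) (at t within II)" by (auto intro!: derivative_eq_intros)
    show "(f has_vector_derivative f') (at (- t) within uminus ` II)" unfolding neg by fact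
  qed
  then show ?thesis by simp
qed

lemma CB_reflect:
  assumes u: "CB l \<rho> u"
  shows "CB l \<rho> (\<lambda>t. u (- t))"
proof -
  obtain g where g: "\<And>t. t \<in> II \<Longrightarrow> g 0 t = u t"
    "\<And>j t. j < l \<Longrightarrow> t \<in> II \<Longrightarrow> (g j has_vector_derivative g (Suc j) t) (at t within II)"
    "\<And>j. j \<le> l \<Longrightarrow> continuous_on II (g j)" "\<And>j t. j \<le> l \<Longrightarrow> t \<in> II \<Longrightarrow> norm (g j t) \<le> \<rho> j"
    using that by (rule CBE[OF u])
  show ?thesis
  proof (rule CBI[of "\<lambda>j t. (-1) ^ j * g j (- t)"])
    fix j t assume j: "j < l" and t: "t \<in> II"
    have "((\<lambda>t. g j (- t)) has_vector_derivative - g (Suc j) (- t)) (at t within II)"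
      by (rule neg_derivative) (use g(2)[OF j, of "- t"] t in simp)
    from has_vector_derivative_mult_right[OF this, of "(-1)^j"]
    show "((\<lambda>t. (-1) ^ j * g j (- t)) has_vector_derivative (-1) ^ Suc j * g (Suc j) (- t)) (at t within II)"
      by simp
  next
    fix j assume "j \<le> l"
    then show "continuous_on II (\<lambda>t. (- 1) ^ j * g j (- t))"
      by (intro continuous_intros continuous_on_compose2[OF g(3)]) auto
  qed (use g in \<open>simp_all add: norm_mult norm_power\<close>)
qed

section \<open>Multiplication by phases\<close>

definition ph :: "real \<Rightarrow> real \<Rightarrow> complex" where "ph a t = exp (\<i> * complex_of_real (a * t))"

lemma ph_norm[simp]: "norm (ph a t) = 1"
  by (simp add: ph_def)

lemma ph_mult: "ph a t * ph b t = ph (a + b) t"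
  by (simp add: ph_def exp_add[symmetric] algebra_simps)

lemma ph_mult_left: "ph a t * (ph b t * x) = ph (a + b) t * x"
  by (simp add: ph_mult[symmetric])

lemma ph_0[simp]: "ph 0 t = 1"
  by (simp add: ph_def)

lemma ph_minus: "ph a (- t) = ph (- a) t"
  by (simp add: ph_def)

lemma ph_deriv: "(ph a has_vector_derivative \<i> * complex_of_real a * ph a t) (at t within S)"
proof -
  have "((\<lambda>t. exp (\<i> * complex_of_real a * t)) has_field_derivative (\<i> * complex_of_real a * exp (\<i> * complex_of_real a * of_real t))) (at (of_real t))"
    by (auto intro!: derivative_eq_intros)
  from has_vector_derivative_real_field[OF this, where s=S] show ?thesis
    by (simp add: ph_def[abs_def] mult.assoc)
qed

lemma ph_cont: "continuous_on S (ph a)"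
  unfolding ph_def[abs_def] by (intro continuous_intros)

text \<open>Differentiating the phase costs at most \<open>2 * \<kappa>\<close>, and the weight
  \<open>\<kappa> ^ j\<close> already allows for the factor \<kappa>. \<open>4 ^ l\<close> collects
  the \<open>2 ^ j\<close> Leibniz terms and the powers of the remaining \<open>2\<close>.\<close>

lemma CB_ph:
  assumes u: "CB l (\<lambda>j. B * \<kappa> ^ j) u" and a: "\<bar>a\<bar> \<le> 2 * \<kappa>" and "\<kappa> \<ge> 1" "B \<ge> 0"
  shows "CB l (\<lambda>j. 4 ^ l * B * \<kappa> ^ j) (\<lambda>t. ph a t * u t)"
proof -
  obtain g where g: "\<And>t. t \<in> II \<Longrightarrow> g 0 t = u t"
    "\<And>j t. j < l \<Longrightarrow> t \<in> II \<Longrightarrow> (g j has_vector_derivative g (Suc j) t) (at t within II)"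
    "\<And>j. j \<le> l \<Longrightarrow> continuous_on II (g j)" "\<And>j t. j \<le> l \<Longrightarrow> t \<in> II \<Longrightarrow> norm (g j t) \<le> B * \<kappa> ^ j"
    using that by (rule CBE[OF u])
  let ?z = "\<i> * complex_of_real a"
  show ?thesis
  proof (rule CBI[of "\<lambda>j t. diag j (\<lambda>p q. (?z ^ p * ph a t) * g q t)"])
    fix j t assume j: "j < l" and t: "t \<in> II"
    show "((\<lambda>t. diag j (\<lambda>p q. (?z ^ p * ph a t) * g q t)) has_vector_derivative
       diag (Suc j) (\<lambda>p q. (?z ^ p * ph a t) * g q t)) (at t within II)"
      unfolding diag_Suc
    proof (rule diag_has_vector_derivative)
      fix p q assume pq: "p + q = j"
      have "((\<lambda>t. (?z ^ p * ph a t) * g q t) has_vector_derivative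
        ((?z ^ p * ph a t) * g (Suc q) t + (?z ^ p * (?z * ph a t)) * g q t)) (at t within II)"
        by (intro has_vector_derivative_mult has_vector_derivative_mult_right ph_deriv g) (use j t pq in auto)
      then show "((\<lambda>t. (?z ^ p * ph a t) * g q t) has_vector_derivative
        (?z ^ Suc p * ph a t) * g q t + (?z ^ p * ph a t) * g (Suc q) t) (at t within II)"
        by (simp add: algebra_simps)
    qed
  next
    fix j assume j: "j \<le> l"
    show "continuous_on II (\<lambda>t. diag j (\<lambda>p q. (?z ^ p * ph a t) * g q t))"
      by (rule diag_continuous) (use j in \<open>auto intro!: continuous_intros ph_cont g\<close>)
    fix t assume t: "t \<in> II"
    have "norm (diag j (\<lambda>p q. (?z ^ p * ph a t) * g q t)) \<le> 2 ^ j * (2 ^ j * B * \<kappa> ^ j)"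
    proof (rule diag_norm)
      fix p q assume pq: "p + q = j"
      have "norm ((?z ^ p * ph a t) * g q t) = \<bar>a\<bar> ^ p * norm (g q t)"
        by (simp add: norm_mult norm_power)
      also have "\<dots> \<le> (2 * \<kappa>) ^ p * (B * \<kappa> ^ q)"
        by (intro mult_mono power_mono a g) (use assms pq j t in auto)
      also have "\<dots> = 2 ^ p * (B * \<kappa> ^ j)" by (simp add: pq[symmetric] power_mult_distrib power_add)
      also have "\<dots> \<le> 2 ^ j * (B * \<kappa> ^ j)"
        by (intro mult_right_mono power_increasing) (use assms pq in auto)
      finally show "norm ((?z ^ p * ph a t) * g q t) \<le> 2 ^ j * B * \<kappa> ^ j" by (simp add: mult.assoc)
    qed
    also have "\<dots> = (2 * 2) ^ j * (B * \<kappa> ^ j)" unfolding power_mult_distrib by (simp only: mult.assoc)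
    also have "\<dots> = 4 ^ j * (B * \<kappa> ^ j)" by simp
    also have "\<dots> \<le> 4 ^ l * (B * \<kappa> ^ j)"
      by (intro mult_right_mono power_increasing) (use assms j in auto)
    finally show "norm (diag j (\<lambda>p q. (?z ^ p * ph a t) * g q t)) \<le> 4 ^ l * B * \<kappa> ^ j" by (simp add: mult.assoc)
  qed (use g(1) in simp)
qed

definition Vop :: "(nat \<Rightarrow> nat \<Rightarrow> real \<Rightarrow> real \<Rightarrow> complex) \<Rightarrow> (real \<Rightarrow> complex) \<Rightarrow> real \<Rightarrow> complex" where
  "Vop D u s = integral {-1..s} (\<lambda>t. D 0 0 s t * u t)"

context kernel
begin

text \<open>The partial derivative of order \<open>(i, j)\<close> of \<open>K(s,t) w(t)\<close>, where \<^term>\<open>g q\<close> is the derivative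
  of order \<^term>\<open>q\<close> of \<open>w\<close>.\<close>
definition F :: "(nat \<Rightarrow> real \<Rightarrow> complex) \<Rightarrow> nat \<Rightarrow> nat \<Rightarrow> real \<Rightarrow> real \<Rightarrow> complex" where
  "F g i j s t = diag j (\<lambda>p q. D i p s t * g q t)"

lemma F_cont:
  assumes "i \<le> m" "j \<le> m" "\<And>q. q \<le> j \<Longrightarrow> continuous_on II (g q)"
  shows "continuous_on (II \<times> II) (\<lambda>(s,t). F g i j s t)"
proof -
  have "continuous_on (II \<times> II) (\<lambda>z. diag j (\<lambda>p q. D i p (fst z) (snd z) * g q (snd z)))"
  proof (rule diag_continuous)
    fix p q assume pq: "p + q = j"
    have 1: "continuous_on (II \<times> II) (\<lambda>z. D i p (fst z) (snd z))"
      using D_cont[of i p] assms pq by (simp add: case_prod_unfold)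
    have "continuous_on II (g q)" using assms pq by simp
    from continuous_on_compose2[OF this continuous_on_snd[OF continuous_on_id], of "II \<times> II"]
    have "continuous_on (II \<times> II) (\<lambda>z. g q (snd z))" by (simp add: image_subset_iff mem_Times_iff)
    with 1 show "continuous_on (II \<times> II) (\<lambda>z. D i p (fst z) (snd z) * g q (snd z))"
      by (rule continuous_on_mult)
  qed
  then show ?thesis by (simp add: F_def case_prod_unfold)
qed

lemma F_ds:
  assumes "i < m" "j \<le> m" "s \<in> II" "t \<in> II"
  shows "((\<lambda>s. F g i j s t) has_vector_derivative F g (Suc i) j s t) (at s within II)"
  unfolding F_def
proof (rule diag_has_vector_derivative)
  fix p q assume "p + q = j"
  then show "((\<lambda>s. D i p s t * g q t) has_vector_derivative D (Suc i) p s t * g q t) (at s within II)"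
    by (intro has_vector_derivative_mult_left D_ds) (use assms in auto)
qed

lemma F_dt:
  assumes "i \<le> m" "j < m" "s \<in> II" "t \<in> II"
    and g: "\<And>q. q \<le> j \<Longrightarrow> (g q has_vector_derivative g (Suc q) t) (at t within II)"
  shows "((\<lambda>t. F g i j s t) has_vector_derivative F g i (Suc j) s t) (at t within II)"
  unfolding F_def diag_Suc
proof (rule diag_has_vector_derivative)
  fix p q assume pq: "p + q = j"
  have "((\<lambda>t. D i p s t * g q t) has_vector_derivative (D i p s t * g (Suc q) t + D i (Suc p) s t * g q t)) (at t within II)"
    by (intro has_vector_derivative_mult D_dt g) (use assms pq in auto)
  then show "((\<lambda>t. D i p s t * g q t) has_vector_derivative (D i (Suc p) s t * g q t + D i p s t * g (Suc q) t)) (at t within II)"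
    by (simp add: add.commute)
qed

lemma F_bound:
  assumes "i \<le> m" "j \<le> m" "s \<in> II" "t \<in> II" and g: "\<And>q. q \<le> j \<Longrightarrow> norm (g q t) \<le> B"
  shows "norm (F g i j s t) \<le> 2 ^ j * (M * B)"
  unfolding F_def
proof (rule diag_norm)
  fix p q assume pq: "p + q = j"
  have "norm (D i p s t) \<le> M" by (rule D_bound) (use assms pq in auto)
  moreover have "norm (g q t) \<le> B" using g pq by simp
  ultimately show "norm (D i p s t * g q t) \<le> M * B"
    unfolding norm_mult by (intro mult_mono) (use M_ge in auto)
qed

text \<open>The derivatives in \<^term>\<open>t\<close> of \<open>\<integral>\<^sub>-\<^sub>1\<^sup>t K(s,r) u(r) dr\<close> do not involve an integral, so a bound
  \<^term>\<open>\<beta>\<close> for the integrals that is better than the one for \<^term>\<open>u\<close> (oscillation) pays off for all orders.\<close>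
lemma Vop_CB:
  assumes u: "CB k \<rho> u" and n: "n \<le> Suc k" "n \<le> m"
    and mono: "\<And>i j. i \<le> j \<Longrightarrow> \<rho> i \<le> \<rho> j"
    and \<beta>: "\<And>i s t. i \<le> n \<Longrightarrow> s \<in> II \<Longrightarrow> t \<in> II \<Longrightarrow> norm (integral {-1..t} (\<lambda>r. D i 0 s r * u r)) \<le> \<beta>"
  shows "CB n (\<lambda>j. 2 ^ j * (\<beta> + (if j = 0 then 0 else 2 ^ j * (M * \<rho> (j - 1))))) (Vop D u)"
proof -
  obtain g where g: "\<And>t. t \<in> II \<Longrightarrow> g 0 t = u t"
    "\<And>j t. j < k \<Longrightarrow> t \<in> II \<Longrightarrow> (g j has_vector_derivative g (Suc j) t) (at t within II)"
    "\<And>j. j \<le> k \<Longrightarrow> continuous_on II (g j)" "\<And>j t. j \<le> k \<Longrightarrow> t \<in> II \<Longrightarrow> norm (g j t) \<le> \<rho> j"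
    using that by (rule CBE[OF u])
  \<comment> \<open>\<open>j = 0\<close> is the primitive in \<open>t\<close>; one derivative in
    \<open>t\<close> removes the integral, hence the shift by one. This is why \<open>n\<close> may
    exceed \<open>k\<close> by one: order \<open>Suc k\<close> of \<open>G\<close> uses
    \<open>F\<close> up to order \<open>k\<close> only.\<close>
  define G where "G = (\<lambda>i j s t. case j of 0 \<Rightarrow> integral {-1..t} (F g i 0 s) | Suc j \<Rightarrow> F g i j s t)"
  have int: "integral {-1..t} (F g i 0 s) = integral {-1..t} (\<lambda>r. D i 0 s r * u r)" if "t \<in> II" for i s t
    by (rule integral_cong) (use that g(1) in \<open>auto simp: F_def\<close>)
  have \<beta>0: "\<beta> \<ge> 0" using order_trans[OF norm_ge_zero \<beta>[of 0 0 0]] by simp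
  have \<rho>0: "\<rho> j \<ge> 0" for j
    using order_trans[OF norm_ge_zero g(4)[of 0 0]] mono[of 0 j] by simp
  have Fc: "continuous_on (II \<times> II) (\<lambda>(s,t). F g i j s t)" if "i \<le> m" "j \<le> m" "j \<le> k" for i j
    by (rule F_cont) (use that g in auto)
  have "Ck2 n G"
    unfolding Ck2_def
  proof (intro conjI allI impI)
    fix i j assume ij: "i + j \<le> n"
    show "continuous_on (II \<times> II) (\<lambda>(s, t). G i j s t)"
    proof (cases j)
      case 0
      then show ?thesis using antiderivative_continuous2[OF Fc[of i 0]] ij n by (simp add: G_def)
    next
      case (Suc j')
      then show ?thesis using Fc[of i j'] ij n by (simp add: G_def)
    qed
  next
    fix i j s t assume ij: "i + j < n" and s: "s \<in> II" and t: "t \<in> II"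
    show "((\<lambda>s'. G i j s' t) has_vector_derivative G (Suc i) j s t) (at s within II)"
    proof (cases j)
      case 0
      have "((\<lambda>s. integral {-1..t} (F g i 0 s)) has_vector_derivative integral {-1..t} (F g (Suc i) 0 s)) (at s within II)"
        by (rule antiderivative_param[OF Fc Fc F_ds]) (use ij n s t in auto)
      then show ?thesis using 0 by (simp add: G_def)
    next
      case (Suc j')
      then show ?thesis using F_ds[of i j' s t g] ij n s t by (simp add: G_def)
    qed
    show "((\<lambda>t'. G i j s t') has_vector_derivative G i (Suc j) s t) (at t within II)"
    proof (cases j)
      case 0
      have "((\<lambda>t. integral {-1..t} (F g i 0 s)) has_vector_derivative F g i 0 s t) (at t within II)"
        by (rule antiderivative_deriv[OF continuous_on_section[OF Fc]]) (use ij n s t in auto)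
      then show ?thesis using 0 by (simp add: G_def)
    next
      case (Suc j')
      then show ?thesis using F_dt[of i j' s t g] g(2) ij n s t by (simp add: G_def)
    qed
  qed
  then have "CB n (\<lambda>j. 2 ^ j * (\<beta> + (if j = 0 then 0 else 2 ^ j * (M * \<rho> (j - 1))))) (\<lambda>s. G 0 0 s s)"
  proof (rule Ck2_diagonal)
    fix i j s t assume ij: "i + j \<le> n" and s: "s \<in> II" and t: "t \<in> II"
    show "norm (G i j s t) \<le> \<beta> + (if i + j = 0 then 0 else 2 ^ (i + j) * (M * \<rho> (i + j - 1)))"
    proof (cases j)
      case 0
      then have "norm (G i j s t) \<le> \<beta>" using \<beta>[of i s t] ij s t int[OF t] by (simp add: G_def)
      then show ?thesis using \<rho>0 M_ge by (simp add: add_increasing2)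
    next
      case (Suc j')
      have "norm (F g i j' s t) \<le> 2 ^ j' * (M * \<rho> j')"
      proof (rule F_bound)
        fix q assume "q \<le> j'"
        then show "norm (g q t) \<le> \<rho> j'" using g(4)[of q t] mono[of q j'] ij n t Suc by simp
      qed (use ij n s t Suc in auto)
      also have "\<dots> \<le> 2 ^ (i + j) * (M * \<rho> (i + j - 1))"
        by (intro mult_mono power_increasing mono) (use Suc \<rho>0 M_ge in auto)
      finally show ?thesis using Suc \<beta>0 by (simp add: G_def)
    qed
  qed
  then show ?thesis
    by (rule CB_cong) (simp add: G_def Vop_def int)
qed

lemma Vop_int_bound:
  assumes "continuous_on II u" "\<And>t. t \<in> II \<Longrightarrow> norm (u t) \<le> B" "i \<le> m" "s \<in> II" "t \<in> II"
  shows "norm (integral {-1..t} (\<lambda>r. D i 0 s r * u r)) \<le> 2 * (M * B)"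
proof -
  have c: "continuous_on II (\<lambda>r. D i 0 s r * u r)"
    by (intro continuous_on_mult continuous_on_section[OF D_cont] assms) (use assms in auto)
  have B: "norm (D i 0 s r * u r) \<le> M * B" if "r \<in> II" for r
    unfolding norm_mult by (intro mult_mono D_bound assms) (use assms M_ge that in auto)
  have B0: "0 \<le> M * B" using order_trans[OF norm_ge_zero B[of 0]] by simp
  have "norm (integral {-1..t} (\<lambda>r. D i 0 s r * u r)) \<le> M * B * (t - (-1))"
    by (rule integral_bound) (use assms B c in \<open>auto intro: continuous_on_subset\<close>)
  also have "\<dots> \<le> M * B * 2" by (rule mult_left_mono) (use assms B0 in auto)
  finally show ?thesis by (simp add: mult.commute)
qed

end

section \<open>Oscillatory integrals\<close>

text \<open>Absolute continuity in the form of increments. The step from order \<open>m - 1\<close>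
  to \<open>m\<close> in an \<open>HB\<close> chain has only this form, and classical steps have it
  too, so the whole chain can be treated alike.\<close>

definition AC :: "(real \<Rightarrow> complex) \<Rightarrow> (real \<Rightarrow> complex) \<Rightarrow> bool" where
  "AC f f' \<longleftrightarrow> f' absolutely_integrable_on II \<and>
     (\<forall>a b. -1 \<le> a \<longrightarrow> a \<le> b \<longrightarrow> b \<le> 1 \<longrightarrow> f b - f a = integral {a..b} f')"

lemma AC_D: "AC f f' \<Longrightarrow> -1 \<le> a \<Longrightarrow> a \<le> b \<Longrightarrow> b \<le> 1 \<Longrightarrow> f b - f a = integral {a..b} f'"
  by (simp add: AC_def)

lemma AC_integrable: "AC f f' \<Longrightarrow> f' absolutely_integrable_on II"
  by (simp add: AC_def)

lemma AC_add:
  assumes "AC f f'" "AC g g'"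
  shows "AC (\<lambda>t. f t + g t) (\<lambda>t. f' t + g' t)"
  unfolding AC_def
proof (intro conjI allI impI)
  have f: "f' absolutely_integrable_on II" and g: "g' absolutely_integrable_on II" using assms AC_integrable by blast+
  show "(\<lambda>t. f' t + g' t) absolutely_integrable_on II" by (rule set_integral_add(1)[OF f g])
  fix a b :: real assume ab: "-1 \<le> a" "a \<le> b" "b \<le> 1"
  have "f' integrable_on {a..b}" "g' integrable_on {a..b}"
    using f g ab by (meson absolutely_integrable_on_subinterval atLeastatMost_subset_iff set_lebesgue_integral_eq_integral(1))+
  then have "integral {a..b} (\<lambda>t. f' t + g' t) = integral {a..b} f' + integral {a..b} g'"
    by (rule Henstock_Kurzweil_Integration.integral_add)
  then show "f b + g b - (f a + g a) = integral {a..b} (\<lambda>t. f' t + g' t)"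
    using AC_D[OF assms(1) ab] AC_D[OF assms(2) ab] by (simp add: algebra_simps)
qed

lemma AC_mult:
  assumes f: "AC f f'" and q: "\<And>x. x \<in> II \<Longrightarrow> (q has_vector_derivative q' x) (at x within II)"
    and q': "continuous_on II q'"
  shows "AC (\<lambda>t. q t * f t) (\<lambda>t. q' t * f t + q t * f' t)"
  unfolding AC_def
proof (intro conjI allI impI)
  have f': "f' absolutely_integrable_on II" by (rule AC_integrable[OF f])
  have qc: "continuous_on II q" by (rule continuous_on_vector_derivative[OF q])
  have "f' integrable_on II" using f' set_lebesgue_integral_eq_integral(1) by blast
  then have "continuous_on II (\<lambda>t. f (-1) + integral {-1..t} f')"
    by (intro continuous_intros indefinite_integral_continuous_1)
  then have fc: "continuous_on II f"
  proof (rule continuous_on_eq)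
    show "f (-1) + integral {-1..t} f' = f t" if "t \<in> II" for t
      using AC_D[OF f, of "-1" t] that by (simp add: algebra_simps)
  qed
  have 1: "(\<lambda>t. q' t * f t) absolutely_integrable_on II"
    by (rule absolutely_integrable_continuous_real) (intro continuous_intros q' fc)
  have 2: "(\<lambda>t. f' t * q t) absolutely_integrable_on II"
    using integrable_mult_continuous[of "-1" 1 f' q] f' qc by (simp add: integrable_iff_abs)
  show "(\<lambda>t. q' t * f t + q t * f' t) absolutely_integrable_on II"
    using set_integral_add(1)[OF 1 2] by (simp add: mult.commute)
  fix a b :: real assume ab: "-1 \<le> a" "a \<le> b" "b \<le> 1"
  have sub: "{a..b} \<subseteq> II" using ab by auto
  have "((\<lambda>x. q' x * f x + q x * f' x) has_integral (q b * f b - q a * f a)) {a..b}"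
  proof (rule ac_by_parts[OF ab(2)])
    show "(q has_vector_derivative q' x) (at x within {a..b})" if "x \<in> {a..b}" for x
      using has_vector_derivative_within_subset[OF q sub] that sub by blast
    show "continuous_on {a..b} q'" using q' sub continuous_on_subset by blast
    show "f' absolutely_integrable_on {a..b}" using absolutely_integrable_on_subinterval[OF f' sub] .
    show "f t = f a + integral {a..t} f'" if "t \<in> {a..b}" for t
      using AC_D[OF f, of a t] that ab by (simp add: algebra_simps)
  qed
  then show "q b * f b - q a * f a = integral {a..b} (\<lambda>x. q' x * f x + q x * f' x)"
    by (simp add: integral_unique)
qed

lemma AC_derivative:
  assumes "\<And>x. x \<in> II \<Longrightarrow> (f has_vector_derivative f' x) (at x within II)" "continuous_on II f'"
  shows "AC f f'"
  unfolding AC_def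
proof (intro conjI allI impI)
  show "f' absolutely_integrable_on II" by (rule absolutely_integrable_continuous_real[OF assms(2)])
  fix a b :: real assume ab: "-1 \<le> a" "a \<le> b" "b \<le> 1"
  then have sub: "{a..b} \<subseteq> II" by auto
  have "(f' has_integral f b - f a) {a..b}"
    by (rule fundamental_theorem_of_calculus[OF ab(2)])
      (use has_vector_derivative_within_subset[OF assms(1) sub] sub in blast)
  then show "f b - f a = integral {a..b} f'" by (simp add: integral_unique)
qed

context kernel
begin

lemma AC_F:
  assumes g: "\<And>j. j < n \<Longrightarrow> AC (g j) (g (Suc j))" and n: "n \<le> m" "j < n" and i: "i \<le> m" "s \<in> II"
  shows "AC (F g i j s) (F g i (Suc j) s)"
proof -
  have "AC (\<lambda>t. diag j (\<lambda>p q. D i p s t * g q t)) (\<lambda>t. diag j (\<lambda>p q. D i (Suc p) s t * g q t + D i p s t * g (Suc q) t))"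
  proof (rule diag_rel[where R=AC and A="\<lambda>p q t. D i p s t * g q t" and B="\<lambda>p q t. D i (Suc p) s t * g q t + D i p s t * g (Suc q) t"])
    fix p q assume pq: "p + q = j"
    show "AC (\<lambda>t. D i p s t * g q t) (\<lambda>t. D i (Suc p) s t * g q t + D i p s t * g (Suc q) t)"
    proof (rule AC_mult)
      show "AC (g q) (g (Suc q))" by (rule g) (use pq n in simp)
      show "(D i p s has_vector_derivative D i (Suc p) s x) (at x within II)" if "x \<in> II" for x
        by (rule D_dt) (use that pq n i in auto)
      show "continuous_on II (D i (Suc p) s)"
        by (rule continuous_on_section[OF D_cont]) (use pq n i in auto)
    qed
  qed (rule AC_add)
  then show ?thesis unfolding F_def[abs_def] diag_Suc .
qed

text \<open>Among the \<open>g j\<close> only \<open>g m\<close> lacks a pointwise bound. Hence the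
  Leibniz bound is used with \<open>B + norm (g m r)\<close> in place of \<open>B\<close> and
  integrated afterwards: \<open>3 * B\<close> is \<open>B\<close> times the length \<open>2\<close>,
  plus \<open>B\<close> for the integral of \<open>norm (g m r)\<close>.\<close>

lemma oscillatory_top_bound:
  assumes g: "\<And>j. j < m \<Longrightarrow> AC (g j) (g (Suc j))"
    and bd: "\<And>j t. j < m \<Longrightarrow> t \<in> II \<Longrightarrow> norm (g j t) \<le> B" and top: "integral II (\<lambda>t. norm (g m t)) \<le> B"
    and i: "i \<le> m" "s \<in> II" and t: "t \<in> II"
  shows "norm (integral {-1..t} (\<lambda>r. ph (- c) r * F g i m s r)) \<le> 2 ^ m * (M * (3 * B))"
proof -
  obtain k where k: "m = Suc k" using m_ge by (cases m) auto
  have gm: "g m absolutely_integrable_on II" using AC_integrable[OF g[of k]] k by simp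
  then have gmn: "(\<lambda>t. norm (g m t)) integrable_on II" unfolding absolutely_integrable_on_def by simp
  have "AC (F g i k s) (F g i (Suc k) s)" by (rule AC_F[where n=m]) (use g k i in auto)
  then have Fm: "F g i m s absolutely_integrable_on II" using k AC_integrable by simp
  have "(\<lambda>r. F g i m s r * ph (- c) r) absolutely_integrable_on II"
    using integrable_mult_continuous[of "-1" 1 "F g i m s" "ph (- c)"] Fm ph_cont by (simp add: integrable_iff_abs)
  then have pF: "(\<lambda>r. ph (- c) r * F g i m s r) absolutely_integrable_on II" by (simp add: mult.commute)
  have "norm (integral {-1..t} (\<lambda>r. ph (- c) r * F g i m s r)) \<le> integral II (\<lambda>r. norm (ph (- c) r * F g i m s r))"
    by (rule abs_integral_increment(2)[OF pF]) (use t in auto)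
  also have "\<dots> \<le> integral II (\<lambda>r. 2 ^ m * (M * (B + norm (g m r))))"
  proof (rule integral_le)
    show "(\<lambda>r. norm (ph (- c) r * F g i m s r)) integrable_on II" using pF unfolding absolutely_integrable_on_def by simp
    show "(\<lambda>r. 2 ^ m * (M * (B + norm (g m r)))) integrable_on II"
      by (intro integrable_on_mult_right integrable_add gmn integrable_const_ivl)
    fix r :: real assume r: "r \<in> II"
    have "norm (F g i m s r) \<le> 2 ^ m * (M * (B + norm (g m r)))"
    proof (rule F_bound)
      fix q assume "q \<le> m"
      show "norm (g q r) \<le> B + norm (g m r)"
      proof (cases "q = m")
        case True
        have "0 \<le> B" using order_trans[OF norm_ge_zero bd[of 0 0]] m_ge by simp
        then show ?thesis using True by simp
      next
        case False
        then have "norm (g q r) \<le> B" using \<open>q \<le> m\<close> by (intro bd r) simp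
        then show ?thesis by (simp add: add_increasing2)
      qed
    qed (use i r in auto)
    then show "norm (ph (- c) r * F g i m s r) \<le> 2 ^ m * (M * (B + norm (g m r)))" by (simp add: norm_mult)
  qed
  also have "\<dots> = 2 ^ m * (M * (integral II (\<lambda>r. B) + integral II (\<lambda>r. norm (g m r))))"
    using gmn by (simp add: Henstock_Kurzweil_Integration.integral_add integrable_const_ivl)
  also have "\<dots> \<le> 2 ^ m * (M * (3 * B))"
    by (intro mult_left_mono) (use top M_ge in auto)
  finally show ?thesis .
qed

text \<open>With \<open>L = \<i>c\<close> let \<open>a\<^sub>0(s,t)\<close> be the solution of \<open>\<partial>\<^sub>t a\<^sub>0 = L a\<^sub>0 + K(s,t) w(t)\<close> whose derivative
  \<open>a\<^sub>m\<close> of order \<open>m\<close> in \<open>t\<close> vanishes at \<open>t = -1\<close>; the initial value \<open>\<gamma>\<close> below is chosen for this purpose.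
  Then \<open>a\<^sub>m\<close> is an oscillatory integral of \<open>\<partial>\<^sub>t\<^sup>m(K w)\<close>, hence bounded independently of \<open>c\<close>, and the lower
  derivatives are bounded because of \<open>L a\<^sub>j = a\<^bsub>j+1\<^esub> - \<partial>\<^sub>t\<^sup>j(K w)\<close>.\<close>
lemma oscillatory_split:
  assumes c: "\<bar>c\<bar> \<ge> 1" and w: "HB m B w"
  shows "\<exists>a b. CB m (\<lambda>_. 4 ^ m * (M * (real m + 3)) * B) a \<and> CB m (\<lambda>_. 4 ^ m * (M * (real m + 3)) * B) b \<and>
     (\<forall>s\<in>II. Vop D (\<lambda>t. ph (- c) t * w t) s = ph (- c) s * a s + b s)"
proof -
  obtain k where k: "m = Suc k" using m_ge by (cases m) auto
  obtain g' h where g': "\<And>t. t \<in> II \<Longrightarrow> g' 0 t = w t"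
    "\<And>j t. Suc j < m \<Longrightarrow> t \<in> II \<Longrightarrow> (g' j has_vector_derivative g' (Suc j) t) (at t within II)"
    "\<And>j. j < m \<Longrightarrow> continuous_on II (g' j)"
    "\<And>j t. j < m \<Longrightarrow> t \<in> II \<Longrightarrow> norm (g' j t) \<le> B"
    "h absolutely_integrable_on II" "integral II (\<lambda>t. norm (h t)) \<le> B"
    "\<And>a b. -1 \<le> a \<Longrightarrow> a \<le> b \<Longrightarrow> b \<le> 1 \<Longrightarrow> g' (m - 1) b - g' (m - 1) a = integral {a..b} h"
    using that by (rule HBE[OF w])
  \<comment> \<open>The integrable top derivative \<open>h\<close> joins the chain as its member of
    index \<open>m\<close>.\<close>
  define g where "g = g'(m := h)"
  have gw: "\<And>t. t \<in> II \<Longrightarrow> g 0 t = w t" using g'(1) m_ge by (simp add: g_def)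
  have gd: "(g j has_vector_derivative g (Suc j) t) (at t within II)" if "Suc j < m" "t \<in> II" for j t
    using g'(2)[OF that] that by (simp add: g_def)
  have gc: "continuous_on II (g j)" if "j < m" for j using g'(3)[OF that] that by (simp add: g_def)
  have gb: "norm (g j t) \<le> B" if "j < m" "t \<in> II" for j t using g'(4)[OF that] that by (simp add: g_def)
  have gm: "integral II (\<lambda>t. norm (g m t)) \<le> B" using g'(6) by (simp add: g_def)
  have gAC: "AC (g j) (g (Suc j))" if "j < m" for j
  proof (cases "Suc j < m")
    case True then show ?thesis by (intro AC_derivative gd gc) auto
  next
    case False
    then have "j = k" using that k by simp
    then show ?thesis using g'(5,7) k by (simp add: AC_def g_def)
  qed
  have B0: "0 \<le> B" using order_trans[OF norm_ge_zero gb[of 0 0]] m_ge by simp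
  define L where "L = \<i> * complex_of_real c"
  have L: "norm L \<ge> 1" "L \<noteq> 0" using c by (auto simp: L_def norm_mult)
  have Fc: "continuous_on (II \<times> II) (\<lambda>(s,t). F g i j s t)" if "i \<le> m" "j < m" for i j
    by (rule F_cont) (use that gc in auto)
  have Fb: "norm (F g i j s t) \<le> 2 ^ m * (M * B)" if "i \<le> m" "j < m" "s \<in> II" "t \<in> II" for i j s t
  proof -
    have "norm (F g i j s t) \<le> 2 ^ j * (M * B)" by (rule F_bound) (use that gb in auto)
    also have "\<dots> \<le> 2 ^ m * (M * B)"
      by (intro mult_right_mono power_increasing) (use that B0 M_ge in auto)
    finally show ?thesis .
  qed
  define J where "J = (\<lambda>i s t. integral {-1..t} (\<lambda>r. ph (- c) r * F g i 0 s r))"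
  \<comment> \<open>Solving \<open>a_(j+1) = L a_j + F_j\<close> at \<open>t = -1\<close> backwards
    from \<open>a_m = 0\<close> gives \<open>a_0 = - S\<close>, where \<open>S\<close> is the sum of
    all \<open>(1/L)^(l+1) F_l\<close> with \<open>l < m\<close>. As \<open>J\<close> vanishes at
    \<open>-1\<close>, this means \<open>ph c (-1) * \<gamma> = S\<close>.\<close>
  define \<gamma> where "\<gamma> = (\<lambda>i s. ph c 1 * (\<Sum>l<m. (1/L) ^ Suc l * F g i l s (-1)))"
  \<comment> \<open>The derivatives in \<open>t\<close> are defined by the differential equation and
    verified to be derivatives afterwards, which avoids expanding derivatives of the phase.\<close>
  define a where "a = (\<lambda>i j s t. rec_nat (ph c t * (J i s t - \<gamma> i s)) (\<lambda>j x. L * x + F g i j s t) j)"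
  have a0: "a i 0 s t = ph c t * (J i s t - \<gamma> i s)" for i s t by (simp add: a_def)
  have aS: "a i (Suc j) s t = L * a i j s t + F g i j s t" for i j s t by (simp add: a_def)
  have pFc: "continuous_on (II \<times> II) (\<lambda>(s,t). ph (- c) t * F g i 0 s t)" if "i \<le> m" for i
  proof -
    have "continuous_on (II \<times> II) (\<lambda>z. ph (- c) (snd z))"
      by (rule continuous_on_compose2[OF ph_cont[of UNIV] continuous_on_snd[OF continuous_on_id]]) simp
    moreover have "continuous_on (II \<times> II) (\<lambda>z. F g i 0 (fst z) (snd z))"
      using Fc[OF that, of 0] m_ge by (simp add: case_prod_unfold)
    ultimately show ?thesis unfolding case_prod_unfold by (rule continuous_on_mult)
  qed
  have F1c: "continuous_on II (\<lambda>s. F g i l s (-1))" if "i \<le> m" "l < m" for i l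
  proof -
    have "continuous_on II (\<lambda>s::real. (s, -1::real))" by (intro continuous_intros)
    from continuous_on_compose2[OF Fc[OF that] this] show ?thesis by (simp add: image_subset_iff)
  qed
  have \<gamma>c: "continuous_on II (\<gamma> i)" if "i \<le> m" for i
    unfolding \<gamma>_def by (intro continuous_intros F1c) (use that in auto)
  have \<gamma>d: "(\<gamma> i has_vector_derivative \<gamma> (Suc i) s) (at s within II)" if "i < m" "s \<in> II" for i s
    unfolding \<gamma>_def
    by (intro has_vector_derivative_mult_right has_vector_derivative_sum F_ds) (use that in auto)
  have Jc: "continuous_on (II \<times> II) (\<lambda>(s,t). J i s t)" if "i \<le> m" for i
    unfolding J_def by (rule antiderivative_continuous2[OF pFc[OF that]])
  have Jds: "((\<lambda>s. J i s t) has_vector_derivative J (Suc i) s t) (at s within II)" if "i < m" "s \<in> II" "t \<in> II" for i s t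
    unfolding J_def
    by (rule antiderivative_param[OF pFc pFc has_vector_derivative_mult_right[OF F_ds]]) (use that in auto)
  have Jdt: "((\<lambda>t. J i s t) has_vector_derivative ph (- c) t * F g i 0 s t) (at t within II)" if "i \<le> m" "s \<in> II" "t \<in> II" for i s t
    unfolding J_def by (rule antiderivative_deriv[OF continuous_on_section[OF pFc]]) (use that in auto)
  have ac: "continuous_on (II \<times> II) (\<lambda>(s,t). a i j s t)" if "i \<le> m" "j \<le> m" for i j
    using that(2)
  proof (induction j)
    case 0
    have 1: "continuous_on (II \<times> II) (\<lambda>z. ph c (snd z))"
      by (rule continuous_on_compose2[OF ph_cont[of UNIV] continuous_on_snd[OF continuous_on_id]]) simp
    have 2: "continuous_on (II \<times> II) (\<lambda>z. \<gamma> i (fst z))"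
      by (rule continuous_on_compose2[OF \<gamma>c[OF that(1)] continuous_on_fst[OF continuous_on_id]]) auto
    have 3: "continuous_on (II \<times> II) (\<lambda>z. J i (fst z) (snd z))" using Jc[OF that(1)] by (simp add: case_prod_unfold)
    show ?case unfolding a0 case_prod_unfold by (intro continuous_on_mult continuous_on_diff 1 2 3)
  next
    case (Suc j)
    have 1: "continuous_on (II \<times> II) (\<lambda>z. F g i j (fst z) (snd z))" using Fc[OF that(1), of j] Suc by (simp add: case_prod_unfold)
    have 2: "continuous_on (II \<times> II) (\<lambda>z. a i j (fst z) (snd z))" using Suc by (simp add: case_prod_unfold)
    show ?case unfolding aS case_prod_unfold by (intro continuous_on_add continuous_on_mult continuous_on_const 1 2)
  qed
  have ads: "((\<lambda>s. a i j s t) has_vector_derivative a (Suc i) j s t) (at s within II)" if "i < m" "j \<le> m" "s \<in> II" "t \<in> II" for i j s t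
    using that(2)
  proof (induction j)
    case 0
    show ?case unfolding a0
      by (intro has_vector_derivative_mult_right has_vector_derivative_diff Jds \<gamma>d) (use that in auto)
  next
    case (Suc j)
    then show ?case unfolding aS
      by (intro has_vector_derivative_mult_right has_vector_derivative_add F_ds) (use that in auto)
  qed
  have adt: "((\<lambda>t. a i j s t) has_vector_derivative a i (Suc j) s t) (at t within II)" if "i \<le> m" "j < m" "s \<in> II" "t \<in> II" for i j s t
    using that(2)
  proof (induction j)
    case 0
    have "((\<lambda>t. ph c t * (J i s t - \<gamma> i s)) has_vector_derivative
      (ph c t * (ph (- c) t * F g i 0 s t - 0) + \<i> * complex_of_real c * ph c t * (J i s t - \<gamma> i s))) (at t within II)"
      by (intro has_vector_derivative_mult has_vector_derivative_diff has_vector_derivative_const ph_deriv Jdt that)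
    moreover have "ph c t * (ph (- c) t * F g i 0 s t - 0) + \<i> * complex_of_real c * ph c t * (J i s t - \<gamma> i s) = a i (Suc 0) s t"
      unfolding aS a0 by (simp add: ph_mult_left L_def mult.assoc)
    ultimately show ?case unfolding a0 by simp
  next
    case (Suc j)
    have "((\<lambda>t. L * a i j s t + F g i j s t) has_vector_derivative (L * a i (Suc j) s t + F g i (Suc j) s t)) (at t within II)"
      by (intro has_vector_derivative_mult_right has_vector_derivative_add F_dt gd Suc.IH) (use Suc.prems that in auto)
    then show ?case by (simp only: aS[of i j, symmetric] aS[of i "Suc j", symmetric])
  qed
  have am1: "a i j s (-1) = - (\<Sum>l<m-j. (1/L) ^ Suc l * F g i (l + j) s (-1))" if "j < m" for i j s
    using that
  proof (induction j)
    case 0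
    have "ph c (-1) * ph c 1 = 1" by (simp add: ph_minus ph_mult)
    then show ?case by (simp add: a0 J_def \<gamma>_def mult.assoc[symmetric])
  next
    case (Suc j)
    then have mj: "m - j = Suc (m - Suc j)" by simp
    have gen: "L * (- ((1/L) * x + S)) = - x - L * S" for x S
      using L(2) by (simp add: algebra_simps)
    have "a i j s (-1) = - (\<Sum>l<m-j. (1/L) ^ Suc l * F g i (l + j) s (-1))" using Suc by simp
    also have "\<dots> = - ((1/L) * F g i j s (-1) + (\<Sum>l<m - Suc j. (1/L) ^ Suc (Suc l) * F g i (l + Suc j) s (-1)))"
      unfolding mj sum.lessThan_Suc_shift by simp
    finally have "L * a i j s (-1) = - F g i j s (-1) - L * (\<Sum>l<m - Suc j. (1/L) ^ Suc (Suc l) * F g i (l + Suc j) s (-1))"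
      by (simp only: gen)
    also have "L * (\<Sum>l<m - Suc j. (1/L) ^ Suc (Suc l) * F g i (l + Suc j) s (-1)) = (\<Sum>l<m - Suc j. (1/L) ^ Suc l * F g i (l + Suc j) s (-1))"
      unfolding sum_distrib_left by (rule sum.cong) (use L(2) in auto)
    finally show ?case by (simp add: aS)
  qed
  \<comment> \<open>\<open>F g i k s\<close> is only absolutely continuous, so \<open>a i m\<close>
    need not be differentiable in \<open>t\<close>. Instead the increments from \<open>-1\<close> of
    \<open>ph (- c) * a i k\<close> and of \<open>ph (- c) * F g i k\<close> are compared: the
    integrals with factor \<open>L\<close> cancel, the initial values cancel by the choice of
    \<gamma>, and the integral of \<open>ph (- c) * F g i m\<close> is left.\<close>
  have top: "norm (a i m s t) \<le> 2 ^ m * (M * (3 * B))" if i: "i \<le> m" and s: "s \<in> II" and t: "t \<in> II" for i s t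
  proof -
    have km: "k < m" using k by simp
    let ?F = "F g i k s"
    have a1: "a i k s (-1) = - ((1/L) * ?F (-1))" using am1[OF km] k by simp
    have d: "((\<lambda>t. ph (- c) t * a i k s t) has_vector_derivative ph (- c) t * ?F t) (at t within II)" if "t \<in> II" for t
    proof -
      have "((\<lambda>t. ph (- c) t * a i k s t) has_vector_derivative
         (ph (- c) t * a i (Suc k) s t + \<i> * complex_of_real (- c) * ph (- c) t * a i k s t)) (at t within II)"
        by (intro has_vector_derivative_mult ph_deriv adt i s that km)
      moreover have "ph (- c) t * a i (Suc k) s t + \<i> * complex_of_real (- c) * ph (- c) t * a i k s t = ph (- c) t * ?F t"
        by (simp add: aS L_def algebra_simps)
      ultimately show ?thesis by simp
    qed
    have Fkc: "continuous_on II ?F" by (rule continuous_on_section[OF Fc[OF i km] s])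
    have cF: "continuous_on II (\<lambda>t. ph (- c) t * ?F t)" by (intro continuous_on_mult ph_cont Fkc)
    have "AC (\<lambda>t. ph (- c) t * a i k s t) (\<lambda>t. ph (- c) t * ?F t)"
      by (rule AC_derivative[OF d cF])
    then have 1: "ph (- c) t * a i k s t - ph (- c) (-1) * a i k s (-1) = integral {-1..t} (\<lambda>t. ph (- c) t * ?F t)"
      using t AC_D[of _ _ "-1" t] by auto
    have ACF: "AC ?F (F g i m s)" unfolding k
      by (rule AC_F[where n=m]) (use gAC k i s in auto)
    have "AC (\<lambda>t. ph (- c) t * ?F t) (\<lambda>t. \<i> * complex_of_real (- c) * ph (- c) t * ?F t + ph (- c) t * F g i m s t)"
      by (rule AC_mult[OF ACF ph_deriv]) (intro continuous_intros ph_cont)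
    then have 2: "ph (- c) t * ?F t - ph (- c) (-1) * ?F (-1) = integral {-1..t} (\<lambda>t. \<i> * complex_of_real (- c) * ph (- c) t * ?F t + ph (- c) t * F g i m s t)"
      using t AC_D[of _ _ "-1" t] by auto
    have sub: "{-1..t} \<subseteq> II" using t by auto
    have Fm: "F g i m s absolutely_integrable_on II" by (rule AC_integrable[OF ACF])
    have "(\<lambda>r. F g i m s r * ph (- c) r) absolutely_integrable_on II"
      using integrable_mult_continuous[of "-1" 1 "F g i m s" "ph (- c)"] Fm ph_cont by (simp add: integrable_iff_abs)
    then have "(\<lambda>r. ph (- c) r * F g i m s r) absolutely_integrable_on {-1..t}"
      using absolutely_integrable_on_subinterval[OF _ sub] by (simp add: mult.commute)
    then have I2: "(\<lambda>r. ph (- c) r * F g i m s r) integrable_on {-1..t}" using set_lebesgue_integral_eq_integral(1) by blast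
    have I1: "(\<lambda>t. - L * (ph (- c) t * ?F t)) integrable_on {-1..t}"
      by (intro integrable_continuous_interval continuous_intros continuous_on_subset[OF cF sub])
    have "integral {-1..t} (\<lambda>t. \<i> * complex_of_real (- c) * ph (- c) t * ?F t + ph (- c) t * F g i m s t)
       = integral {-1..t} (\<lambda>t. - L * (ph (- c) t * ?F t) + ph (- c) t * F g i m s t)"
      by (simp add: L_def mult.assoc)
    also have "\<dots> = integral {-1..t} (\<lambda>t. - L * (ph (- c) t * ?F t)) + integral {-1..t} (\<lambda>t. ph (- c) t * F g i m s t)"
      by (rule Henstock_Kurzweil_Integration.integral_add[OF I1 I2])
    also have "integral {-1..t} (\<lambda>t. - L * (ph (- c) t * ?F t)) = - L * integral {-1..t} (\<lambda>t. ph (- c) t * ?F t)"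
      by (rule integral_mult_right)
    finally have 3: "ph (- c) t * ?F t - ph (- c) (-1) * ?F (-1) =
        - L * integral {-1..t} (\<lambda>t. ph (- c) t * ?F t) + integral {-1..t} (\<lambda>t. ph (- c) t * F g i m s t)"
      using 2 by simp
    have "ph (- c) t * a i m s t = L * (ph (- c) t * a i k s t) + ph (- c) t * ?F t"
      unfolding k aS by (simp add: algebra_simps)
    also have "ph (- c) t * a i k s t = ph (- c) (-1) * a i k s (-1) + integral {-1..t} (\<lambda>t. ph (- c) t * ?F t)"
      using 1 by (simp add: algebra_simps)
    also have "L * (ph (- c) (-1) * a i k s (-1) + integral {-1..t} (\<lambda>t. ph (- c) t * ?F t)) + ph (- c) t * ?F t
       = integral {-1..t} (\<lambda>t. ph (- c) t * F g i m s t)"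
      using 3 L(2) by (simp add: a1 algebra_simps)
    finally have "norm (ph (- c) t * a i m s t) \<le> 2 ^ m * (M * (3 * B))"
      using oscillatory_top_bound[OF gAC gb gm i s t] by simp
    then show ?thesis by (simp add: norm_mult)
  qed
  \<comment> \<open>From the top downwards: \<open>norm L \<ge> 1\<close> permits division by
    \<open>L\<close>, and each step adds one bound for \<open>F\<close>, whence
    \<open>real l + 3\<close>.\<close>
  have ab: "norm (a i (m - l) s t) \<le> 2 ^ m * (M * (real l + 3) * B)" if "l \<le> m" "i \<le> m" "s \<in> II" "t \<in> II" for i l s t
    using that(1)
  proof (induction l)
    case 0
    then show ?case using top[OF that(2-4)] by (simp add: mult.assoc)
  next
    case (Suc l)
    then have ml: "m - l = Suc (m - Suc l)" by simp
    let ?x = "a i (m - Suc l) s t" and ?f = "F g i (m - Suc l) s t"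
    have "norm ?x \<le> norm L * norm ?x" using L(1) by (simp add: mult_left_le_imp_le mult_right_mono[of 1 "norm L" "norm ?x", simplified])
    also have "\<dots> = norm (a i (m - l) s t - ?f)" unfolding ml aS by (simp add: norm_mult)
    also have "\<dots> \<le> norm (a i (m - l) s t) + norm ?f" by (rule norm_triangle_ineq4)
    also have "\<dots> \<le> 2 ^ m * (M * (real l + 3) * B) + 2 ^ m * (M * B)"
      by (intro add_mono Suc.IH Fb) (use Suc that in auto)
    also have "\<dots> = 2 ^ m * (M * (real (Suc l) + 3) * B)" by (simp add: algebra_simps)
    finally show ?case .
  qed
  let ?C = "2 ^ m * (M * (real m + 3) * B)"
  have C0: "0 \<le> ?C" using B0 M_ge by simp
  have ab': "norm (a i j s t) \<le> ?C" if "i \<le> m" "j \<le> m" "s \<in> II" "t \<in> II" for i j s t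
  proof -
    have "norm (a i j s t) \<le> 2 ^ m * (M * (real (m - j) + 3) * B)"
      using ab[of "m - j" i s t] that by simp
    also have "\<dots> \<le> ?C" by (intro mult_left_mono mult_right_mono) (use B0 M_ge in auto)
    finally show ?thesis .
  qed
  have Ck: "Ck2 m a"
    unfolding Ck2_def using ac ads adt by simp
  have "CB m (\<lambda>k. 2 ^ k * ?C) (\<lambda>s. a 0 0 s s)"
    by (rule Ck2_diagonal[OF Ck]) (rule ab', auto)
  then have A: "CB m (\<lambda>_. 4 ^ m * (M * (real m + 3)) * B) (\<lambda>s. a 0 0 s s)"
  proof (rule CB_mono)
    fix j assume "j \<le> m"
    then have "2 ^ j * ?C \<le> 2 ^ m * ?C" using C0 by (intro mult_right_mono power_increasing) auto
    also have "\<dots> = (2 * 2) ^ m * (M * (real m + 3)) * B" unfolding power_mult_distrib by (simp only: mult.assoc)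
    finally show "2 ^ j * ?C \<le> 4 ^ m * (M * (real m + 3)) * B" by simp
  qed simp
  \<comment> \<open>\<open>\<gamma> 0\<close> becomes the amplitude \<open>b\<close>; the powers of
    \<open>1/L\<close> in it are at most \<open>1\<close>, so the bound does not depend on
    \<open>c\<close>.\<close>
  have G: "CB m (\<lambda>_. 4 ^ m * (M * (real m + 3)) * B) (\<gamma> 0)"
  proof (rule CBI[of \<gamma>])
    fix i t assume i: "i \<le> m" and t: "t \<in> II"
    have "norm (\<gamma> i t) \<le> (\<Sum>l<m. norm ((1/L) ^ Suc l * F g i l t (-1)))"
      unfolding \<gamma>_def norm_mult[of "ph c 1"] ph_norm mult_1 by (rule norm_sum)
    also have "\<dots> \<le> (\<Sum>l<m. 2 ^ m * (M * B))"
    proof (rule sum_mono)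
      fix l assume l: "l \<in> {..<m}"
      have 1: "norm ((1/L) ^ Suc l) \<le> 1" unfolding norm_power
        by (rule power_le_one) (use L in \<open>auto simp: norm_divide\<close>)
      have 2: "norm (F g i l t (-1)) \<le> 2 ^ m * (M * B)" by (rule Fb) (use i l t in auto)
      have "norm ((1/L) ^ Suc l) * norm (F g i l t (-1)) \<le> 1 * (2 ^ m * (M * B))"
        by (rule mult_mono[OF 1 2]) auto
      then show "norm ((1/L) ^ Suc l * F g i l t (-1)) \<le> 2 ^ m * (M * B)" by (simp only: norm_mult mult_1)
    qed
    also have "\<dots> = 2 ^ m * (M * real m * B)" by simp
    also have "\<dots> \<le> 4 ^ m * (M * (real m + 3) * B)"
      by (intro mult_mono power_mono) (use B0 M_ge in auto)
    finally show "norm (\<gamma> i t) \<le> 4 ^ m * (M * (real m + 3)) * B" by (simp add: mult.assoc)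
  qed (use \<gamma>d \<gamma>c in auto)
  have "Vop D (\<lambda>t. ph (- c) t * w t) s = ph (- c) s * a 0 0 s s + \<gamma> 0 s" if s: "s \<in> II" for s
  proof -
    have "Vop D (\<lambda>t. ph (- c) t * w t) s = J 0 s s"
      unfolding Vop_def J_def by (rule integral_cong) (use s gw in \<open>auto simp: F_def\<close>)
    then show ?thesis unfolding a0 by (simp add: ph_mult_left)
  qed
  with A G show ?thesis by blast
qed

end

section \<open>The two halves of the integral operator\<close>

text \<open>The \<open>2\<close> is the length of \<open>II\<close>, over which the bounded top
  derivative is integrated.\<close>

lemma CB_imp_HB:
  assumes m: "m \<ge> 1" and u: "CB m (\<lambda>_. B) u"
  shows "HB m (2 * B) u"
proof -
  obtain g where g: "\<And>t. t \<in> II \<Longrightarrow> g 0 t = u t"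
    "\<And>j t. j < m \<Longrightarrow> t \<in> II \<Longrightarrow> (g j has_vector_derivative g (Suc j) t) (at t within II)"
    "\<And>j. j \<le> m \<Longrightarrow> continuous_on II (g j)" "\<And>j t. j \<le> m \<Longrightarrow> t \<in> II \<Longrightarrow> norm (g j t) \<le> B"
    using that by (rule CBE[OF u])
  have B0: "0 \<le> B" using order_trans[OF norm_ge_zero g(4)[of 0 0]] by simp
  have AC: "AC (g (m - 1)) (g (Suc (m - 1)))"
    by (rule AC_derivative[OF g(2) g(3)]) (use m in auto)
  show ?thesis
  proof (rule HBI[of g, where h = "g m"])
    show "norm (g j t) \<le> 2 * B" if "j < m" "t \<in> II" for j t using g(4)[of j t] that B0 by simp
    show "g m absolutely_integrable_on II" using AC_integrable[OF AC] m by simp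
    have "integral II (\<lambda>t. norm (g m t)) \<le> integral II (\<lambda>t. B)"
      by (rule integral_le) (use g(3,4)[of m] in \<open>auto intro!: integrable_continuous_interval continuous_intros\<close>)
    then show "integral II (\<lambda>t. norm (g m t)) \<le> 2 * B" by simp
    show "g (m - 1) b - g (m - 1) a = integral {a..b} (g m)" if "-1 \<le> a" "a \<le> b" "b \<le> 1" for a b
      using AC_D[OF AC that] m by simp
  qed (use g in simp_all)
qed

lemma HB_imp_CB:
  assumes m: "m \<ge> 1" and w: "HB m B w"
  shows "CB (m - 1) (\<lambda>_. B) w"
proof -
  obtain g h where g: "\<And>t. t \<in> II \<Longrightarrow> g 0 t = w t"
    "\<And>j t. Suc j < m \<Longrightarrow> t \<in> II \<Longrightarrow> (g j has_vector_derivative g (Suc j) t) (at t within II)"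
    "\<And>j. j < m \<Longrightarrow> continuous_on II (g j)"
    "\<And>j t. j < m \<Longrightarrow> t \<in> II \<Longrightarrow> norm (g j t) \<le> B"
    "h absolutely_integrable_on II" "integral II (\<lambda>t. norm (h t)) \<le> B"
    "\<And>a b. -1 \<le> a \<Longrightarrow> a \<le> b \<Longrightarrow> b \<le> 1 \<Longrightarrow> g (m - 1) b - g (m - 1) a = integral {a..b} h"
    using that by (rule HBE[OF w])
  show ?thesis by (rule CBI[of g]) (use g(1-4) m in auto)
qed

lemma HB_reflect:
  assumes m: "m \<ge> 1" and w: "HB m B w"
  shows "HB m B (\<lambda>t. w (- t))"
proof -
  obtain g h where g: "\<And>t. t \<in> II \<Longrightarrow> g 0 t = w t"
    "\<And>j t. Suc j < m \<Longrightarrow> t \<in> II \<Longrightarrow> (g j has_vector_derivative g (Suc j) t) (at t within II)"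
    "\<And>j. j < m \<Longrightarrow> continuous_on II (g j)"
    "\<And>j t. j < m \<Longrightarrow> t \<in> II \<Longrightarrow> norm (g j t) \<le> B"
    "h absolutely_integrable_on II" "integral II (\<lambda>t. norm (h t)) \<le> B"
    "\<And>a b. -1 \<le> a \<Longrightarrow> a \<le> b \<Longrightarrow> b \<le> 1 \<Longrightarrow> g (m - 1) b - g (m - 1) a = integral {a..b} h"
    using that by (rule HBE[OF w])
  show ?thesis
  proof (rule HBI[of "\<lambda>j t. (-1) ^ j * g j (- t)", where h = "\<lambda>t. (-1) ^ m * h (- t)"])
    fix j t assume j: "Suc j < m" and t: "t \<in> II"
    have "((\<lambda>t. g j (- t)) has_vector_derivative - g (Suc j) (- t)) (at t within II)"
      by (rule neg_derivative) (use g(2)[OF j, of "- t"] t in simp)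
    from has_vector_derivative_mult_right[OF this, of "(-1)^j"]
    show "((\<lambda>t. (-1) ^ j * g j (- t)) has_vector_derivative (-1) ^ Suc j * g (Suc j) (- t)) (at t within II)"
      by simp
  next
    fix j assume "j < m"
    then show "continuous_on II (\<lambda>t. (- 1) ^ j * g j (- t))"
      by (intro continuous_intros continuous_on_compose2[OF g(3)]) auto
  next
    have "(\<lambda>t. h (- t)) absolutely_integrable_on {- 1..- (- 1)}"
      using g(5) absolutely_integrable_reflect_real[where f=h and a="-1" and b=1] by simp
    then show "(\<lambda>t. (-1) ^ m * h (- t)) absolutely_integrable_on II"
      using integrable_mult_continuous[of "-1" 1 "\<lambda>t. h (- t)" "\<lambda>t. (-1) ^ m"]
      by (simp add: integrable_iff_abs mult.commute)
    have "integral {-1..1} (\<lambda>t. norm (h (- t))) = integral II (\<lambda>t. norm (h t))"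
      using Henstock_Kurzweil_Integration.integral_reflect_real[where f="\<lambda>t. norm (h t)" and a="-1" and b=1] by simp
    then show "integral II (\<lambda>t. norm ((-1) ^ m * h (- t))) \<le> B" using g(6) by (simp add: norm_mult norm_power)
  next
    fix a b :: real assume ab: "-1 \<le> a" "a \<le> b" "b \<le> 1"
    have "integral {a..b} (\<lambda>t. h (- t)) = integral {-b..-a} h"
      using Henstock_Kurzweil_Integration.integral_reflect_real[where f=h and a="-b" and b="-a"] by simp
    also have "\<dots> = g (m - 1) (- a) - g (m - 1) (- b)" using g(7)[of "-b" "-a"] ab by simp
    finally have "integral {a..b} (\<lambda>t. (-1) ^ m * h (- t)) = (-1) ^ m * (g (m - 1) (- a) - g (m - 1) (- b))"
      by (simp add: integral_mult_right)
    moreover have "(-1) ^ m = - ((-1) ^ (m - 1) :: complex)"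
      using m by (cases m) auto
    ultimately show "(-1) ^ (m - 1) * g (m - 1) (- b) - (-1) ^ (m - 1) * g (m - 1) (- a) = integral {a..b} (\<lambda>t. (-1) ^ m * h (- t))"
      by (simp add: algebra_simps)
  qed (use g in \<open>simp_all add: norm_mult norm_power\<close>)
qed

text \<open>The sign makes the family consist again of the partial derivatives of one function,
  \<open>(s, t) \<mapsto> D 0 0 (- s) (- t)\<close>.\<close>

definition reflect :: "(nat \<Rightarrow> nat \<Rightarrow> real \<Rightarrow> real \<Rightarrow> complex) \<Rightarrow> nat \<Rightarrow> nat \<Rightarrow> real \<Rightarrow> real \<Rightarrow> complex" where
  "reflect D = (\<lambda>i j s t. (-1) ^ (i + j) * D i j (- s) (- t))"

lemma reflect_reflect[simp]: "reflect (reflect D) = D"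
  by (auto simp: reflect_def fun_eq_iff power_add[symmetric] mult.assoc[symmetric] simp flip: mult_2)

text \<open>The parts \<open>t \<le> s\<close> and \<open>t \<ge> s\<close> of the integral operator; the second is the first one for the
  reflected kernel.\<close>
definition Aop :: "(nat \<Rightarrow> nat \<Rightarrow> real \<Rightarrow> real \<Rightarrow> complex) \<Rightarrow> real \<Rightarrow> (real \<Rightarrow> complex) \<Rightarrow> real \<Rightarrow> complex" where
  "Aop D \<kappa> u s = ph \<kappa> s * Vop D (\<lambda>t. ph (- \<kappa>) t * u t) s"

definition Bop :: "(nat \<Rightarrow> nat \<Rightarrow> real \<Rightarrow> real \<Rightarrow> complex) \<Rightarrow> real \<Rightarrow> (real \<Rightarrow> complex) \<Rightarrow> real \<Rightarrow> complex" where
  "Bop D \<kappa> u s = Aop (reflect D) \<kappa> (\<lambda>t. u (- t)) (- s)"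

text \<open>One integration by parts: two boundary values bounded by \<open>P\<close> and an
  integral over length at most \<open>2\<close> bounded through \<open>Q\<close>, all divided by the
  frequency.\<close>

lemma oscillatory_integral_bound:
  fixes q :: "real \<Rightarrow> complex"
  assumes q: "\<And>x. x \<in> II \<Longrightarrow> (q has_vector_derivative q' x) (at x within II)" "continuous_on II q'"
    and b: "\<And>x. x \<in> II \<Longrightarrow> norm (q x) \<le> P" "\<And>x. x \<in> II \<Longrightarrow> norm (q' x) \<le> Q"
    and c: "c \<noteq> 0" and t: "t \<in> II"
  shows "norm (integral {-1..t} (\<lambda>r. ph c r * q r)) \<le> (2 * P + 2 * Q) / \<bar>c\<bar>"
proof -
  let ?L = "\<i> * complex_of_real c"
  have sub: "{-1..t} \<subseteq> II" using t by auto
  have qc: "continuous_on II q" by (rule continuous_on_vector_derivative[OF q(1)])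
  have c1: "continuous_on {-1..t} (\<lambda>r. ph c r * q r)" "continuous_on {-1..t} (\<lambda>r. ph c r * q' r)"
    by (intro continuous_on_mult ph_cont continuous_on_subset[OF qc sub] continuous_on_subset[OF q(2) sub])+
  have "((\<lambda>r. ph c r * q' r + ?L * ph c r * q r) has_integral (ph c t * q t - ph c (-1) * q (-1))) {-1..t}"
  proof (rule fundamental_theorem_of_calculus)
    fix x assume x: "x \<in> {-1..t}"
    have "(q has_vector_derivative q' x) (at x within {-1..t})"
      using has_vector_derivative_within_subset[OF q(1) sub] x sub by blast
    then show "((\<lambda>r. ph c r * q r) has_vector_derivative (ph c x * q' x + ?L * ph c x * q x)) (at x within {-1..t})"
      by (intro has_vector_derivative_mult ph_deriv)
  qed (use t in simp)
  then have 1: "ph c t * q t - ph c (-1) * q (-1) = integral {-1..t} (\<lambda>r. ph c r * q' r + ?L * ph c r * q r)"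
    by (simp add: integral_unique)
  also have "\<dots> = integral {-1..t} (\<lambda>r. ph c r * q' r) + integral {-1..t} (\<lambda>r. ?L * (ph c r * q r))"
    unfolding mult.assoc
    by (rule Henstock_Kurzweil_Integration.integral_add)
      (intro integrable_continuous_interval c1(2) continuous_on_mult[OF continuous_on_const] c1(1)[unfolded mult.assoc])+
  also have "integral {-1..t} (\<lambda>r. ?L * (ph c r * q r)) = ?L * integral {-1..t} (\<lambda>r. ph c r * q r)"
    by (rule integral_mult_right)
  finally have "?L * integral {-1..t} (\<lambda>r. ph c r * q r) =
      ph c t * q t - ph c (-1) * q (-1) - integral {-1..t} (\<lambda>r. ph c r * q' r)"
    by (simp add: algebra_simps)
  then have "\<bar>c\<bar> * norm (integral {-1..t} (\<lambda>r. ph c r * q r)) =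
      norm (ph c t * q t - ph c (-1) * q (-1) - integral {-1..t} (\<lambda>r. ph c r * q' r))"
    by (metis norm_mult norm_ii norm_of_real mult_1 mult.assoc)
  also have "\<dots> \<le> norm (q t) + norm (q (-1)) + norm (integral {-1..t} (\<lambda>r. ph c r * q' r))"
    using norm_triangle_ineq4[of "ph c t * q t - ph c (-1) * q (-1)" "integral {-1..t} (\<lambda>r. ph c r * q' r)"]
      norm_triangle_ineq4[of "ph c t * q t" "ph c (-1) * q (-1)"] by (simp add: norm_mult)
  also have "\<dots> \<le> P + P + Q * 2"
  proof -
    have Q0: "0 \<le> Q" using order_trans[OF norm_ge_zero b(2)[of 0]] by simp
    have "norm (integral {-1..t} (\<lambda>r. ph c r * q' r)) \<le> Q * (t - (-1))"
      by (rule integral_bound) (use t c1 b(2) in \<open>auto simp: norm_mult\<close>)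
    also have "\<dots> \<le> Q * 2" by (rule mult_left_mono) (use t Q0 in auto)
    finally show ?thesis using b(1)[of t] b(1)[of "-1"] t by simp
  qed
  finally show ?thesis using c by (simp add: field_simps)
qed

context kernel
begin

lemma kernel_reflect: "kernel m (reflect D) M"
proof (rule kernel.intro[where m=m and D="reflect D" and M=M, OF m_ge M_ge])
  show "continuous_on (II \<times> II) (\<lambda>(s, t). reflect D i j s t)" if "i \<le> m" "j \<le> m" for i j
  proof -
    have "continuous_on (II \<times> II) (\<lambda>z::real\<times>real. (- fst z, - snd z))" by (intro continuous_intros)
    from continuous_on_compose2[OF D_cont[OF that] this]
    have "continuous_on (II \<times> II) (\<lambda>z. D i j (- fst z) (- snd z))" by (simp add: image_subset_iff mem_Times_iff)
    then show ?thesis unfolding reflect_def case_prod_unfold by (intro continuous_on_mult continuous_on_const)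
  qed
  show "norm (reflect D i j s t) \<le> M" if "i \<le> m" "j \<le> m" "s \<in> II" "t \<in> II" for i j s t
    using D_bound[of i j "- s" "- t"] that by (simp add: reflect_def norm_mult norm_power)
  show "((\<lambda>s'. reflect D i j s' t) has_vector_derivative reflect D (Suc i) j s t) (at s within II)"
    if "i < m" "j \<le> m" "s \<in> II" "t \<in> II" for i j s t
    using has_vector_derivative_mult_right[OF neg_derivative[OF D_ds[of i j "- s" "- t"]], of "(-1) ^ (i + j)"] that
    by (simp add: reflect_def)
  show "((\<lambda>t'. reflect D i j s t') has_vector_derivative reflect D i (Suc j) s t) (at t within II)"
    if "i \<le> m" "j < m" "s \<in> II" "t \<in> II" for i j s t
    using has_vector_derivative_mult_right[OF neg_derivative[OF D_dt[of i j "- s" "- t"]], of "(-1) ^ (i + j)"] that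
    by (simp add: reflect_def)
qed

text \<open>The constant of \<open>Vop_CB\<close> in the scale \<open>\<kappa> ^ j\<close>:
  \<open>2 ^ m\<close> diagonal terms, \<open>2 * M\<close> for the integrals,
  \<open>2 ^ m * M\<close> for the derivatives of the integrand.\<close>

definition CV :: real where "CV = 2 ^ m * ((2 + 2 ^ m) * M)"

lemma CV_ge: "CV \<ge> 1"
proof -
  have "1 * (1 * 1) \<le> 2 ^ m * ((2 + 2 ^ m) * M)"
    by (intro mult_mono) (use M_ge in \<open>auto simp: add_increasing2\<close>)
  then show ?thesis by (simp add: CV_def)
qed

text \<open>One derivative is gained without leaving the scale, since a derivative of the primitive
  involves the argument to one order less. Besides the actual frequency, \<open>\<kappa> = 1\<close>
  is used later: then the bounds are the same for all orders.\<close>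

lemma Vop_scaled:
  assumes u: "CB l (\<lambda>j. B * \<kappa> ^ j) u" and n: "n \<le> Suc l" "n \<le> m" and \<kappa>: "\<kappa> \<ge> 1"
  shows "CB n (\<lambda>j. CV * B * \<kappa> ^ j) (Vop D u)"
proof -
  have nB: "norm (u t) \<le> B" if "t \<in> II" for t using CB_norm[OF u that] by simp
  have B0: "0 \<le> B" using order_trans[OF norm_ge_zero nB[of 0]] by simp
  have "CB n (\<lambda>j. 2 ^ j * (2 * (M * B) + (if j = 0 then 0 else 2 ^ j * (M * (B * \<kappa> ^ (j - 1)))))) (Vop D u)"
  proof (rule Vop_CB[OF u n])
    show "B * \<kappa> ^ i \<le> B * \<kappa> ^ j" if "i \<le> j" for i j
      by (intro mult_left_mono power_increasing) (use that \<kappa> B0 in auto)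
    show "norm (integral {-1..t} (\<lambda>r. D i 0 s r * u r)) \<le> 2 * (M * B)" if "i \<le> n" "s \<in> II" "t \<in> II" for i s t
      by (rule Vop_int_bound[OF CB_continuous[OF u] nB]) (use that n in auto)
  qed
  then show ?thesis
  proof (rule CB_mono)
    fix j assume j: "j \<le> n"
    have 1: "\<kappa> ^ (j - 1) \<le> \<kappa> ^ j" by (intro power_increasing) (use \<kappa> in auto)
    have 2: "1 \<le> \<kappa> ^ j" using \<kappa> by simp
    have "2 * (M * B) + (if j = 0 then 0 else 2 ^ j * (M * (B * \<kappa> ^ (j - 1)))) \<le> 2 * (M * B) * \<kappa> ^ j + 2 ^ m * (M * (B * \<kappa> ^ j))"
    proof (rule add_mono)
      show "2 * (M * B) \<le> 2 * (M * B) * \<kappa> ^ j" using mult_left_mono[OF 2, of "2 * (M * B)"] M_ge B0 by simp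
      have "2 ^ j * (M * (B * \<kappa> ^ (j - 1))) \<le> 2 ^ m * (M * (B * \<kappa> ^ j))"
        by (intro mult_mono power_increasing 1) (use M_ge B0 \<kappa> j n in auto)
      then show "(if j = 0 then 0 else 2 ^ j * (M * (B * \<kappa> ^ (j - 1)))) \<le> 2 ^ m * (M * (B * \<kappa> ^ j))"
        using M_ge B0 \<kappa> by auto
    qed
    also have "\<dots> = (2 + 2 ^ m) * M * B * \<kappa> ^ j" by (simp add: algebra_simps)
    finally have "2 ^ j * (2 * (M * B) + (if j = 0 then 0 else 2 ^ j * (M * (B * \<kappa> ^ (j - 1))))) \<le> 2 ^ m * ((2 + 2 ^ m) * M * B * \<kappa> ^ j)"
      by (intro mult_mono power_increasing) (use M_ge B0 \<kappa> j n in auto)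
    then show "2 ^ j * (2 * (M * B) + (if j = 0 then 0 else 2 ^ j * (M * (B * \<kappa> ^ (j - 1))))) \<le> CV * B * \<kappa> ^ j"
      by (simp add: CV_def mult.assoc)
  qed simp
qed

text \<open>One factor \<open>4 ^ m\<close> for the phase before and one for the phase after
  \<open>Vop\<close>.\<close>

definition CA :: real where "CA = 4 ^ m * (CV * 4 ^ m)"

lemma CA_ge: "CA \<ge> 1"
proof -
  have "1 * (1 * 1) \<le> 4 ^ m * (CV * 4 ^ m)" by (intro mult_mono) (use CV_ge in auto)
  then show ?thesis by (simp add: CA_def)
qed

lemma Aop_scaled:
  assumes u: "CB l (\<lambda>j. B * \<kappa> ^ j) u" and n: "n \<le> Suc l" "n \<le> m" "l \<le> m" and \<kappa>: "\<kappa> \<ge> 1"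
  shows "CB n (\<lambda>j. CA * B * \<kappa> ^ j) (Aop D \<kappa> u)"
proof -
  have B0: "0 \<le> B" using order_trans[OF norm_ge_zero CB_norm[OF u, of 0]] by simp
  have 1: "CB l (\<lambda>j. 4 ^ l * B * \<kappa> ^ j) (\<lambda>t. ph (- \<kappa>) t * u t)"
    by (rule CB_ph[OF u]) (use \<kappa> B0 in auto)
  have 2: "CB n (\<lambda>j. CV * (4 ^ l * B) * \<kappa> ^ j) (Vop D (\<lambda>t. ph (- \<kappa>) t * u t))"
    by (rule Vop_scaled[OF 1 n(1,2) \<kappa>])
  have "CB n (\<lambda>j. 4 ^ n * (CV * (4 ^ l * B)) * \<kappa> ^ j) (Aop D \<kappa> u)"
    unfolding Aop_def[abs_def] by (rule CB_ph[OF 2]) (use \<kappa> B0 CV_ge in auto)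
  then show ?thesis
  proof (rule CB_mono)
    fix j assume "j \<le> n"
    have "4 ^ n * (CV * (4 ^ l * B)) * \<kappa> ^ j \<le> 4 ^ m * (CV * (4 ^ m * B)) * \<kappa> ^ j"
      by (intro mult_mono power_increasing) (use n \<kappa> B0 CV_ge in auto)
    then show "4 ^ n * (CV * (4 ^ l * B)) * \<kappa> ^ j \<le> CA * B * \<kappa> ^ j" by (simp add: CA_def mult.assoc)
  qed simp
qed

end

section \<open>Iterates of the integral operator\<close>

definition Kop :: "(nat \<Rightarrow> nat \<Rightarrow> real \<Rightarrow> real \<Rightarrow> complex) \<Rightarrow> real \<Rightarrow> (real \<Rightarrow> complex) \<Rightarrow> real \<Rightarrow> complex" where
  "Kop D \<kappa> u s = Aop D \<kappa> u s + Bop D \<kappa> u s"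

lemma Vop_cong: "(\<And>t. t \<in> II \<Longrightarrow> u t = v t) \<Longrightarrow> s \<in> II \<Longrightarrow> Vop D u s = Vop D v s"
  unfolding Vop_def by (rule integral_cong) auto

lemma Aop_cong: "(\<And>t. t \<in> II \<Longrightarrow> u t = v t) \<Longrightarrow> s \<in> II \<Longrightarrow> Aop D \<kappa> u s = Aop D \<kappa> v s"
  unfolding Aop_def by (rule arg_cong[where f="(*) _"], rule Vop_cong) auto

lemma Bop_cong: "(\<And>t. t \<in> II \<Longrightarrow> u t = v t) \<Longrightarrow> s \<in> II \<Longrightarrow> Bop D \<kappa> u s = Bop D \<kappa> v s"
  unfolding Bop_def by (rule Aop_cong) auto

lemma Kop_cong: "(\<And>t. t \<in> II \<Longrightarrow> u t = v t) \<Longrightarrow> s \<in> II \<Longrightarrow> Kop D \<kappa> u s = Kop D \<kappa> v s"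
  unfolding Kop_def by (intro arg_cong2[where f="(+)"] Aop_cong Bop_cong)

lemma Kop_pow_cong: "(\<And>t. t \<in> II \<Longrightarrow> u t = v t) \<Longrightarrow> s \<in> II \<Longrightarrow> (Kop D \<kappa> ^^ n) u s = (Kop D \<kappa> ^^ n) v s"
proof (induction n arbitrary: s)
  case (Suc n)
  show ?case unfolding funpow.simps o_apply by (rule Kop_cong) (use Suc in auto)
qed simp

text \<open>\<open>Aop\<close> is \<open>Vop\<close> conjugated by a phase, so in a power all inner
  phases cancel. Powers of \<open>Aop\<close> thus inherit the smoothing and the decay of Volterra
  powers uniformly in \<kappa>.\<close>

lemma Aop_pow: "(Aop D \<kappa> ^^ n) u t = ph \<kappa> t * (Vop D ^^ n) (\<lambda>t. ph (- \<kappa>) t * u t) t"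
proof (induction n arbitrary: t)
  case 0
  show ?case by (simp add: ph_mult_left)
next
  case (Suc n)
  have "(\<lambda>t. ph (- \<kappa>) t * (Aop D \<kappa> ^^ n) u t) = (Vop D ^^ n) (\<lambda>t. ph (- \<kappa>) t * u t)"
    by (simp add: Suc ph_mult_left)
  then show ?case unfolding funpow.simps o_apply Aop_def[of D \<kappa> "(Aop D \<kappa> ^^ n) u" t] by (simp only:)
qed

lemma Bop_pow: "(Bop D \<kappa> ^^ n) u t = (Aop (reflect D) \<kappa> ^^ n) (\<lambda>t. u (- t)) (- t)"
proof (induction n arbitrary: t)
  case (Suc n)
  have "(\<lambda>t. (Bop D \<kappa> ^^ n) u (- t)) = (Aop (reflect D) \<kappa> ^^ n) (\<lambda>t. u (- t))"
    by (simp add: Suc)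
  then show ?case unfolding funpow.simps o_apply Bop_def[of D \<kappa> "(Bop D \<kappa> ^^ n) u" t] by (simp only:)
qed simp

context kernel
begin

lemma Vop_add:
  assumes "continuous_on II u" "continuous_on II v" "s \<in> II"
  shows "Vop D (\<lambda>t. u t + v t) s = Vop D u s + Vop D v s"
proof -
  have c: "(\<lambda>t. D 0 0 s t * w t) integrable_on {-1..s}" if "continuous_on II w" for w
  proof -
    have "continuous_on II (\<lambda>t. D 0 0 s t * w t)"
      by (intro continuous_on_mult continuous_on_section[OF D_cont] that assms) auto
    then show ?thesis by (intro integrable_continuous_interval) (rule continuous_on_subset, use assms in auto)
  qed
  show ?thesis unfolding Vop_def distrib_left
    by (rule Henstock_Kurzweil_Integration.integral_add[OF c[OF assms(1)] c[OF assms(2)]])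
qed

lemma Aop_add:
  assumes "continuous_on II u" "continuous_on II v" "s \<in> II"
  shows "Aop D \<kappa> (\<lambda>t. u t + v t) s = Aop D \<kappa> u s + Aop D \<kappa> v s"
  unfolding Aop_def distrib_left
  by (subst Vop_add) (use assms in \<open>auto intro!: continuous_on_mult ph_cont simp: distrib_left\<close>)

lemma Bop_add:
  assumes "continuous_on II u" "continuous_on II v" "s \<in> II"
  shows "Bop D \<kappa> (\<lambda>t. u t + v t) s = Bop D \<kappa> u s + Bop D \<kappa> v s"
proof -
  interpret R: kernel m "reflect D" M by (rule kernel_reflect)
  have c: "continuous_on II (\<lambda>t. w (- t))" if "continuous_on II w" for w :: "real \<Rightarrow> complex"
    by (rule continuous_on_compose2[OF that, of II uminus]) (auto intro: continuous_on_minus continuous_on_id)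
  show ?thesis unfolding Bop_def by (rule R.Aop_add) (use assms c in auto)
qed

lemma Kop_add:
  assumes "continuous_on II u" "continuous_on II v" "s \<in> II"
  shows "Kop D \<kappa> (\<lambda>t. u t + v t) s = Kop D \<kappa> u s + Kop D \<kappa> v s"
  unfolding Kop_def using Aop_add[OF assms] Bop_add[OF assms] by simp

lemma Bop_scaled:
  assumes u: "CB l (\<lambda>j. B * \<kappa> ^ j) u" and n: "n \<le> Suc l" "n \<le> m" "l \<le> m" and \<kappa>: "\<kappa> \<ge> 1"
  shows "CB n (\<lambda>j. CA * B * \<kappa> ^ j) (Bop D \<kappa> u)"
proof -
  interpret R: kernel m "reflect D" M by (rule kernel_reflect)
  show ?thesis unfolding Bop_def[abs_def]
    by (rule CB_reflect[OF R.Aop_scaled[OF CB_reflect[OF u] n \<kappa>]])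
qed

lemma Kop_scaled:
  assumes u: "CB l (\<lambda>j. B * \<kappa> ^ j) u" and n: "n \<le> Suc l" "n \<le> m" "l \<le> m" and \<kappa>: "\<kappa> \<ge> 1"
  shows "CB n (\<lambda>j. 2 * CA * B * \<kappa> ^ j) (Kop D \<kappa> u)"
  using CB_add[OF Aop_scaled[OF assms] Bop_scaled[OF assms]]
  unfolding Kop_def[abs_def] by (simp add: algebra_simps)

lemma Aop_pow_scaled:
  assumes u: "CB l (\<lambda>j. B * \<kappa> ^ j) u" and "l \<le> m" "\<kappa> \<ge> 1"
  shows "CB l (\<lambda>j. CA ^ n * B * \<kappa> ^ j) ((Aop D \<kappa> ^^ n) u)"
proof (induction n)
  case (Suc n)
  show ?case using Aop_scaled[OF Suc, of l] assms by (simp add: mult.assoc)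
qed (use u in simp)

lemma Bop_pow_scaled:
  assumes u: "CB l (\<lambda>j. B * \<kappa> ^ j) u" and "l \<le> m" "\<kappa> \<ge> 1"
  shows "CB l (\<lambda>j. CA ^ n * B * \<kappa> ^ j) ((Bop D \<kappa> ^^ n) u)"
proof (induction n)
  case (Suc n)
  show ?case using Bop_scaled[OF Suc, of l] assms by (simp add: mult.assoc)
qed (use u in simp)

lemma Kop_pow_scaled:
  assumes u: "CB l (\<lambda>j. B * \<kappa> ^ j) u" and "l \<le> m" "\<kappa> \<ge> 1"
  shows "CB l (\<lambda>j. (2 * CA) ^ n * B * \<kappa> ^ j) ((Kop D \<kappa> ^^ n) u)"
proof (induction n)
  case (Suc n)
  show ?case using Kop_scaled[OF Suc, of l] assms by (simp add: mult.assoc)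
qed (use u in simp)

text \<open>Each application gains a derivative at the price of a factor \<kappa>; this gives a
  merely continuous solution \<open>m\<close> derivatives of known size.\<close>

lemma Kop_pow_smoothing:
  assumes u: "CB 0 (\<lambda>j. B * \<kappa> ^ j) u" and "n \<le> m" "\<kappa> \<ge> 1"
  shows "CB n (\<lambda>j. (2 * CA) ^ n * B * \<kappa> ^ j) ((Kop D \<kappa> ^^ n) u)"
  using assms(2)
proof (induction n)
  case (Suc n)
  then have "CB n (\<lambda>j. (2 * CA) ^ n * B * \<kappa> ^ j) ((Kop D \<kappa> ^^ n) u)" by simp
  from Kop_scaled[OF this, of "Suc n"] show ?case using assms Suc by (simp add: mult.assoc)
qed (use u in simp)

text \<open>\<open>24 * M\<^sup>2\<close> stems from the oscillatory integral, the other summand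
  from the derivatives in \<open>Vop_CB\<close>; the outer factors stand for the diagonal terms and
  the final phase.\<close>

definition CG :: real where "CG = 4 ^ m * (2 ^ m * (24 * M\<^sup>2 + 2 ^ m * (M * (4 ^ m * CA))))"

lemma CG_ge: "CG \<ge> 0"
  unfolding CG_def using M_ge CA_ge by simp

text \<open>The phases of the two factors differ, so one integration by parts in the intermediate
  variable gains \<open>1/\<kappa>\<close>.\<close>
lemma Aop_Bop_gain:
  assumes u: "CB l (\<lambda>j. B * \<kappa> ^ j) u" and l: "l \<le> m" and \<kappa>: "\<kappa> \<ge> 1"
  shows "CB l (\<lambda>j. CG * B / \<kappa> * \<kappa> ^ j) (Aop D \<kappa> (Bop D \<kappa> u))"
proof -
  interpret R: kernel m "reflect D" M by (rule kernel_reflect)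
  have uB: "norm (u t) \<le> B" if "t \<in> II" for t using CB_norm[OF u that] by simp
  have uc: "continuous_on II u" by (rule CB_continuous[OF u])
  have B0: "0 \<le> B" using order_trans[OF norm_ge_zero uB[of 0]] by simp
  define u' where "u' = (\<lambda>t. ph (- \<kappa>) t * u (- t))"
  have u'c: "continuous_on II u'" unfolding u'_def
    by (intro continuous_on_mult ph_cont continuous_on_compose2[OF uc, of II uminus]) (auto intro: continuous_on_minus continuous_on_id)
  have u'B: "norm (u' t) \<le> B" if "t \<in> II" for t using uB[of "- t"] that by (simp add: u'_def norm_mult)
  have u'0: "CB 0 (\<lambda>_. B) u'" using CB_0[OF u'c u'B, of 1] by simp
  have "CB 1 (\<lambda>j. 2 ^ j * (2 * (M * B) + (if j = 0 then 0 else 2 ^ j * (M * B)))) (Vop (reflect D) u')"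
    by (rule R.Vop_CB[OF u'0]) (use m_ge R.Vop_int_bound[OF u'c u'B] in auto)
  \<comment> \<open>One derivative of the inner integral is all that the integration by parts
    consumes. The \<open>8\<close> is reached at order \<open>1\<close>, as
    \<open>2 * (2 + 2)\<close>.\<close>
  then have hr: "CB 1 (\<lambda>j. 8 * (M * B)) (\<lambda>t. Vop (reflect D) u' (- t))"
  proof (intro CB_reflect, rule CB_mono)
    fix j :: nat assume "j \<le> 1"
    then consider "j = 0" | "j = 1" by linarith
    then show "2 ^ j * (2 * (M * B) + (if j = 0 then 0 else 2 ^ j * (M * B))) \<le> 8 * (M * B)"
      using B0 M_ge by cases auto
  qed simp
  let ?h = "\<lambda>t. Vop (reflect D) u' (- t)"
  obtain g where g: "\<And>t. t \<in> II \<Longrightarrow> g 0 t = ?h t"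
    "\<And>j t. j < 1 \<Longrightarrow> t \<in> II \<Longrightarrow> (g j has_vector_derivative g (Suc j) t) (at t within II)"
    "\<And>j. j \<le> 1 \<Longrightarrow> continuous_on II (g j)" "\<And>j t. j \<le> 1 \<Longrightarrow> t \<in> II \<Longrightarrow> norm (g j t) \<le> 8 * (M * B)"
    using that by (rule CBE[OF hr])
  have hB: "Bop D \<kappa> u t = ph (- \<kappa>) t * ?h t" for t
    by (simp add: Bop_def Aop_def u'_def ph_minus)
  define v where "v = (\<lambda>t. ph (- \<kappa>) t * Bop D \<kappa> u t)"
  \<comment> \<open>\<open>Aop\<close> removes the frequency \<kappa> and \<open>Bop\<close>
    delivers \<open>- \<kappa>\<close>, so the phases reinforce each other instead of
    cancelling.\<close>
  have v: "v t = ph (- (2 * \<kappa>)) t * ?h t" for t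
    by (simp add: v_def hB ph_mult_left)
  have vS: "CB l (\<lambda>j. 4 ^ l * (CA * B) * \<kappa> ^ j) v" unfolding v_def
    by (rule CB_ph[OF Bop_scaled[OF u _ l l \<kappa>]]) (use \<kappa> CA_ge B0 in auto)
  \<comment> \<open>Integration by parts in \<open>r\<close> with \<open>P = 8 M^2 B\<close> and
    \<open>Q = 16 M^2 B\<close> at frequency \<open>2 \<kappa>\<close>:
    \<open>(16 + 32) / 2 = 24\<close>.\<close>
  have beta: "norm (integral {-1..t} (\<lambda>r. D i 0 s r * v r)) \<le> 24 * M\<^sup>2 * B / \<kappa>"
    if i: "i \<le> l" and s: "s \<in> II" and t: "t \<in> II" for i s t
  proof -
    have "integral {-1..t} (\<lambda>r. D i 0 s r * v r) = integral {-1..t} (\<lambda>r. ph (- (2 * \<kappa>)) r * (D i 0 s r * g 0 r))"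
      by (rule integral_cong) (use t g(1) in \<open>auto simp: v\<close>)
    moreover have "norm (integral {-1..t} (\<lambda>r. ph (- (2 * \<kappa>)) r * (D i 0 s r * g 0 r)))
       \<le> (2 * (M * (8 * (M * B))) + 2 * (M * (8 * (M * B)) + M * (8 * (M * B)))) / \<bar>- (2 * \<kappa>)\<bar>"
    proof (rule oscillatory_integral_bound)
      show "((\<lambda>r. D i 0 s r * g 0 r) has_vector_derivative (D i 0 s x * g (Suc 0) x + D i (Suc 0) s x * g 0 x)) (at x within II)"
        if "x \<in> II" for x
        by (intro has_vector_derivative_mult D_dt g(2)) (use i l s that m_ge in auto)
      show "continuous_on II (\<lambda>x. D i 0 s x * g (Suc 0) x + D i (Suc 0) s x * g 0 x)"
        by (intro continuous_on_add continuous_on_mult continuous_on_section[OF D_cont] g(3)) (use i l s m_ge in auto)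
      have b: "norm (D i p s x * g q x) \<le> M * (8 * (M * B))" if "p \<le> 1" "q \<le> 1" "x \<in> II" for p q x
        unfolding norm_mult by (intro mult_mono D_bound g(4)) (use i l s that m_ge M_ge in auto)
      show "norm (D i 0 s x * g 0 x) \<le> M * (8 * (M * B))" if "x \<in> II" for x using b that by simp
      show "norm (D i 0 s x * g (Suc 0) x + D i (Suc 0) s x * g 0 x) \<le> M * (8 * (M * B)) + M * (8 * (M * B))"
        if "x \<in> II" for x
        by (intro norm_triangle_mono b) (use that in auto)
    qed (use t \<kappa> in auto)
    moreover have "(2 * (M * (8 * (M * B))) + 2 * (M * (8 * (M * B)) + M * (8 * (M * B)))) / \<bar>- (2 * \<kappa>)\<bar> = 24 * M\<^sup>2 * B / \<kappa>"
      using \<kappa> by (simp add: power2_eq_square)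
    ultimately show ?thesis by simp
  qed
  \<comment> \<open>At order \<open>0\<close> the gain \<open>1/\<kappa>\<close> comes from
    \<open>beta\<close> alone. The further terms at order \<open>j \<ge> 1\<close> carry it in the
    exponent \<open>j - 1\<close>, because the first derivative removes the integral.\<close>
  have V: "CB l (\<lambda>j. 2 ^ j * (24 * M\<^sup>2 * B / \<kappa> + (if j = 0 then 0 else 2 ^ j * (M * (4 ^ l * (CA * B) * \<kappa> ^ (j - 1)))))) (Vop D v)"
  proof (rule Vop_CB[OF vS _ l])
    show "4 ^ l * (CA * B) * \<kappa> ^ i \<le> 4 ^ l * (CA * B) * \<kappa> ^ j" if "i \<le> j" for i j
      by (intro mult_left_mono power_increasing) (use that \<kappa> B0 CA_ge in auto)
  qed (use beta in auto)
  let ?W = "2 ^ m * (24 * M\<^sup>2 + 2 ^ m * (M * (4 ^ m * CA))) * B / \<kappa>"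
  have V': "CB l (\<lambda>j. ?W * \<kappa> ^ j) (Vop D v)"
    using V
  proof (rule CB_mono)
    fix j assume j: "j \<le> l"
    have 2: "1 \<le> \<kappa> ^ j" using \<kappa> by simp
    have "24 * M\<^sup>2 * B / \<kappa> + (if j = 0 then 0 else 2 ^ j * (M * (4 ^ l * (CA * B) * \<kappa> ^ (j - 1))))
       \<le> 24 * M\<^sup>2 * B / \<kappa> * \<kappa> ^ j + 2 ^ m * (M * (4 ^ m * (CA * B) * (\<kappa> ^ j / \<kappa>)))"
    proof (rule add_mono)
      have "0 \<le> 24 * M\<^sup>2 * B / \<kappa>" using B0 \<kappa> by simp
      from mult_left_mono[OF 2 this] show "24 * M\<^sup>2 * B / \<kappa> \<le> 24 * M\<^sup>2 * B / \<kappa> * \<kappa> ^ j" by simp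
      show "(if j = 0 then 0 else 2 ^ j * (M * (4 ^ l * (CA * B) * \<kappa> ^ (j - 1)))) \<le> 2 ^ m * (M * (4 ^ m * (CA * B) * (\<kappa> ^ j / \<kappa>)))"
      proof (cases j)
        case 0
        then show ?thesis using M_ge CA_ge B0 \<kappa> by simp
      next
        case (Suc i)
        then have "\<kappa> ^ j / \<kappa> = \<kappa> ^ (j - 1)" using \<kappa> by simp
        moreover have "2 ^ j * (M * (4 ^ l * (CA * B) * \<kappa> ^ (j - 1))) \<le> 2 ^ m * (M * (4 ^ m * (CA * B) * \<kappa> ^ (j - 1)))"
          by (intro mult_mono power_increasing) (use M_ge CA_ge B0 \<kappa> j l in auto)
        ultimately show ?thesis using Suc by simp
      qed
    qed
    also have "\<dots> = (24 * M\<^sup>2 + 2 ^ m * (M * (4 ^ m * CA))) * B / \<kappa> * \<kappa> ^ j"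
      by (simp add: algebra_simps add_divide_distrib)
    finally have "2 ^ j * (24 * M\<^sup>2 * B / \<kappa> + (if j = 0 then 0 else 2 ^ j * (M * (4 ^ l * (CA * B) * \<kappa> ^ (j - 1)))))
       \<le> 2 ^ m * ((24 * M\<^sup>2 + 2 ^ m * (M * (4 ^ m * CA))) * B / \<kappa> * \<kappa> ^ j)"
      by (intro mult_mono power_increasing) (use M_ge B0 \<kappa> j l CA_ge in auto)
    then show "2 ^ j * (24 * M\<^sup>2 * B / \<kappa> + (if j = 0 then 0 else 2 ^ j * (M * (4 ^ l * (CA * B) * \<kappa> ^ (j - 1))))) \<le> ?W * \<kappa> ^ j"
      by (simp add: mult.assoc)
  qed simp
  have W0: "0 \<le> ?W" using M_ge B0 \<kappa> CA_ge by simp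
  have "CB l (\<lambda>j. 4 ^ l * ?W * \<kappa> ^ j) (\<lambda>t. ph \<kappa> t * Vop D v t)"
    by (rule CB_ph[OF V']) (use \<kappa> W0 in auto)
  then have "CB l (\<lambda>j. CG * B / \<kappa> * \<kappa> ^ j) (\<lambda>t. ph \<kappa> t * Vop D v t)"
  proof (rule CB_mono)
    fix j
    have "4 ^ l * ?W * \<kappa> ^ j \<le> 4 ^ m * ?W * \<kappa> ^ j"
      by (intro mult_right_mono power_increasing) (use l W0 \<kappa> in auto)
    then show "4 ^ l * ?W * \<kappa> ^ j \<le> CG * B / \<kappa> * \<kappa> ^ j" by (simp add: CG_def mult.assoc)
  qed simp
  then show ?thesis by (simp add: Aop_def[abs_def] v_def)
qed

text \<open>Reflection exchanges \<open>Aop\<close> and \<open>Bop\<close>.\<close>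

lemma Bop_Aop_gain:
  assumes u: "CB l (\<lambda>j. B * \<kappa> ^ j) u" and l: "l \<le> m" and \<kappa>: "\<kappa> \<ge> 1"
  shows "CB l (\<lambda>j. CG * B / \<kappa> * \<kappa> ^ j) (Bop D \<kappa> (Aop D \<kappa> u))"
proof -
  interpret R: kernel m "reflect D" M by (rule kernel_reflect)
  have "Bop D \<kappa> (Aop D \<kappa> u) = (\<lambda>s. Aop (reflect D) \<kappa> (Bop (reflect D) \<kappa> (\<lambda>t. u (- t))) (- s))"
    by (simp add: Bop_def[abs_def])
  then show ?thesis using CB_reflect[OF R.Aop_Bop_gain[OF CB_reflect[OF u] l \<kappa>]] by simp
qed

text \<open>Every mixed word in the two operators contains a factor \<open>AB\<close> or \<open>BA\<close> and is therefore \<open>O(1/\<kappa>)\<close>.\<close>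
lemma Kop_pow_split:
  assumes l: "l \<le> m"
  shows "\<exists>C\<ge>0. \<forall>\<kappa>\<ge>1. \<forall>B u. CB l (\<lambda>j. B * \<kappa> ^ j) u \<longrightarrow>
    (\<exists>r. CB l (\<lambda>j. C * B / \<kappa> * \<kappa> ^ j) r \<and>
      (\<forall>t\<in>II. (Kop D \<kappa> ^^ Suc n) u t = (Aop D \<kappa> ^^ Suc n) u t + (Bop D \<kappa> ^^ Suc n) u t + r t))"
proof (induction n)
  case 0
  show ?case
  proof (rule exI[of _ 0], intro conjI allI impI)
    fix \<kappa> B :: real and u assume "1 \<le> \<kappa>" "CB l (\<lambda>j. B * \<kappa> ^ j) u"
    show "\<exists>r. CB l (\<lambda>j. 0 * B / \<kappa> * \<kappa> ^ j) r \<and>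
      (\<forall>t\<in>II. (Kop D \<kappa> ^^ Suc 0) u t = (Aop D \<kappa> ^^ Suc 0) u t + (Bop D \<kappa> ^^ Suc 0) u t + r t)"
      by (rule exI[of _ "\<lambda>_. 0"]) (simp add: CB_zero Kop_def)
  qed simp
next
  case (Suc n)
  then obtain C where C: "C \<ge> 0" "\<And>\<kappa> B u. \<kappa> \<ge> 1 \<Longrightarrow> CB l (\<lambda>j. B * \<kappa> ^ j) u \<Longrightarrow>
    (\<exists>r. CB l (\<lambda>j. C * B / \<kappa> * \<kappa> ^ j) r \<and>
      (\<forall>t\<in>II. (Kop D \<kappa> ^^ Suc n) u t = (Aop D \<kappa> ^^ Suc n) u t + (Bop D \<kappa> ^^ Suc n) u t + r t))"
    by auto
  let ?C = "2 * CG * CA ^ n + 2 * CA * C"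
  show ?case
  proof (rule exI[of _ ?C], intro conjI allI impI)
    show "0 \<le> ?C" using C(1) CG_ge CA_ge by simp
    fix \<kappa> B :: real and u assume \<kappa>: "1 \<le> \<kappa>" and u: "CB l (\<lambda>j. B * \<kappa> ^ j) u"
    obtain r where r: "CB l (\<lambda>j. C * B / \<kappa> * \<kappa> ^ j) r"
      "\<And>t. t \<in> II \<Longrightarrow> (Kop D \<kappa> ^^ Suc n) u t = (Aop D \<kappa> ^^ Suc n) u t + (Bop D \<kappa> ^^ Suc n) u t + r t"
      using C(2)[OF \<kappa> u] by blast
    let ?An = "(Aop D \<kappa> ^^ Suc n) u" and ?Bn = "(Bop D \<kappa> ^^ Suc n) u"
    let ?An' = "(Aop D \<kappa> ^^ n) u" and ?Bn' = "(Bop D \<kappa> ^^ n) u"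
    \<comment> \<open>Everything that \<open>Kop\<close> produces beside the two pure powers. The
      two mixed terms are \<open>B A\<close> and \<open>A B\<close> applied to powers of order
      \<open>n\<close> and account for the first summand of \<open>?C\<close>;
      \<open>Kop D \<kappa> r\<close> accounts for the second.\<close>
    define r' where "r' = (\<lambda>t. (Bop D \<kappa> (Aop D \<kappa> ?An') t + Aop D \<kappa> (Bop D \<kappa> ?Bn') t) + Kop D \<kappa> r t)"
    note cA = CB_continuous[OF Aop_pow_scaled[OF u l \<kappa>]] and cB = CB_continuous[OF Bop_pow_scaled[OF u l \<kappa>]]
    have "CB l (\<lambda>j. CG * (CA ^ n * B) / \<kappa> * \<kappa> ^ j + CG * (CA ^ n * B) / \<kappa> * \<kappa> ^ j + 2 * CA * (C * B / \<kappa>) * \<kappa> ^ j) r'"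
      unfolding r'_def
      by (intro CB_add Bop_Aop_gain Aop_Bop_gain Aop_pow_scaled Bop_pow_scaled u l \<kappa> Kop_scaled[OF r(1)]) simp
    then have "CB l (\<lambda>j. ?C * B / \<kappa> * \<kappa> ^ j) r'"
      by (simp add: algebra_simps add_divide_distrib)
    moreover have "(Kop D \<kappa> ^^ Suc (Suc n)) u t = (Aop D \<kappa> ^^ Suc (Suc n)) u t + (Bop D \<kappa> ^^ Suc (Suc n)) u t + r' t"
      if t: "t \<in> II" for t
    proof -
      have "(Kop D \<kappa> ^^ Suc (Suc n)) u t = Kop D \<kappa> (\<lambda>t. (?An t + ?Bn t) + r t) t"
        using Kop_cong[where D=D and \<kappa>=\<kappa>, OF r(2) t] by simp
      also have "\<dots> = Kop D \<kappa> (\<lambda>t. ?An t + ?Bn t) t + Kop D \<kappa> r t"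
        by (rule Kop_add[OF continuous_on_add[OF cA cB] CB_continuous[OF r(1)] t])
      also have "Kop D \<kappa> (\<lambda>t. ?An t + ?Bn t) t = Kop D \<kappa> ?An t + Kop D \<kappa> ?Bn t"
        by (rule Kop_add[OF cA cB t])
      also have "Kop D \<kappa> ?An t = Aop D \<kappa> ?An t + Bop D \<kappa> ?An t" by (rule Kop_def)
      also have "Kop D \<kappa> ?Bn t = Aop D \<kappa> ?Bn t + Bop D \<kappa> ?Bn t" by (rule Kop_def)
      finally show ?thesis unfolding r'_def funpow.simps o_apply by (simp only: ac_simps)
    qed
    ultimately show "\<exists>r. CB l (\<lambda>j. ?C * B / \<kappa> * \<kappa> ^ j) r \<and>
      (\<forall>t\<in>II. (Kop D \<kappa> ^^ Suc (Suc n)) u t = (Aop D \<kappa> ^^ Suc (Suc n)) u t + (Bop D \<kappa> ^^ Suc (Suc n)) u t + r t)"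
      by blast
  qed
qed

section \<open>Powers of the Volterra operators and the Neumann expansion\<close>

lemma Vop_pow_smoothing:
  assumes u: "continuous_on II v" "\<And>t. t \<in> II \<Longrightarrow> norm (v t) \<le> B" and "n \<le> m"
  shows "CB n (\<lambda>_. CV ^ n * B) ((Vop D ^^ n) v)"
  using assms(3)
proof (induction n)
  case 0
  show ?case using CB_0[OF u, of 1] by simp
next
  case (Suc n)
  then have "CB n (\<lambda>j. CV ^ n * B * 1 ^ j) ((Vop D ^^ n) v)" by simp
  from Vop_scaled[OF this, of "Suc n"] show ?case using Suc by (simp add: mult.assoc)
qed

lemma Vop_pow_continuous:
  assumes u: "continuous_on II v" "\<And>t. t \<in> II \<Longrightarrow> norm (v t) \<le> B"
  shows "continuous_on II ((Vop D ^^ n) v)"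
proof (cases n)
  case 0 then show ?thesis using u by simp
next
  case (Suc k)
  have "CB 0 (\<lambda>j. CV ^ k * B * 1 ^ j) ((Vop D ^^ k) v)"
  proof (induction k)
    case 0
    show ?case using CB_0[OF u, of 1] by simp
  next
    case (Suc k)
    from Vop_scaled[OF Suc, of 0] show ?case by (simp add: mult.assoc)
  qed
  from CB_continuous[OF Vop_scaled[OF this, of 0]] show ?thesis using Suc by simp
qed

text \<open>Integrating the bound of order \<open>n\<close> from \<open>-1\<close> to
  \<open>s\<close> gives the bound of order \<open>n + 1\<close>; this is where the factorial
  arises.\<close>

lemma Vop_pow_factorial:
  assumes u: "continuous_on II v" "\<And>t. t \<in> II \<Longrightarrow> norm (v t) \<le> B" and s: "s \<in> II"
  shows "norm ((Vop D ^^ n) v s) \<le> M ^ n * B * ((s + 1) ^ n / fact n)"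
  using s
proof (induction n arbitrary: s)
  case 0 then show ?case using u by simp
next
  case (Suc n)
  let ?p = "\<lambda>t. M ^ Suc n * B * ((t + 1) ^ n / fact n)"
  have d: "((\<lambda>t. M ^ Suc n * B * ((t + 1) ^ Suc n / fact (Suc n))) has_vector_derivative ?p t) (at t within {-1..s})" for t
  proof -
    have "((\<lambda>t. M ^ Suc n * B * ((t + 1) ^ Suc n / fact (Suc n))) has_real_derivative
      M ^ Suc n * B * (real (Suc n) * (t + 1) ^ n / fact (Suc n))) (at t within {-1..s})"
      by (rule derivative_eq_intros refl | simp)+
    moreover have "real (Suc n) * (t + 1) ^ n / fact (Suc n) = (t + 1) ^ n / fact n"
      by (simp add: divide_simps del: of_nat_Suc)
    ultimately show ?thesis by (simp add: has_real_derivative_iff_has_vector_derivative)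
  qed
  have I: "(?p has_integral M ^ Suc n * B * ((s + 1) ^ Suc n / fact (Suc n)) - M ^ Suc n * B * ((-1 + 1) ^ Suc n / fact (Suc n))) {-1..s}"
    by (rule fundamental_theorem_of_calculus[OF _ d]) (use Suc.prems in auto)
  have c: "continuous_on II (\<lambda>t. D 0 0 s t * (Vop D ^^ n) v t)"
    by (intro continuous_on_mult continuous_on_section[OF D_cont] Vop_pow_continuous[OF u]) (use Suc.prems in auto)
  have "norm (integral {-1..s} (\<lambda>t. D 0 0 s t * (Vop D ^^ n) v t)) \<le> integral {-1..s} ?p"
  proof (rule integral_norm_bound_integral)
    show "(\<lambda>t. D 0 0 s t * (Vop D ^^ n) v t) integrable_on {-1..s}"
      by (rule integrable_continuous_interval[OF continuous_on_subset[OF c]]) (use Suc.prems in auto)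
    show "?p integrable_on {-1..s}" using I by blast
    fix t assume t: "t \<in> {-1..s}"
    then have t': "t \<in> II" using Suc.prems by auto
    have "norm (D 0 0 s t) * norm ((Vop D ^^ n) v t) \<le> M * (M ^ n * B * ((t + 1) ^ n / fact n))"
      by (intro mult_mono D_bound Suc.IH Suc.prems t') (use M_ge in auto)
    then show "norm (D 0 0 s t * (Vop D ^^ n) v t) \<le> ?p t" by (simp add: norm_mult mult.assoc)
  qed
  also have "\<dots> = M ^ Suc n * B * ((s + 1) ^ Suc n / fact (Suc n))" using integral_unique[OF I] by simp
  finally have "norm (integral {-1..s} (\<lambda>t. D 0 0 s t * (Vop D ^^ n) v t)) \<le> M ^ Suc n * B * ((s + 1) ^ Suc n / fact (Suc n))" .
  then show ?case by (simp only: funpow.simps o_apply Vop_def[of D "(Vop D ^^ n) v" s])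
qed

text \<open>The phases have modulus \<open>1\<close>, so the Volterra decay survives without any
  dependence on \<kappa>. \<open>2\<close> is the largest value of \<open>s + 1\<close>.\<close>

lemma Aop_pow_small:
  assumes u: "continuous_on II v" "\<And>t. t \<in> II \<Longrightarrow> norm (v t) \<le> B" and s: "s \<in> II"
  shows "norm ((Aop D \<kappa> ^^ n) v s) \<le> (2 * M) ^ n / fact n * B"
proof -
  have B0: "0 \<le> B" using order_trans[OF norm_ge_zero u(2)[of 0]] by simp
  have "norm ((Aop D \<kappa> ^^ n) v s) = norm ((Vop D ^^ n) (\<lambda>t. ph (- \<kappa>) t * v t) s)"
    by (simp add: Aop_pow norm_mult)
  also have "\<dots> \<le> M ^ n * B * ((s + 1) ^ n / fact n)"
    by (rule Vop_pow_factorial[where B=B]) (use u s in \<open>auto intro!: continuous_on_mult ph_cont simp: norm_mult\<close>)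
  also have "\<dots> \<le> M ^ n * B * (2 ^ n / fact n)"
    by (intro mult_left_mono divide_right_mono power_mono) (use s B0 M_ge in auto)
  also have "\<dots> = (2 * M) ^ n / fact n * B" by (simp add: power_mult_distrib)
  finally show ?thesis .
qed

lemma Bop_pow_small:
  assumes u: "continuous_on II v" "\<And>t. t \<in> II \<Longrightarrow> norm (v t) \<le> B" and s: "s \<in> II"
  shows "norm ((Bop D \<kappa> ^^ n) v s) \<le> (2 * M) ^ n / fact n * B"
proof -
  interpret R: kernel m "reflect D" M by (rule kernel_reflect)
  have c: "continuous_on II (\<lambda>t. v (- t))"
    by (rule continuous_on_compose2[OF u(1), of II uminus]) (auto intro: continuous_on_minus continuous_on_id)
  show ?thesis unfolding Bop_pow by (rule R.Aop_pow_small[OF c]) (use u s in auto)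
qed

lemma Kop_pow_add:
  assumes u: "continuous_on II u" "\<And>n. continuous_on II ((Kop D \<kappa> ^^ n) u)"
    and v: "continuous_on II v" "\<And>n. continuous_on II ((Kop D \<kappa> ^^ n) v)" and s: "s \<in> II"
  shows "(Kop D \<kappa> ^^ n) (\<lambda>t. u t + v t) s = (Kop D \<kappa> ^^ n) u s + (Kop D \<kappa> ^^ n) v s"
  using s
proof (induction n arbitrary: s)
  case (Suc n)
  have "(Kop D \<kappa> ^^ Suc n) (\<lambda>t. u t + v t) s = Kop D \<kappa> (\<lambda>s. (Kop D \<kappa> ^^ n) u s + (Kop D \<kappa> ^^ n) v s) s"
    unfolding funpow.simps o_apply by (rule Kop_cong[OF Suc.IH Suc.prems])
  also have "\<dots> = (Kop D \<kappa> ^^ Suc n) u s + (Kop D \<kappa> ^^ Suc n) v s"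
    unfolding funpow.simps o_apply by (rule Kop_add[OF u(2) v(2) Suc.prems])
  finally show ?case .
qed simp

lemma Kop_sum_expansion:
  assumes y: "CB 0 (\<lambda>j. Y * \<kappa> ^ j) y" and f: "CB 0 (\<lambda>j. B * \<kappa> ^ j) f" and \<kappa>: "\<kappa> \<ge> 1"
    and eq: "\<And>s. s \<in> II \<Longrightarrow> y s = f s + Kop D \<kappa> y s" and s: "s \<in> II"
  shows "y s = (\<Sum>n<N. (Kop D \<kappa> ^^ n) f s) + (Kop D \<kappa> ^^ N) y s"
proof (induction N)
  case (Suc N)
  have Ky: "CB 0 (\<lambda>j. 2 * CA * Y * \<kappa> ^ j) (Kop D \<kappa> y)" by (rule Kop_scaled[OF y _ _ _ \<kappa>]) auto
  have pow_add: "(Kop D \<kappa> ^^ N) (\<lambda>t. f t + Kop D \<kappa> y t) s = (Kop D \<kappa> ^^ N) f s + (Kop D \<kappa> ^^ N) (Kop D \<kappa> y) s"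
    by (rule Kop_pow_add[OF CB_continuous[OF f] CB_continuous[OF Kop_pow_scaled[OF f _ \<kappa>]]
          CB_continuous[OF Ky] CB_continuous[OF Kop_pow_scaled[OF Ky _ \<kappa>]] s]) simp_all
  have "(Kop D \<kappa> ^^ N) y s = (Kop D \<kappa> ^^ N) (\<lambda>t. f t + Kop D \<kappa> y t) s"
    by (rule Kop_pow_cong[OF eq s])
  also have "\<dots> = (Kop D \<kappa> ^^ N) f s + (Kop D \<kappa> ^^ Suc N) y s"
    unfolding pow_add by (simp only: funpow_Suc_right o_apply)
  finally show ?case using Suc by simp
qed simp

text \<open>The order of the choices matters: first a power \<open>?N\<close> for which both pure
  powers have norm at most \<open>1/8\<close>, then the constant \<open>C\<close> of the mixed
  words, which depends on \<open>?N\<close>, and only then \<open>\<kappa> \<ge> 4 * C\<close>. At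
  most half of the maximum of \<open>y\<close> then appears on the right and is absorbed, which
  replaces a bound for the inverse operator.\<close>

lemma uniform_bound:
  "\<exists>C\<ge>0. \<exists>\<kappa>1\<ge>1. \<forall>\<kappa>\<ge>\<kappa>1. \<forall>B f y. continuous_on II y \<longrightarrow> CB 0 (\<lambda>j. B * \<kappa> ^ j) f \<longrightarrow>
     (\<forall>s\<in>II. y s = f s + Kop D \<kappa> y s) \<longrightarrow> (\<forall>s\<in>II. norm (y s) \<le> C * B)"
proof -
  have "(\<lambda>n. inverse (fact n) * (2 * M) ^ n) \<longlonglongrightarrow> 0"
    by (rule summable_LIMSEQ_zero[OF summable_exp])
  then have "eventually (\<lambda>n. inverse (fact n) * (2 * M) ^ n < 1/8) sequentially"
    by (rule order_tendstoD) simp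
  then obtain N0 where N0: "\<And>n. n \<ge> N0 \<Longrightarrow> inverse (fact n) * (2 * M) ^ n < 1/8"
    by (auto simp: eventually_sequentially)
  let ?N = "Suc N0"
  have N: "(2 * M) ^ ?N / fact ?N \<le> 1/8"
    using N0[of ?N] by (simp only: divide_inverse mult.commute) simp
  obtain C where C: "C \<ge> 0" "\<And>\<kappa> B u. \<kappa> \<ge> 1 \<Longrightarrow> CB 0 (\<lambda>j. B * \<kappa> ^ j) u \<Longrightarrow>
    (\<exists>r. CB 0 (\<lambda>j. C * B / \<kappa> * \<kappa> ^ j) r \<and>
      (\<forall>t\<in>II. (Kop D \<kappa> ^^ ?N) u t = (Aop D \<kappa> ^^ ?N) u t + (Bop D \<kappa> ^^ ?N) u t + r t))"
    using Kop_pow_split[of 0 N0] by auto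
  define S where "S = (\<Sum>n<?N. (2 * CA) ^ n)"
  have S0: "S \<ge> 0" unfolding S_def using CA_ge by (intro sum_nonneg) simp
  show ?thesis
  proof (rule exI[of _ "2 * S"], intro conjI, use S0 in simp, rule exI[of _ "max 1 (4 * C)"], intro conjI allI impI ballI)
    fix \<kappa> B :: real and f y :: "real \<Rightarrow> complex" and s :: real
    assume \<kappa>: "max 1 (4 * C) \<le> \<kappa>" and yc: "continuous_on II y" and f: "CB 0 (\<lambda>j. B * \<kappa> ^ j) f"
      and eq: "\<forall>s\<in>II. y s = f s + Kop D \<kappa> y s" and s: "s \<in> II"
    have \<kappa>1: "\<kappa> \<ge> 1" and \<kappa>C: "4 * C \<le> \<kappa>" using \<kappa> by auto
    have "continuous_on II (\<lambda>t. norm (y t))" using yc by (intro continuous_intros)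
    \<comment> \<open>The absorption is carried out at a point where \<open>norm (y t)\<close>
      attains its maximum.\<close>
    then obtain s0 where s0: "s0 \<in> II" "\<And>t. t \<in> II \<Longrightarrow> norm (y t) \<le> norm (y s0)"
      using continuous_attains_sup[of II "\<lambda>t. norm (y t)"] by auto
    let ?Y = "norm (y s0)"
    have y: "CB 0 (\<lambda>j. ?Y * \<kappa> ^ j) y" by (rule CB_0[OF yc s0(2)])
    obtain r where r: "CB 0 (\<lambda>j. C * ?Y / \<kappa> * \<kappa> ^ j) r"
      "\<And>t. t \<in> II \<Longrightarrow> (Kop D \<kappa> ^^ ?N) y t = (Aop D \<kappa> ^^ ?N) y t + (Bop D \<kappa> ^^ ?N) y t + r t"
      using C(2)[OF \<kappa>1 y] by blast
    have "y s0 = (\<Sum>n<?N. (Kop D \<kappa> ^^ n) f s0) + (Kop D \<kappa> ^^ ?N) y s0"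
      by (rule Kop_sum_expansion[OF y f \<kappa>1 _ s0(1)]) (use eq in blast)
    then have "y s0 = (\<Sum>n<?N. (Kop D \<kappa> ^^ n) f s0) + ((Aop D \<kappa> ^^ ?N) y s0 + (Bop D \<kappa> ^^ ?N) y s0 + r s0)"
      using r(2)[OF s0(1)] by simp
    moreover have "norm (\<Sum>n<?N. (Kop D \<kappa> ^^ n) f s0) \<le> S * B"
    proof -
      have "norm ((Kop D \<kappa> ^^ n) f s0) \<le> (2 * CA) ^ n * B" for n
        using CB_norm[OF Kop_pow_scaled[OF f _ \<kappa>1] s0(1)] by simp
      then show ?thesis unfolding S_def sum_distrib_right by (intro sum_norm_le)
    qed
    moreover have "norm ((Aop D \<kappa> ^^ ?N) y s0) \<le> 1/8 * ?Y"
      by (rule order_trans[OF Aop_pow_small[OF yc s0(2) s0(1)] mult_right_mono[OF N]]) simp_all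
    moreover have "norm ((Bop D \<kappa> ^^ ?N) y s0) \<le> 1/8 * ?Y"
      by (rule order_trans[OF Bop_pow_small[OF yc s0(2) s0(1)] mult_right_mono[OF N]]) simp_all
    moreover have "norm (r s0) \<le> 1/4 * ?Y"
    proof -
      have "norm (r s0) \<le> C / \<kappa> * ?Y" using CB_norm[OF r(1) s0(1)] by simp
      also have "\<dots> \<le> 1/4 * ?Y" by (rule mult_right_mono) (use \<kappa>C \<kappa>1 in \<open>auto simp: field_simps\<close>)
      finally show ?thesis .
    qed
    ultimately have "?Y \<le> S * B + (1/8 * ?Y + 1/8 * ?Y + 1/4 * ?Y)"
      by (smt (verit, best) norm_triangle_ineq)
    then have "?Y \<le> 2 * S * B" by simp
    then show "norm (y s) \<le> 2 * S * B" using s0(2)[OF s] by simp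
  qed simp
qed

end

section \<open>Regularity of the solution\<close>

text \<open>The quantitative form of the oscillatory space for one \<kappa>. Two versions are used
  because \<open>f\<close> has only Sobolev amplitudes (\<open>HT\<close>), whereas the operators
  produce amplitudes with \<open>m\<close> classical derivatives (\<open>CT\<close>).\<close>

definition CT :: "nat \<Rightarrow> real \<Rightarrow> real \<Rightarrow> (real \<Rightarrow> complex) \<Rightarrow> bool" where
  "CT m \<kappa> B u \<longleftrightarrow> (\<exists>u0 u1 u2. CB m (\<lambda>_. B) u0 \<and> CB m (\<lambda>_. B) u1 \<and> CB m (\<lambda>_. B) u2 \<and>
     (\<forall>t\<in>II. u t = u0 t + ph \<kappa> t * u1 t + ph (- \<kappa>) t * u2 t))"

definition HT :: "nat \<Rightarrow> real \<Rightarrow> real \<Rightarrow> (real \<Rightarrow> complex) \<Rightarrow> bool" where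
  "HT m \<kappa> B u \<longleftrightarrow> (\<exists>u0 u1 u2. HB m B u0 \<and> HB m B u1 \<and> HB m B u2 \<and>
     (\<forall>t\<in>II. u t = u0 t + ph \<kappa> t * u1 t + ph (- \<kappa>) t * u2 t))"

lemma CT_cong: "CT m \<kappa> B u \<Longrightarrow> (\<And>t. t \<in> II \<Longrightarrow> u t = v t) \<Longrightarrow> CT m \<kappa> B v"
  by (simp add: CT_def)

lemma CT_mono:
  assumes "CT m \<kappa> B u" "B \<le> B'"
  shows "CT m \<kappa> B' u"
  using assms(1) unfolding CT_def by (elim ex_forward conj_forward) (auto intro: CB_mono assms(2))

lemma CT_add:
  assumes "CT m \<kappa> B u" "CT m \<kappa> B' v"
  shows "CT m \<kappa> (B + B') (\<lambda>t. u t + v t)"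
proof -
  obtain u0 u1 u2 where u: "CB m (\<lambda>_. B) u0" "CB m (\<lambda>_. B) u1" "CB m (\<lambda>_. B) u2"
    "\<forall>t\<in>II. u t = u0 t + ph \<kappa> t * u1 t + ph (- \<kappa>) t * u2 t" using assms(1) unfolding CT_def by blast
  obtain v0 v1 v2 where v: "CB m (\<lambda>_. B') v0" "CB m (\<lambda>_. B') v1" "CB m (\<lambda>_. B') v2"
    "\<forall>t\<in>II. v t = v0 t + ph \<kappa> t * v1 t + ph (- \<kappa>) t * v2 t" using assms(2) unfolding CT_def by blast
  show ?thesis unfolding CT_def
    by (rule exI[of _ "\<lambda>t. u0 t + v0 t"], rule exI[of _ "\<lambda>t. u1 t + v1 t"], rule exI[of _ "\<lambda>t. u2 t + v2 t"])
      (use u v in \<open>simp add: CB_add algebra_simps\<close>)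
qed

lemma CT_zero: "CT m \<kappa> 0 (\<lambda>t. 0)"
  unfolding CT_def by (intro exI[of _ "\<lambda>_. 0"]) (simp add: CB_zero)

lemma CT_sum:
  assumes "\<And>n. n \<in> S \<Longrightarrow> CT m \<kappa> (B n) (u n)" "finite S"
  shows "CT m \<kappa> (\<Sum>n\<in>S. B n) (\<lambda>t. \<Sum>n\<in>S. u n t)"
  using assms(2,1) by (induction S rule: finite_induct) (auto intro!: CT_add CT_zero)

lemma CT_imp_HT:
  assumes "m \<ge> 1" "CT m \<kappa> B u"
  shows "HT m \<kappa> (2 * B) u"
  using assms(2) unfolding CT_def HT_def by (elim ex_forward conj_forward) (auto intro: CB_imp_HB assms(1))

lemma CT_reflect:
  assumes "CT m \<kappa> B u"
  shows "CT m \<kappa> B (\<lambda>t. u (- t))"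
proof -
  obtain u0 u1 u2 where u: "CB m (\<lambda>_. B) u0" "CB m (\<lambda>_. B) u1" "CB m (\<lambda>_. B) u2"
    "\<forall>t\<in>II. u t = u0 t + ph \<kappa> t * u1 t + ph (- \<kappa>) t * u2 t" using assms(1) unfolding CT_def by blast
  show ?thesis unfolding CT_def
    by (rule exI[of _ "\<lambda>t. u0 (- t)"], rule exI[of _ "\<lambda>t. u2 (- t)"], rule exI[of _ "\<lambda>t. u1 (- t)"])
      (use u in \<open>simp add: CB_reflect ph_minus\<close>)
qed

lemma HT_reflect:
  assumes "m \<ge> 1" "HT m \<kappa> B u"
  shows "HT m \<kappa> B (\<lambda>t. u (- t))"
proof -
  obtain u0 u1 u2 where u: "HB m B u0" "HB m B u1" "HB m B u2"
    "\<forall>t\<in>II. u t = u0 t + ph \<kappa> t * u1 t + ph (- \<kappa>) t * u2 t" using assms(2) unfolding HT_def by blast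
  show ?thesis unfolding HT_def
    by (rule exI[of _ "\<lambda>t. u0 (- t)"], rule exI[of _ "\<lambda>t. u2 (- t)"], rule exI[of _ "\<lambda>t. u1 (- t)"])
      (use u in \<open>simp add: HB_reflect[OF assms(1)] ph_minus\<close>)
qed

lemma HB_continuous: "m \<ge> 1 \<Longrightarrow> HB m B w \<Longrightarrow> continuous_on II w"
  by (rule CB_continuous[OF HB_imp_CB])

lemma HT_continuous_bounded:
  assumes "m \<ge> 1" "HT m \<kappa> B u"
  shows "CB 0 (\<lambda>j. 3 * B * \<kappa> ^ j) u"
proof (rule CB_0)
  obtain u0 u1 u2 where u: "HB m B u0" "HB m B u1" "HB m B u2"
    "\<forall>t\<in>II. u t = u0 t + ph \<kappa> t * u1 t + ph (- \<kappa>) t * u2 t" using assms(2) unfolding HT_def by blast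
  have "continuous_on II (\<lambda>t. u0 t + ph \<kappa> t * u1 t + ph (- \<kappa>) t * u2 t)"
    by (intro continuous_on_add continuous_on_mult ph_cont HB_continuous[OF assms(1) u(1)]
        HB_continuous[OF assms(1) u(2)] HB_continuous[OF assms(1) u(3)])
  then show "continuous_on II u" by (rule continuous_on_eq) (use u(4) in simp)
  fix t :: real assume t: "t \<in> II"
  have "norm (w t) \<le> B" if "HB m B w" for w
    using CB_norm[OF HB_imp_CB[OF assms(1) that] t] .
  then have "norm (u0 t) \<le> B" "norm (u1 t) \<le> B" "norm (u2 t) \<le> B" using u by auto
  then show "norm (u t) \<le> 3 * B"
    using u(4) t norm_triangle_ineq[of "u0 t + ph \<kappa> t * u1 t" "ph (- \<kappa>) t * u2 t"] norm_triangle_ineq[of "u0 t" "ph \<kappa> t * u1 t"]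
    by (simp add: norm_mult)
qed

context kernel
begin

text \<open>Two applications of \<open>oscillatory_split\<close> and one of
  \<open>Vop_scaled\<close>.\<close>

definition CQ :: real where "CQ = 2 * (4 ^ m * (M * (real m + 3))) + CV"

lemma CQ_ge: "CQ \<ge> 0" unfolding CQ_def using M_ge CV_ge by simp

text \<open>Multiplication by \<open>ph (- \<kappa>)\<close> shifts the three frequencies to
  \<open>- \<kappa>\<close>, \<open>0\<close> and \<open>- 2 \<kappa>\<close>. The part without
  phase gains a derivative by plain integration; the other two are split. The outer phase leads back
  to \<open>0\<close>, \<open>\<kappa>\<close> and \<open>- \<kappa>\<close>, so this set of
  frequencies is stable.\<close>

lemma Aop_HT:
  assumes u: "HT m \<kappa> B u" and \<kappa>: "\<kappa> \<ge> 1"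
  shows "CT m \<kappa> (CQ * B) (Aop D \<kappa> u)"
proof -
  let ?C = "4 ^ m * (M * (real m + 3)) * B"
  obtain u0 u1 u2 where u: "HB m B u0" "HB m B u1" "HB m B u2"
    "\<forall>t\<in>II. u t = u0 t + ph \<kappa> t * u1 t + ph (- \<kappa>) t * u2 t" using u unfolding HT_def by blast
  have B0: "0 \<le> B" using order_trans[OF norm_ge_zero CB_norm[OF HB_imp_CB[OF m_ge u(1)], of 0]] by simp
  obtain a b where ab: "CB m (\<lambda>_. ?C) a" "CB m (\<lambda>_. ?C) b"
    "\<And>s. s \<in> II \<Longrightarrow> Vop D (\<lambda>t. ph (- \<kappa>) t * u0 t) s = ph (- \<kappa>) s * a s + b s"
    using oscillatory_split[OF _ u(1), of \<kappa>] \<kappa> by auto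
  obtain a' b' where ab': "CB m (\<lambda>_. ?C) a'" "CB m (\<lambda>_. ?C) b'"
    "\<And>s. s \<in> II \<Longrightarrow> Vop D (\<lambda>t. ph (- (2 * \<kappa>)) t * u2 t) s = ph (- (2 * \<kappa>)) s * a' s + b' s"
    using oscillatory_split[OF _ u(3), of "2 * \<kappa>"] \<kappa> by auto
  \<comment> \<open>The scale with base \<open>1\<close>: the single derivative gained by
    integration leads from order \<open>m - 1\<close> to order \<open>m\<close>.\<close>
  have "CB (m - 1) (\<lambda>j. B * 1 ^ j) u1" using HB_imp_CB[OF m_ge u(2)] by simp
  from Vop_scaled[OF this, of m] have V1: "CB m (\<lambda>_. CV * B) (Vop D u1)" using m_ge by simp
  have c: "continuous_on II u0" "continuous_on II u1" "continuous_on II u2"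
    using HB_continuous[OF m_ge] u by auto
  have eq: "Aop D \<kappa> u s = a s + ph \<kappa> s * (b s + Vop D u1 s + b' s) + ph (- \<kappa>) s * a' s" if s: "s \<in> II" for s
  proof -
    have "Vop D (\<lambda>t. ph (- \<kappa>) t * u t) s = Vop D (\<lambda>t. (ph (- \<kappa>) t * u0 t + u1 t) + ph (- (2 * \<kappa>)) t * u2 t) s"
      by (rule Vop_cong[OF _ s]) (use u(4) in \<open>simp add: distrib_left ph_mult_left\<close>)
    also have "\<dots> = Vop D (\<lambda>t. ph (- \<kappa>) t * u0 t + u1 t) s + Vop D (\<lambda>t. ph (- (2 * \<kappa>)) t * u2 t) s"
      by (rule Vop_add[OF _ _ s]) (intro continuous_on_add continuous_on_mult ph_cont c)+
    also have "Vop D (\<lambda>t. ph (- \<kappa>) t * u0 t + u1 t) s = Vop D (\<lambda>t. ph (- \<kappa>) t * u0 t) s + Vop D u1 s"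
      by (rule Vop_add[OF _ _ s]) (intro continuous_on_add continuous_on_mult ph_cont c)+
    finally have "Vop D (\<lambda>t. ph (- \<kappa>) t * u t) s = ph (- \<kappa>) s * a s + b s + Vop D u1 s + (ph (- (2 * \<kappa>)) s * a' s + b' s)"
      using ab(3)[OF s] ab'(3)[OF s] by simp
    then show ?thesis unfolding Aop_def by (simp add: distrib_left ph_mult_left)
  qed
  have CQB: "CQ * B = ?C + CV * B + ?C" by (simp add: CQ_def algebra_simps)
  have C0: "0 \<le> ?C" using M_ge B0 by simp
  have mid: "CB m (\<lambda>_. CQ * B) (\<lambda>s. b s + Vop D u1 s + b' s)"
    unfolding CQB by (intro CB_add ab ab' V1)
  have "0 \<le> CV * B" using B0 CV_ge by simp
  then have le: "?C \<le> CQ * B" unfolding CQB using C0 by linarith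
  show ?thesis unfolding CT_def
    by (rule exI[of _ a], rule exI[of _ "\<lambda>s. b s + Vop D u1 s + b' s"], rule exI[of _ a'])
      (use mid eq in \<open>auto intro: CB_mono[OF ab(1)] CB_mono[OF ab'(1)] le\<close>)
qed

lemma Bop_HT:
  assumes u: "HT m \<kappa> B u" and \<kappa>: "\<kappa> \<ge> 1"
  shows "CT m \<kappa> (CQ * B) (Bop D \<kappa> u)"
proof -
  interpret R: kernel m "reflect D" M by (rule kernel_reflect)
  show ?thesis unfolding Bop_def[abs_def]
    by (rule CT_reflect[OF R.Aop_HT[OF HT_reflect[OF m_ge u] \<kappa>]])
qed

lemma Kop_HT:
  assumes u: "HT m \<kappa> B u" and \<kappa>: "\<kappa> \<ge> 1"
  shows "CT m \<kappa> (2 * CQ * B) (Kop D \<kappa> u)"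
  using CT_add[OF Aop_HT[OF assms] Bop_HT[OF assms]] unfolding Kop_def[abs_def] by (simp add: algebra_simps)

lemma Kop_pow_CT:
  assumes u: "CT m \<kappa> B u" and \<kappa>: "\<kappa> \<ge> 1"
  shows "CT m \<kappa> ((4 * CQ) ^ n * B) ((Kop D \<kappa> ^^ n) u)"
proof (induction n)
  case (Suc n)
  from Kop_HT[OF CT_imp_HT[OF m_ge Suc] \<kappa>] show ?case by (simp add: mult.assoc)
qed (use u in simp)

lemma Kop_pow_HT:
  assumes u: "HT m \<kappa> B u" and \<kappa>: "\<kappa> \<ge> 1"
  shows "CT m \<kappa> ((4 * CQ) ^ n * (2 * CQ * B)) ((Kop D \<kappa> ^^ Suc n) u)"
  using Kop_pow_CT[OF Kop_HT[OF u \<kappa>] \<kappa>, of n] by (simp only: funpow_Suc_right o_apply)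

lemma Aop_pow_CT:
  assumes u: "CB 0 (\<lambda>j. B * \<kappa> ^ j) u" and \<kappa>: "\<kappa> \<ge> 1"
  shows "CT m \<kappa> (CV ^ m * B) ((Aop D \<kappa> ^^ m) u)"
proof -
  have uB: "norm (u t) \<le> B" if "t \<in> II" for t using CB_norm[OF u that] by simp
  have B0: "0 \<le> B" using order_trans[OF norm_ge_zero uB[of 0]] by simp
  have "CB m (\<lambda>_. CV ^ m * B) ((Vop D ^^ m) (\<lambda>t. ph (- \<kappa>) t * u t))"
    by (rule Vop_pow_smoothing) (use uB in \<open>auto intro!: continuous_on_mult ph_cont CB_continuous[OF u] simp: norm_mult\<close>)
  then show ?thesis unfolding CT_def
    by (intro exI[of _ "\<lambda>_. 0"] exI[of _ "(Vop D ^^ m) (\<lambda>t. ph (- \<kappa>) t * u t)"])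
      (use B0 CV_ge in \<open>auto intro!: CB_zero simp: Aop_pow\<close>)
qed

lemma Bop_pow_CT:
  assumes u: "CB 0 (\<lambda>j. B * \<kappa> ^ j) u" and \<kappa>: "\<kappa> \<ge> 1"
  shows "CT m \<kappa> (CV ^ m * B) ((Bop D \<kappa> ^^ m) u)"
proof -
  interpret R: kernel m "reflect D" M by (rule kernel_reflect)
  have "(Bop D \<kappa> ^^ m) u = (\<lambda>t. (Aop (reflect D) \<kappa> ^^ m) (\<lambda>t. u (- t)) (- t))"
    by (rule ext) (rule Bop_pow)
  then show ?thesis using CT_reflect[OF R.Aop_pow_CT[OF CB_reflect[OF u] \<kappa>]] by simp
qed

text \<open>Here \<open>A\<^sup>m u = e\<^bsup>i\<kappa>s\<^esup> V\<^sup>m(e\<^bsup>-i\<kappa>t\<^esup> u)\<close> is \<open>m\<close> times differentiable after removing the phase.\<close>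
lemma Kop_pow_step:
  "\<exists>C\<ge>0. \<forall>\<kappa>\<ge>1. \<forall>B u. CB m (\<lambda>j. B * \<kappa> ^ j) u \<longrightarrow>
    (\<exists>v r. CT m \<kappa> (C * B) v \<and> CB m (\<lambda>j. C * B / \<kappa> * \<kappa> ^ j) r \<and>
      (\<forall>t\<in>II. (Kop D \<kappa> ^^ m) u t = v t + r t))"
proof -
  obtain k where k: "m = Suc k" using m_ge by (cases m) auto
  obtain C where C: "C \<ge> 0" "\<And>\<kappa> B u. \<kappa> \<ge> 1 \<Longrightarrow> CB m (\<lambda>j. B * \<kappa> ^ j) u \<Longrightarrow>
    (\<exists>r. CB m (\<lambda>j. C * B / \<kappa> * \<kappa> ^ j) r \<and>
      (\<forall>t\<in>II. (Kop D \<kappa> ^^ m) u t = (Aop D \<kappa> ^^ m) u t + (Bop D \<kappa> ^^ m) u t + r t))"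
    using Kop_pow_split[of m k] unfolding k by auto
  let ?C = "C + 2 * CV ^ m"
  show ?thesis
  proof (rule exI[of _ ?C], intro conjI allI impI)
    show "0 \<le> ?C" using C(1) CV_ge by simp
    fix \<kappa> B :: real and u assume \<kappa>: "1 \<le> \<kappa>" and u: "CB m (\<lambda>j. B * \<kappa> ^ j) u"
    have B0: "0 \<le> B" using order_trans[OF norm_ge_zero CB_norm[OF u, of 0]] by simp
    obtain r where r: "CB m (\<lambda>j. C * B / \<kappa> * \<kappa> ^ j) r"
      "\<forall>t\<in>II. (Kop D \<kappa> ^^ m) u t = (Aop D \<kappa> ^^ m) u t + (Bop D \<kappa> ^^ m) u t + r t"
      using C(2)[OF \<kappa> u] by blast
    have u0: "CB 0 (\<lambda>j. B * \<kappa> ^ j) u" by (rule CB_mono[OF u]) auto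
    have "CT m \<kappa> (CV ^ m * B + CV ^ m * B) (\<lambda>t. (Aop D \<kappa> ^^ m) u t + (Bop D \<kappa> ^^ m) u t)"
      by (intro CT_add Aop_pow_CT Bop_pow_CT u0 \<kappa>)
    then have v: "CT m \<kappa> (?C * B) (\<lambda>t. (Aop D \<kappa> ^^ m) u t + (Bop D \<kappa> ^^ m) u t)"
      by (rule CT_mono) (use C(1) B0 in \<open>simp add: algebra_simps\<close>)
    have "CB m (\<lambda>j. ?C * B / \<kappa> * \<kappa> ^ j) r"
    proof (rule CB_mono[OF r(1)])
      show "C * B / \<kappa> * \<kappa> ^ j \<le> ?C * B / \<kappa> * \<kappa> ^ j" for j
        by (intro mult_right_mono divide_right_mono) (use B0 CV_ge \<kappa> in auto)
    qed simp
    with v r(2) show "\<exists>v r. CT m \<kappa> (?C * B) v \<and> CB m (\<lambda>j. ?C * B / \<kappa> * \<kappa> ^ j) r \<and>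
      (\<forall>t\<in>II. (Kop D \<kappa> ^^ m) u t = v t + r t)" by blast
  qed
qed

lemma CT_continuous:
  assumes "CT m \<kappa> B u"
  shows "continuous_on II u"
  using HT_continuous_bounded[OF m_ge CT_imp_HT[OF m_ge assms]] by (rule CB_continuous)

text \<open>\<open>Kop_pow_step\<close> is applied again to the remainder only; the part already in
  \<open>CT\<close> stays there under further powers. Each block of \<open>m\<close> factors thus
  contributes one power of \<open>1/\<kappa>\<close>.\<close>

lemma Kop_pow_iterate:
  "\<exists>C\<ge>0. \<forall>\<kappa>\<ge>1. \<forall>B u. CB m (\<lambda>j. B * \<kappa> ^ j) u \<longrightarrow>
    (\<exists>v r. CT m \<kappa> (C * B) v \<and> CB m (\<lambda>j. C * B / \<kappa> ^ k * \<kappa> ^ j) r \<and>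
      (\<forall>t\<in>II. (Kop D \<kappa> ^^ (m * k)) u t = v t + r t))"
proof (induction k)
  case 0
  show ?case
  proof (rule exI[of _ 1], intro conjI allI impI)
    fix \<kappa> B :: real and u assume \<kappa>: "1 \<le> \<kappa>" and u: "CB m (\<lambda>j. B * \<kappa> ^ j) u"
    have B0: "0 \<le> B" using order_trans[OF norm_ge_zero CB_norm[OF u, of 0]] by simp
    show "\<exists>v r. CT m \<kappa> (1 * B) v \<and> CB m (\<lambda>j. 1 * B / \<kappa> ^ 0 * \<kappa> ^ j) r \<and>
      (\<forall>t\<in>II. (Kop D \<kappa> ^^ (m * 0)) u t = v t + r t)"
      by (rule exI[of _ "\<lambda>_. 0"], rule exI[of _ u]) (use u CT_mono[OF CT_zero] B0 in simp)
  qed simp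
next
  case (Suc k)
  obtain C where C: "C \<ge> 0" "\<And>\<kappa> B u. \<kappa> \<ge> 1 \<Longrightarrow> CB m (\<lambda>j. B * \<kappa> ^ j) u \<Longrightarrow>
    (\<exists>v r. CT m \<kappa> (C * B) v \<and> CB m (\<lambda>j. C * B / \<kappa> ^ k * \<kappa> ^ j) r \<and>
      (\<forall>t\<in>II. (Kop D \<kappa> ^^ (m * k)) u t = v t + r t))"
    using Suc by auto
  obtain C' where C': "C' \<ge> 0" "\<And>\<kappa> B u. \<kappa> \<ge> 1 \<Longrightarrow> CB m (\<lambda>j. B * \<kappa> ^ j) u \<Longrightarrow>
    (\<exists>v r. CT m \<kappa> (C' * B) v \<and> CB m (\<lambda>j. C' * B / \<kappa> * \<kappa> ^ j) r \<and>
      (\<forall>t\<in>II. (Kop D \<kappa> ^^ m) u t = v t + r t))"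
    using Kop_pow_step by auto
  let ?C = "(4 * CQ) ^ m * C + C' * C"
  show ?case
  proof (rule exI[of _ ?C], intro conjI allI impI)
    show C0: "0 \<le> ?C" using C(1) C'(1) CQ_ge by simp
    fix \<kappa> B :: real and u assume \<kappa>: "1 \<le> \<kappa>" and u: "CB m (\<lambda>j. B * \<kappa> ^ j) u"
    have B0: "0 \<le> B" using order_trans[OF norm_ge_zero CB_norm[OF u, of 0]] by simp
    obtain v r where v: "CT m \<kappa> (C * B) v" and r: "CB m (\<lambda>j. C * B / \<kappa> ^ k * \<kappa> ^ j) r"
      and e: "\<And>t. t \<in> II \<Longrightarrow> (Kop D \<kappa> ^^ (m * k)) u t = v t + r t"
      using C(2)[OF \<kappa> u] by blast
    obtain v' r' where v': "CT m \<kappa> (C' * (C * B / \<kappa> ^ k)) v'" and r': "CB m (\<lambda>j. C' * (C * B / \<kappa> ^ k) / \<kappa> * \<kappa> ^ j) r'"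
      and e': "\<And>t. t \<in> II \<Longrightarrow> (Kop D \<kappa> ^^ m) r t = v' t + r' t"
      using C'(2)[OF \<kappa> r] by blast
    have "CT m \<kappa> ((4 * CQ) ^ m * (C * B) + C' * (C * B / \<kappa> ^ k)) (\<lambda>t. (Kop D \<kappa> ^^ m) v t + v' t)"
      by (intro CT_add Kop_pow_CT v v' \<kappa>)
    then have V: "CT m \<kappa> (?C * B) (\<lambda>t. (Kop D \<kappa> ^^ m) v t + v' t)"
    proof (rule CT_mono)
      have "C * B / \<kappa> ^ k \<le> C * B / 1"
        by (rule divide_left_mono) (use C(1) B0 \<kappa> in auto)
      then have "C' * (C * B / \<kappa> ^ k) \<le> C' * (C * B)" using C'(1) by (intro mult_left_mono) auto
      then show "(4 * CQ) ^ m * (C * B) + C' * (C * B / \<kappa> ^ k) \<le> ?C * B" by (simp add: algebra_simps)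
    qed
    have R: "CB m (\<lambda>j. ?C * B / \<kappa> ^ Suc k * \<kappa> ^ j) r'"
    proof (rule CB_mono[OF r'])
      fix j
      have "C' * C * B \<le> ?C * B" by (rule mult_right_mono) (use C C' CQ_ge B0 in auto)
      then have "C' * C * B / \<kappa> ^ Suc k * \<kappa> ^ j \<le> ?C * B / \<kappa> ^ Suc k * \<kappa> ^ j"
        by (rule mult_right_mono[OF divide_right_mono]) (use \<kappa> in auto)
      then show "C' * (C * B / \<kappa> ^ k) / \<kappa> * \<kappa> ^ j \<le> ?C * B / \<kappa> ^ Suc k * \<kappa> ^ j"
        by (simp only: power_Suc mult.assoc times_divide_eq_right divide_divide_eq_left mult.commute[of "\<kappa> ^ k" \<kappa>])
    qed simp
    have "(Kop D \<kappa> ^^ (m * Suc k)) u t = ((Kop D \<kappa> ^^ m) v t + v' t) + r' t" if t: "t \<in> II" for t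
    proof -
      have "(Kop D \<kappa> ^^ (m * Suc k)) u t = (Kop D \<kappa> ^^ m) ((Kop D \<kappa> ^^ (m * k)) u) t"
        by (simp add: funpow_add)
      also have "\<dots> = (Kop D \<kappa> ^^ m) (\<lambda>t. v t + r t) t" by (rule Kop_pow_cong[OF e t])
      also have "\<dots> = (Kop D \<kappa> ^^ m) v t + (Kop D \<kappa> ^^ m) r t"
        by (rule Kop_pow_add[OF CT_continuous[OF v] CT_continuous[OF Kop_pow_CT[OF v \<kappa>]]
              CB_continuous[OF r] CB_continuous[OF Kop_pow_scaled[OF r _ \<kappa>]] t]) simp
      finally show ?thesis using e'[OF t] by simp
    qed
    with V R show "\<exists>v r. CT m \<kappa> (?C * B) v \<and> CB m (\<lambda>j. ?C * B / \<kappa> ^ Suc k * \<kappa> ^ j) r \<and>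
      (\<forall>t\<in>II. (Kop D \<kappa> ^^ (m * Suc k)) u t = v t + r t)" by blast
  qed
qed

text \<open>After \<open>m\<close> steps the remainder is \<open>\<kappa>\<^sup>-\<^sup>m\<close> times a function whose derivative of order \<open>j\<close> is
  \<open>O(\<kappa>\<^sup>j)\<close>, so it belongs to the non-oscillating part.\<close>
lemma Kop_pow_CB0_CT:
  "\<exists>C\<ge>0. \<forall>\<kappa>\<ge>1. \<forall>Y y. CB 0 (\<lambda>j. Y * \<kappa> ^ j) y \<longrightarrow> CT m \<kappa> (C * Y) ((Kop D \<kappa> ^^ (m * m + m)) y)"
proof -
  obtain C where C: "C \<ge> 0" "\<And>\<kappa> B u. \<kappa> \<ge> 1 \<Longrightarrow> CB m (\<lambda>j. B * \<kappa> ^ j) u \<Longrightarrow>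
    (\<exists>v r. CT m \<kappa> (C * B) v \<and> CB m (\<lambda>j. C * B / \<kappa> ^ m * \<kappa> ^ j) r \<and>
      (\<forall>t\<in>II. (Kop D \<kappa> ^^ (m * m)) u t = v t + r t))"
    using Kop_pow_iterate[of m] by auto
  let ?C = "2 * C * (2 * CA) ^ m"
  show ?thesis
  proof (rule exI[of _ ?C], intro conjI allI impI)
    show "0 \<le> ?C" using C(1) CA_ge by simp
    fix \<kappa> Y :: real and y assume \<kappa>: "1 \<le> \<kappa>" and y: "CB 0 (\<lambda>j. Y * \<kappa> ^ j) y"
    let ?B = "(2 * CA) ^ m * Y"
    have Y0: "0 \<le> Y" using order_trans[OF norm_ge_zero CB_norm[OF y, of 0]] by simp
    \<comment> \<open>The first \<open>m\<close> factors supply the derivatives that a continuous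
      \<open>y\<close> lacks; the other \<open>m * m\<close> factors supply the \<open>m\<close>
      powers of \<open>1/\<kappa>\<close>.\<close>
    have "CB m (\<lambda>j. ?B * \<kappa> ^ j) ((Kop D \<kappa> ^^ m) y)" by (rule Kop_pow_smoothing[OF y _ \<kappa>]) simp
    from C(2)[OF \<kappa> this] obtain v r where v: "CT m \<kappa> (C * ?B) v" and r: "CB m (\<lambda>j. C * ?B / \<kappa> ^ m * \<kappa> ^ j) r"
      and e: "\<forall>t\<in>II. (Kop D \<kappa> ^^ (m * m)) ((Kop D \<kappa> ^^ m) y) t = v t + r t" by blast
    have B0: "0 \<le> C * ?B" using C(1) CA_ge Y0 by simp
    have "CB m (\<lambda>_. C * ?B) r"
    proof (rule CB_mono[OF r])
      fix j assume "j \<le> m"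
      then have "\<kappa> ^ j \<le> \<kappa> ^ m" using \<kappa> by (intro power_increasing)
      from mult_left_mono[OF this B0] show "C * ?B / \<kappa> ^ m * \<kappa> ^ j \<le> C * ?B" using \<kappa> by (simp add: pos_divide_le_eq)
    qed simp
    then have "CT m \<kappa> (C * ?B) r" unfolding CT_def
      by (intro exI[of _ r] exI[of _ "\<lambda>_. 0"]) (use B0 in \<open>simp add: CB_zero\<close>)
    from CT_add[OF v this] have "CT m \<kappa> (C * ?B + C * ?B) (\<lambda>t. v t + r t)" .
    moreover have "C * ?B + C * ?B = ?C * Y" by simp
    ultimately have "CT m \<kappa> (?C * Y) (\<lambda>t. v t + r t)" by (simp only:)
    then show "CT m \<kappa> (?C * Y) ((Kop D \<kappa> ^^ (m * m + m)) y)"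
    proof (rule CT_cong)
      show "v t + r t = (Kop D \<kappa> ^^ (m * m + m)) y t" if "t \<in> II" for t
        unfolding funpow_add o_apply by (rule bspec[OF e that, symmetric])
    qed
  qed
qed

text \<open>\<open>f\<close> stays outside \<open>CT\<close>, because its amplitudes need not have
  \<open>m\<close> classical derivatives. Keeping \<open>y - f\<close> separate also allows the
  original amplitudes of \<open>f\<close> to be reused in the final decomposition.\<close>

lemma solution_regularity:
  "\<exists>C\<ge>0. \<forall>\<kappa>\<ge>1. \<forall>B Y f y. HT m \<kappa> B f \<longrightarrow> CB 0 (\<lambda>j. Y * \<kappa> ^ j) y \<longrightarrow> (\<forall>s\<in>II. y s = f s + Kop D \<kappa> y s) \<longrightarrow>
     (\<exists>z. CT m \<kappa> (C * (B + Y)) z \<and> (\<forall>s\<in>II. y s = f s + z s))"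
proof -
  obtain C where C: "C \<ge> 0" "\<And>\<kappa> Y y. \<kappa> \<ge> 1 \<Longrightarrow> CB 0 (\<lambda>j. Y * \<kappa> ^ j) y \<Longrightarrow> CT m \<kappa> (C * Y) ((Kop D \<kappa> ^^ (m * m + m)) y)"
    using Kop_pow_CB0_CT by auto
  obtain N where N: "m * m + m = Suc N" using m_ge by (cases "m * m + m") auto
  define S where "S = (\<Sum>n<N. (4 * CQ) ^ n * (2 * CQ))"
  have S0: "S \<ge> 0" unfolding S_def using CQ_ge by (intro sum_nonneg) simp
  show ?thesis
  proof (rule exI[of _ "S + C"], intro conjI allI impI)
    show "0 \<le> S + C" using S0 C by simp
    fix \<kappa> B Y :: real and f y
    assume \<kappa>: "1 \<le> \<kappa>" and f: "HT m \<kappa> B f" and y: "CB 0 (\<lambda>j. Y * \<kappa> ^ j) y" and eq: "\<forall>s\<in>II. y s = f s + Kop D \<kappa> y s"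
    have f0: "CB 0 (\<lambda>j. 3 * B * \<kappa> ^ j) f" by (rule HT_continuous_bounded[OF m_ge f])
    have B0: "0 \<le> B" using order_trans[OF norm_ge_zero CB_norm[OF f0, of 0]] by simp
    have Y0: "0 \<le> Y" using order_trans[OF norm_ge_zero CB_norm[OF y, of 0]] by simp
    \<comment> \<open>The term of order \<open>0\<close> in the expansion is \<open>f\<close>
      itself, hence the shifted index.\<close>
    let ?z = "\<lambda>s. (\<Sum>n<N. (Kop D \<kappa> ^^ Suc n) f s) + (Kop D \<kappa> ^^ Suc N) y s"
    have "CT m \<kappa> ((\<Sum>n<N. (4 * CQ) ^ n * (2 * CQ * B)) + C * Y) ?z"
      unfolding N[symmetric] by (intro CT_add CT_sum Kop_pow_HT[OF f \<kappa>] C(2)[OF \<kappa> y]) simp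
    moreover have "(\<Sum>n<N. (4 * CQ) ^ n * (2 * CQ * B)) = S * B"
      unfolding S_def sum_distrib_right by (simp add: mult.assoc)
    ultimately have "CT m \<kappa> (S * B + C * Y) ?z" by simp
    then have "CT m \<kappa> ((S + C) * (B + Y)) ?z"
      by (rule CT_mono) (use S0 C(1) B0 Y0 in \<open>simp add: algebra_simps\<close>)
    moreover have "y s = f s + ?z s" if s: "s \<in> II" for s
    proof -
      have "y s = (\<Sum>n<Suc N. (Kop D \<kappa> ^^ n) f s) + (Kop D \<kappa> ^^ Suc N) y s"
        by (rule Kop_sum_expansion[OF y f0 \<kappa> _ s]) (use eq in blast)
      also have "(\<Sum>n<Suc N. (Kop D \<kappa> ^^ n) f s) = f s + (\<Sum>n<N. (Kop D \<kappa> ^^ Suc n) f s)"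
        unfolding sum.lessThan_Suc_shift by simp
      finally show ?thesis by (simp only: add.assoc)
    qed
    ultimately show "\<exists>z. CT m \<kappa> ((S + C) * (B + Y)) z \<and> (\<forall>s\<in>II. y s = f s + z s)" by blast
  qed
qed

end

section \<open>From the integral equation to the decomposition of the solution\<close>

lemma AE_eq_continuous:
  fixes u v :: "real \<Rightarrow> complex"
  assumes u: "continuous_on II u" and v: "continuous_on II v"
    and ae: "AE x in lebesgue_on II. u x = v x" and t: "t \<in> II"
  shows "u t = v t"
proof -
  let ?n = "\<lambda>t. norm (u t - v t)"
  have "AE x in lebesgue_on II. ?n x = 0" using ae by eventually_elim simp
  then have "integral II ?n = 0" using AE_eq_integral[of ?n "\<lambda>_. 0" II] by simp
  moreover have "continuous_on (cbox (-1) 1) ?n" using u v by (auto intro!: continuous_intros)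
  ultimately have "\<forall>t\<in>cbox (-1) 1. ?n t = 0"
    using integral_cbox_eq_0_iff[of "-1" 1 ?n] by (auto simp: box_real)
  then show ?thesis using t by simp
qed

lemma continuous_bounded:
  fixes u :: "real \<Rightarrow> complex"
  assumes "continuous_on II u"
  shows "\<exists>Y. \<forall>s\<in>II. norm (u s) \<le> Y"
proof -
  have "continuous_on II (\<lambda>t. norm (u t))" using assms by (intro continuous_intros)
  then obtain s0 where "\<forall>t\<in>II. norm (u t) \<le> norm (u s0)"
    using continuous_attains_sup[of II "\<lambda>t. norm (u t)"] by auto
  then show ?thesis by (rule exI)
qed

lemma H_bound_mono: "H_bound m u c \<Longrightarrow> c \<le> d \<Longrightarrow> H_bound m u d"
  unfolding H_bound_def by (elim ex_forward conj_forward) auto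

context kernel
begin

text \<open>Splitting at \<open>t = s\<close> resolves the absolute value in the phase; the
  substitution \<open>t \<mapsto> - t\<close> brings the upper part into Volterra form.\<close>

lemma solves_IE_operator:
  assumes K: "\<And>s t. s \<in> II \<Longrightarrow> t \<in> II \<Longrightarrow> D 0 0 s t = K s t"
    and y: "continuous_on II y" and eq: "solves_IE K \<kappa> f y" and s: "s \<in> II"
  shows "y s = f s + Kop D \<kappa> y s"
proof -
  let ?g = "\<lambda>t. D 0 0 s t * exp (\<i> * of_real (\<kappa> * \<bar>s - t\<bar>)) * y t"
  have Dc: "continuous_on II (D 0 0 s)" by (rule continuous_on_section[OF D_cont s]) auto
  have gc: "continuous_on II ?g" by (intro continuous_intros Dc y)
  have gi: "integrable (lebesgue_on II) ?g"
    using gc by (simp add: integrable_iff_abs absolutely_integrable_continuous_real)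
  have "integral\<^sup>L (lebesgue_on II) (\<lambda>t. K s t * exp (\<i> * of_real (\<kappa> * \<bar>s - t\<bar>)) * y t) = integral\<^sup>L (lebesgue_on II) ?g"
    by (rule Bochner_Integration.integral_cong) (use K s in auto)
  also have "\<dots> = integral II ?g" by (rule lebesgue_integral_eq_integral[OF gi]) simp
  also have "\<dots> = integral {-1..s} ?g + integral {s..1} ?g"
    by (rule Henstock_Kurzweil_Integration.integral_combine[symmetric])
      (use s gc in \<open>auto intro: integrable_continuous_interval\<close>)
  also have "integral {-1..s} ?g = Aop D \<kappa> y s"
  proof -
    have "integral {-1..s} ?g = integral {-1..s} (\<lambda>t. ph \<kappa> s * (D 0 0 s t * (ph (- \<kappa>) t * y t)))"
    proof (rule integral_cong)
      fix t assume "t \<in> {-1..s}"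
      then have "exp (\<i> * of_real (\<kappa> * \<bar>s - t\<bar>)) = ph \<kappa> s * ph (- \<kappa>) t"
        by (simp add: ph_def exp_add[symmetric] algebra_simps)
      then show "?g t = ph \<kappa> s * (D 0 0 s t * (ph (- \<kappa>) t * y t))" by (simp only: mult_ac)
    qed
    also have "\<dots> = ph \<kappa> s * integral {-1..s} (\<lambda>t. D 0 0 s t * (ph (- \<kappa>) t * y t))"
      by (rule integral_mult_right)
    finally show ?thesis unfolding Aop_def Vop_def .
  qed
  also have "integral {s..1} ?g = Bop D \<kappa> y s"
  proof -
    have "integral {s..1} ?g = integral {s..1} (\<lambda>t. ph (- \<kappa>) s * (D 0 0 s t * (ph \<kappa> t * y t)))"
    proof (rule integral_cong)
      fix t assume "t \<in> {s..1}"
      then have "exp (\<i> * of_real (\<kappa> * \<bar>s - t\<bar>)) = ph (- \<kappa>) s * ph \<kappa> t"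
        by (simp add: ph_def exp_add[symmetric] algebra_simps)
      then show "?g t = ph (- \<kappa>) s * (D 0 0 s t * (ph \<kappa> t * y t))" by (simp only: mult_ac)
    qed
    also have "\<dots> = ph (- \<kappa>) s * integral {s..1} (\<lambda>t. D 0 0 s t * (ph \<kappa> t * y t))"
      by (rule integral_mult_right)
    also have "integral {s..1} (\<lambda>t. D 0 0 s t * (ph \<kappa> t * y t)) = integral {-1..-s} (\<lambda>t. D 0 0 s (- t) * (ph (- \<kappa>) t * y (- t)))"
      using Henstock_Kurzweil_Integration.integral_reflect_real[where f="\<lambda>t. D 0 0 s t * (ph \<kappa> t * y t)" and a=s and b=1]
      by (simp add: ph_minus)
    finally show ?thesis unfolding Bop_def Aop_def Vop_def by (simp add: reflect_def ph_minus)
  qed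
  finally show ?thesis using eq s by (simp add: solves_IE_def Kop_def algebra_simps)
qed

end

text \<open>The given amplitudes coincide with continuous functions only almost everywhere; as
  \<open>f\<close> is continuous, the decomposition with these functions nevertheless holds at every
  point.\<close>

lemma H_bounds_imp_HT:
  assumes m: "m \<ge> 1" and c: "c > 0" and H: "H_bound m u0 c" "H_bound m u1 c" "H_bound m u2 c"
    and f: "continuous_on II f" "\<And>t. t \<in> II \<Longrightarrow> f t = u0 t + ph \<kappa> t * u1 t + ph (- \<kappa>) t * u2 t"
  shows "HT m \<kappa> (3 * c) f"
proof -
  obtain v0 where v0: "HB m (3 * c) v0" "AE x in lebesgue_on II. u0 x = v0 x"
    using H_bound_imp_HB[OF m H(1) c] by blast
  obtain v1 where v1: "HB m (3 * c) v1" "AE x in lebesgue_on II. u1 x = v1 x"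
    using H_bound_imp_HB[OF m H(2) c] by blast
  obtain v2 where v2: "HB m (3 * c) v2" "AE x in lebesgue_on II. u2 x = v2 x"
    using H_bound_imp_HB[OF m H(3) c] by blast
  let ?v = "\<lambda>t. v0 t + ph \<kappa> t * v1 t + ph (- \<kappa>) t * v2 t"
  have vc: "continuous_on II ?v"
    by (intro continuous_on_add continuous_on_mult ph_cont HB_continuous[OF m v0(1)]
        HB_continuous[OF m v1(1)] HB_continuous[OF m v2(1)])
  have "AE x in lebesgue_on II. x \<in> II" by (rule AE_I2) simp
  with v0(2) v1(2) v2(2) have "AE x in lebesgue_on II. f x = ?v x"
    by eventually_elim (simp add: f(2))
  then have "f t = ?v t" if "t \<in> II" for t by (rule AE_eq_continuous[OF f(1) vc _ that])
  then show ?thesis unfolding HT_def using v0(1) v1(1) v2(1) by blast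
qed

theorem theorem5p8:
  fixes m :: nat and K :: "real \<Rightarrow> real \<Rightarrow> complex"
    and f y :: "real \<Rightarrow> real \<Rightarrow> complex"
  assumes "m \<ge> 1"
    and "C_bracket m K"
    and "Htilde_kappa0 m f"
    and "\<forall>\<kappa>>1. continuous_on II (y \<kappa>) \<and> solves_IE K \<kappa> (f \<kappa>) (y \<kappa>)"
    and "\<forall>\<kappa>>1. \<forall>z. continuous_on II z \<and> solves_IE K \<kappa> (f \<kappa>) z \<longrightarrow> (\<forall>s\<in>II. z s = y \<kappa> s)"
  shows "Htilde_kappa0 m y"
proof -
  obtain D M where "kernel m D M" and DK: "\<forall>s\<in>II. \<forall>t\<in>II. D 0 0 s t = K s t"
    using C_bracket_kernel[OF assms(1,2)] by blast
  interpret kernel m D M by fact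
  obtain f0 f1 f2 where H: "H_kappa0 m f0" "H_kappa0 m f1" "H_kappa0 m f2"
    and fdec: "\<forall>\<kappa>>1. \<forall>t\<in>II. f \<kappa> t = f0 \<kappa> t + f1 \<kappa> t * exp (\<i> * of_real (\<kappa> * t))
                                  + f2 \<kappa> t * exp (- \<i> * of_real (\<kappa> * t))"
    using assms(3) unfolding Htilde_kappa0_def by blast
  have fph: "f \<kappa> t = f0 \<kappa> t + ph \<kappa> t * f1 \<kappa> t + ph (- \<kappa>) t * f2 \<kappa> t" if "\<kappa> > 1" "t \<in> II" for \<kappa> t
    using fdec that by (simp add: ph_def mult.commute)
  have yc: "continuous_on II (y \<kappa>)" if "\<kappa> > 1" for \<kappa> using assms(4) that by blast
  have yeq: "y \<kappa> s = f \<kappa> s + Kop D \<kappa> (y \<kappa>) s" if "\<kappa> > 1" "s \<in> II" for \<kappa> s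
    by (rule solves_IE_operator[OF _ yc[OF that(1)] _ that(2)]) (use DK assms(4) that in auto)
  \<comment> \<open>Continuity of \<open>f \<kappa>\<close> is read off from the equation, as both
    \<open>y \<kappa>\<close> and its image under \<open>Kop\<close> are continuous.\<close>
  have fc: "continuous_on II (f \<kappa>)" if k: "\<kappa> > 1" for \<kappa>
  proof -
    obtain Y where "\<forall>s\<in>II. norm (y \<kappa> s) \<le> Y"
      using continuous_bounded[OF yc[OF k]] by (rule exE)
    then have "CB 0 (\<lambda>j. Y * \<kappa> ^ j) (y \<kappa>)" by (intro CB_0 yc k) simp
    from CB_continuous[OF Kop_scaled[OF this, of 0]] have "continuous_on II (Kop D \<kappa> (y \<kappa>))" using k by simp
    then have "continuous_on II (\<lambda>s. y \<kappa> s - Kop D \<kappa> (y \<kappa>) s)" by (intro continuous_intros yc k)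
    then show ?thesis by (rule continuous_on_eq) (use yeq[OF k] in simp)
  qed
  obtain C where C: "C \<ge> 0" "\<And>\<kappa> B Y f y. \<kappa> \<ge> 1 \<Longrightarrow> HT m \<kappa> B f \<Longrightarrow> CB 0 (\<lambda>j. Y * \<kappa> ^ j) y \<Longrightarrow> (\<forall>s\<in>II. y s = f s + Kop D \<kappa> y s) \<Longrightarrow>
     (\<exists>z. CT m \<kappa> (C * (B + Y)) z \<and> (\<forall>s\<in>II. y s = f s + z s))"
    using solution_regularity by auto
  obtain C' \<kappa>1 where C': "C' \<ge> 0" "\<kappa>1 \<ge> 1" "\<And>\<kappa> B f y. \<kappa> \<ge> \<kappa>1 \<Longrightarrow> continuous_on II y \<Longrightarrow> CB 0 (\<lambda>j. B * \<kappa> ^ j) f \<Longrightarrow>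
     (\<forall>s\<in>II. y s = f s + Kop D \<kappa> y s) \<Longrightarrow> (\<forall>s\<in>II. norm (y s) \<le> C' * B)"
    using uniform_bound by auto
  define G where "G = (\<lambda>\<kappa> E w0 w1 w2. H_bound m w0 E \<and> H_bound m w1 E \<and> H_bound m w2 E \<and>
    (\<forall>t\<in>II. y \<kappa> t = w0 t + w1 t * exp (\<i> * of_real (\<kappa> * t)) + w2 t * exp (- \<i> * of_real (\<kappa> * t))))"
  have key: "\<exists>w0 w1 w2. G \<kappa> (2 * (c + sqrt (2 * (real m + 1)) * (C * (3 * c + Y)))) w0 w1 w2"
    if k: "\<kappa> > 1" and c: "c > 0" and Hc: "H_bound m (f0 \<kappa>) c" "H_bound m (f1 \<kappa>) c" "H_bound m (f2 \<kappa>) c"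
      and Y: "\<forall>s\<in>II. norm (y \<kappa> s) \<le> Y" for \<kappa> c Y
  proof -
    have HTf: "HT m \<kappa> (3 * c) (f \<kappa>)"
      by (rule H_bounds_imp_HT[OF assms(1) c Hc fc[OF k] fph[OF k]])
    have y0: "CB 0 (\<lambda>j. Y * \<kappa> ^ j) (y \<kappa>)" by (intro CB_0 yc k) (use Y in simp)
    have "\<exists>z. CT m \<kappa> (C * (3 * c + Y)) z \<and> (\<forall>s\<in>II. y \<kappa> s = f \<kappa> s + z s)"
      by (rule C(2)[OF _ HTf y0]) (use k yeq[OF k] in auto)
    then obtain z z0 z1 z2 where z: "CB m (\<lambda>_. C * (3 * c + Y)) z0" "CB m (\<lambda>_. C * (3 * c + Y)) z1" "CB m (\<lambda>_. C * (3 * c + Y)) z2"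
      "\<And>t. t \<in> II \<Longrightarrow> z t = z0 t + ph \<kappa> t * z1 t + ph (- \<kappa>) t * z2 t" "\<And>s. s \<in> II \<Longrightarrow> y \<kappa> s = f \<kappa> s + z s"
      unfolding CT_def by blast
    \<comment> \<open>The original \<open>f0\<close>, \<open>f1\<close>, \<open>f2\<close> are used,
      for which the decomposition of \<open>f\<close> holds at every point; their continuous
      representatives served to control \<open>z\<close>.\<close>
    have "y \<kappa> t = (f0 \<kappa> t + z0 t) + (f1 \<kappa> t + z1 t) * exp (\<i> * of_real (\<kappa> * t)) + (f2 \<kappa> t + z2 t) * exp (- \<i> * of_real (\<kappa> * t))"
      if t: "t \<in> II" for t
      using z(4,5)[OF t] fph[OF k t] by (simp add: ph_def algebra_simps)
    then have E: "\<forall>t\<in>II. y \<kappa> t = (f0 \<kappa> t + z0 t) + (f1 \<kappa> t + z1 t) * exp (\<i> * of_real (\<kappa> * t)) + (f2 \<kappa> t + z2 t) * exp (- \<i> * of_real (\<kappa> * t))"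
      by (rule ballI)
    show ?thesis unfolding G_def
      by (rule exI[of _ "\<lambda>t. f0 \<kappa> t + z0 t"], rule exI[of _ "\<lambda>t. f1 \<kappa> t + z1 t"], rule exI[of _ "\<lambda>t. f2 \<kappa> t + z2 t"])
        (intro conjI H_bound_add[OF Hc(1) CB_imp_H_bound[OF z(1)]] H_bound_add[OF Hc(2) CB_imp_H_bound[OF z(2)]]
          H_bound_add[OF Hc(3) CB_imp_H_bound[OF z(3)]] E)
  qed
  \<comment> \<open>For small \<kappa> no uniformity is asked for: a bound that depends on \<kappa>
    gives membership in the Sobolev space.\<close>
  have each: "\<exists>E w0 w1 w2. G \<kappa> E w0 w1 w2" if k: "\<kappa> > 1" for \<kappa>
  proof -
    obtain c0 c1 c2 where c: "H_bound m (f0 \<kappa>) c0" "H_bound m (f1 \<kappa>) c1" "H_bound m (f2 \<kappa>) c2"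
      using H k unfolding H_kappa0_def sobolev_H_def by blast
    let ?c = "1 + \<bar>c0\<bar> + \<bar>c1\<bar> + \<bar>c2\<bar>"
    obtain Y where Y: "\<forall>s\<in>II. norm (y \<kappa> s) \<le> Y"
      using continuous_bounded[OF yc[OF k]] by (rule exE)
    have "\<exists>w0 w1 w2. G \<kappa> (2 * (?c + sqrt (2 * (real m + 1)) * (C * (3 * ?c + Y)))) w0 w1 w2"
      by (rule key[OF k _ H_bound_mono[OF c(1)] H_bound_mono[OF c(2)] H_bound_mono[OF c(3)]]) (use Y in auto)
    then show ?thesis by blast
  qed
  obtain c0 k0 where k0: "\<And>\<kappa>. \<kappa> > 1 \<Longrightarrow> \<kappa> \<ge> k0 \<Longrightarrow> H_bound m (f0 \<kappa>) c0" and c0: "c0 > 0"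
    using H(1) unfolding H_kappa0_def by blast
  obtain c1 k1 where k1: "\<And>\<kappa>. \<kappa> > 1 \<Longrightarrow> \<kappa> \<ge> k1 \<Longrightarrow> H_bound m (f1 \<kappa>) c1" and c1: "c1 > 0"
    using H(2) unfolding H_kappa0_def by blast
  obtain c2 k2 where k2: "\<And>\<kappa>. \<kappa> > 1 \<Longrightarrow> \<kappa> \<ge> k2 \<Longrightarrow> H_bound m (f2 \<kappa>) c2" and c2: "c2 > 0"
    using H(3) unfolding H_kappa0_def by blast
  define c where "c = c0 + c1 + c2"
  define ks where "ks = Max {\<kappa>1, k0, k1, k2}"
  have ks: "\<kappa>1 \<le> ks" "k0 \<le> ks" "k1 \<le> ks" "k2 \<le> ks" by (auto simp: ks_def)
  \<comment> \<open>\<open>9 = 3 * 3\<close>: three amplitudes, each bounded by the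
    \<open>3 * c\<close> of \<open>H_bound_imp_HB\<close>.\<close>
  define Y where "Y = C' * (9 * c)"
  define E where "E = 2 * (c + sqrt (2 * (real m + 1)) * (C * (3 * c + Y)))"
  have cpos: "c > 0" using c0 c1 c2 by (simp add: c_def)
  have E: "E > 0" unfolding E_def Y_def using cpos C(1) C'(1) by (simp add: add_pos_nonneg)
  have large: "\<exists>w0 w1 w2. G \<kappa> E w0 w1 w2" if k: "\<kappa> > 1" and kk: "\<kappa> \<ge> ks" for \<kappa>
  proof -
    have Hc: "H_bound m (f0 \<kappa>) c" "H_bound m (f1 \<kappa>) c" "H_bound m (f2 \<kappa>) c"
      using H_bound_mono[OF k0[OF k]] H_bound_mono[OF k1[OF k]] H_bound_mono[OF k2[OF k]] kk ks c0 c1 c2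
      by (auto simp: c_def)
    have HTf: "HT m \<kappa> (3 * c) (f \<kappa>)"
      by (rule H_bounds_imp_HT[OF assms(1) cpos Hc fc[OF k] fph[OF k]])
    have "\<forall>s\<in>II. norm (y \<kappa> s) \<le> C' * (3 * (3 * c))"
      by (rule C'(3)[OF _ yc[OF k] HT_continuous_bounded[OF assms(1) HTf]]) (use kk ks yeq[OF k] in auto)
    then have "\<forall>s\<in>II. norm (y \<kappa> s) \<le> Y" by (simp add: Y_def)
    from key[OF k cpos Hc this] show ?thesis unfolding E_def .
  qed
  \<comment> \<open>One choice of triples has to serve both demands: the uniform bound
    \<open>E\<close> from \<open>ks\<close> on, and some bound for every other
    \<open>\<kappa> > 1\<close>.\<close>
  have "\<forall>\<kappa>. \<exists>w. \<kappa> > 1 \<longrightarrow> (\<exists>E. G \<kappa> E (fst w) (fst (snd w)) (snd (snd w))) \<and>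
      (\<kappa> \<ge> ks \<longrightarrow> G \<kappa> E (fst w) (fst (snd w)) (snd (snd w)))"
  proof
    fix \<kappa>
    show "\<exists>w. \<kappa> > 1 \<longrightarrow> (\<exists>E. G \<kappa> E (fst w) (fst (snd w)) (snd (snd w))) \<and>
      (\<kappa> \<ge> ks \<longrightarrow> G \<kappa> E (fst w) (fst (snd w)) (snd (snd w)))"
    proof (cases "\<kappa> > 1 \<and> \<kappa> \<ge> ks")
      case True
      then obtain w0 w1 w2 where "G \<kappa> E w0 w1 w2" using large by blast
      then show ?thesis by (intro exI[of _ "(w0, w1, w2)"]) auto
    next
      case False
      show ?thesis
      proof (cases "\<kappa> > 1")
        case True
        then obtain E' w0 w1 w2 where "G \<kappa> E' w0 w1 w2" using each by blast
        then show ?thesis using False True by (intro exI[of _ "(w0, w1, w2)"]) auto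
      qed auto
    qed
  qed
  then obtain W where W: "\<forall>\<kappa>. \<kappa> > 1 \<longrightarrow> (\<exists>E. G \<kappa> E (fst (W \<kappa>)) (fst (snd (W \<kappa>))) (snd (snd (W \<kappa>)))) \<and>
      (\<kappa> \<ge> ks \<longrightarrow> G \<kappa> E (fst (W \<kappa>)) (fst (snd (W \<kappa>))) (snd (snd (W \<kappa>))))"
    unfolding choice_iff by (rule exE)
  have kspos: "ks > 0" using ks(1) C'(2) by simp
  have W1: "H_kappa0 m (\<lambda>\<kappa>. fst (W \<kappa>))" "H_kappa0 m (\<lambda>\<kappa>. fst (snd (W \<kappa>)))" "H_kappa0 m (\<lambda>\<kappa>. snd (snd (W \<kappa>)))"
    unfolding H_kappa0_def sobolev_H_def
    using W E kspos unfolding G_def by blast+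
  have W2: "\<forall>\<kappa>>1. \<forall>t\<in>II. y \<kappa> t = fst (W \<kappa>) t + fst (snd (W \<kappa>)) t * exp (\<i> * of_real (\<kappa> * t))
     + snd (snd (W \<kappa>)) t * exp (- \<i> * of_real (\<kappa> * t))"
    using W unfolding G_def by blast
  show ?thesis unfolding Htilde_kappa0_def
    by (rule exI[of _ "\<lambda>\<kappa>. fst (W \<kappa>)"], rule exI[of _ "\<lambda>\<kappa>. fst (snd (W \<kappa>))"], rule exI[of _ "\<lambda>\<kappa>. snd (snd (W \<kappa>))"])
      (intro conjI W1 W2)
qed

end
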